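(* Let $\lambda \in \mathbb{C}$. Then the following conditions are pairwise equivalent: (i) There exists a function $F \in X_{\lambda}(\mathbb{D}^2)$, $F\not\equiv 0$, with $\Omega$ as maximal domain of existence. (ii) There exists a function $g \in C^{2}(\widehat{\mathbb{C}})$, $g\not\equiv 0$, such that $\Delta_{\widehat{\mathbb{C}}}\, g=\lambda g$ on $\widehat{\mathbb{C}}$. (iii) $\lambda=4 m (m+1)$ for some non-negative integer $m$. If one of these conditions holds and $\lambda=4m(m+1)$ with $m$ a non-negative integer, then $\dim X_{\lambda}(\Omega)=2m+1$ and the following statements hold: (a) The domain $\Omega$ is the maximal domain of existence of every $F \in X_\lambda^0(\mathbb{D}^2)$, i.e. $X^0_{\lambda}(\mathbb{D})=\mathcal{R}_h\left(X_{\lambda}(\Omega)\right)$. (b) $\left\{ g \in C^2(\widehat{\mathbb{C}}) : \Delta_{\widehat{\mathbb{C}}}\, g=\lambda g \text{ on } \widehat{\mathbb{C}}\right\}=\big\{\widehat{\mathbb{C}} \ni z \mapsto F(z,-\overline{z}) : F \in X_{\lambda}(\Omega) \big\}$.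
   Context: $\widehat{\mathbb{C}}=\mathbb{C}\cup\{\infty\}$ is the Riemann sphere, $\mathbb{D}$ the open unit disk, $\mathbb{D}^2=\mathbb{D}\times\mathbb{D}$. With the conventions $z\cdot\infty=\infty\cdot z=\infty$ for $z\in\widehat{\mathbb{C}}\setminus\{0\}$ and $0\cdot\infty=\infty\cdot 0=1$, put $\Omega=\{(z,w)\in\widehat{\mathbb{C}}^2: z\cdot w\neq 1\}$, an open complex submanifold of $\widehat{\mathbb{C}}^2$, covered by the standard chart $\Omega\cap\mathbb{C}^2$ and the flip chart $(u,v)\mapsto(1/v,1/u)$ on $\Omega\cap(\widehat{\mathbb{C}}\setminus\{0\})^2$. The operator $\Delta_{zw}=4(1-zw)^2\partial_z\partial_w$ is given by this formula in both charts and is well defined on $\Omega$. $\mathcal{H}(D)$ denotes the holomorphic functions $D\to\mathbb{C}$, and $X_\lambda(D)=\{F\in\mathcal{H}(D):\Delta_{zw}F=\lambda F\text{ on }D\}$ for a subdomain $D\subseteq\Omega$. $\Delta_{\mathbb{D}}=4(1-|z|^2)^2\partial_z\partial_{\overline z}$ on $\mathbb{D}$, and $\Delta_{\widehat{\mathbb{C}}}=-4(1+|z|^2)^2\partial_z\partial_{\overline z}$ on $\widehat{\mathbb{C}}$ (at $\infty$ computed with the same formula in the chart $1/z$). $X_\lambda(\mathbb{D})=\{f\in C^2(\mathbb{D}):\Delta_{\mathbb{D}}f=\lambda f\}$, with the topology of locally uniform convergence. Maximal domain of existence: for $F\in\mathcal{H}(\mathbb{D}^2)$, a subdomain $D\subseteq\Omega$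 with $\mathbb{D}^2\subseteq D$ is a maximal domain of existence of $F$ if $F$ has a holomorphic extension to $D$ but to no strictly larger subdomain of $\Omega$ (so the maximal domain of existence of a constant function is $\Omega$). The hyperbolic restriction map $\mathcal{R}_h:X_\lambda(\mathbb{D}^2)\to X_\lambda(\mathbb{D})$, $\mathcal{R}_h(F)(z)=F(z,\overline z)$, is a linear homeomorphism; $X_\lambda(\Omega)$ is regarded as a subspace of $X_\lambda(\mathbb{D}^2)$ by restriction. A closed subspace $Y$ of $X_\lambda(\mathbb{D})$ is Möbius invariant if $f\circ\psi\in Y$ for all $f\in Y$ and all conformal automorphisms $\psi$ of $\mathbb{D}$; it is non-trivial if $Y\ne\{0\}$ and $Y\neq X_\lambda(\mathbb{D})$. By a theorem of Rudin, for $\lambda=4m(m+1)$, $m\in\{0,1,2,\dots\}$, there is exactly one non-trivial Möbius invariant subspace of $X_\lambda(\mathbb{D})$ that is finite dimensional; it has dimension $2m+1$ and is denoted $X^0_\lambda(\mathbb{D})$. Put $X^0_\lambda(\mathbb{D}^2)=\mathcal{R}_h^{-1}(X^0_\lambda(\mathbb{D}))$. On $\widehat{\mathbb{C}}$, $-\overline{\infty}=\infty$. *)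

theory Defs
  imports "HOL-Analysis.Analysis" "HOL-Library.Function_Algebras"
begin

section \<open>Conventions for function spaces\<close>

text \<open>
  A function on a proper subset \<open>D\<close> of a type is represented by the total function that is \<open>0\<close>
  off \<open>D\<close>. So equality of functions on \<open>D\<close> is HOL equality, and spaces of functions on \<open>D\<close> are
  linear subspaces of the complex vector space of all total functions.
\<close>

definition restrict0 :: "'a set \<Rightarrow> ('a \<Rightarrow> complex) \<Rightarrow> 'a \<Rightarrow> complex" where
  "restrict0 D f = (\<lambda>x. if x \<in> D then f x else 0)"

definition fscale :: "complex \<Rightarrow> ('a \<Rightarrow> complex) \<Rightarrow> 'a \<Rightarrow> complex" where
  "fscale c f = (\<lambda>x. c * f x)"

global_interpretation cfun: vector_space "fscale :: complex \<Rightarrow> ('a \<Rightarrow> complex) \<Rightarrow> 'a \<Rightarrow> complex"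
  by unfold_locales (auto simp: fscale_def algebra_simps)

text \<open>
  The topology of locally uniform convergence on a set \<open>X\<close> of functions on \<open>S\<close>, given through its
  neighbourhoods. It is only used for locally compact \<open>S\<close>, where this is convergence on compacta.
\<close>

definition loc_unif_topology ::
    "'a::topological_space set \<Rightarrow> ('a \<Rightarrow> complex) set \<Rightarrow> ('a \<Rightarrow> complex) topology" where
  "loc_unif_topology S X = topology (\<lambda>U. U \<subseteq> X \<and>
     (\<forall>f\<in>U. \<exists>K e. compact K \<and> K \<subseteq> S \<and> e > 0 \<and>
        {h \<in> X. \<forall>z\<in>K. dist (h z) (f z) < e} \<subseteq> U))"

lemma openin_loc_unif_topology:
  "openin (loc_unif_topology S X) U \<longleftrightarrow> U \<subseteq> X \<and>
     (\<forall>f\<in>U. \<exists>K e. compact K \<and> K \<subseteq> S \<and> e > 0 \<and>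
        {h \<in> X. \<forall>z\<in>K. dist (h z) (f z) < e} \<subseteq> U)"
proof -
  let ?N = "\<lambda>f K e. {h \<in> X. \<forall>z\<in>K. dist (h z) (f z) < (e::real)}"
  let ?P = "\<lambda>U. U \<subseteq> X \<and> (\<forall>f\<in>U. \<exists>K e. compact K \<and> K \<subseteq> S \<and> e > 0 \<and> ?N f K e \<subseteq> U)"
  have "istopology ?P"
    unfolding istopology_def
  proof (intro conjI allI impI)
    fix U V assume U: "?P U" and V: "?P V"
    show "U \<inter> V \<subseteq> X" using U by blast
    show "\<forall>f\<in>U \<inter> V. \<exists>K e. compact K \<and> K \<subseteq> S \<and> e > 0 \<and> ?N f K e \<subseteq> U \<inter> V"
    proof
      fix f assume f: "f \<in> U \<inter> V"
      obtain K e where K: "compact K" "K \<subseteq> S" "e > 0" "?N f K e \<subseteq> U"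
        using conjunct2 [OF U, THEN bspec, OF IntD1 [OF f]] by (elim exE conjE)
      obtain L d where L: "compact L" "L \<subseteq> S" "d > 0" "?N f L d \<subseteq> V"
        using conjunct2 [OF V, THEN bspec, OF IntD2 [OF f]] by (elim exE conjE)
      have "?N f (K \<union> L) (min e d) \<subseteq> ?N f K e" "?N f (K \<union> L) (min e d) \<subseteq> ?N f L d"
        by auto
      with K(4) L(4) have "?N f (K \<union> L) (min e d) \<subseteq> U \<inter> V"
        by (intro Int_greatest) (erule subset_trans, assumption)+
      moreover have "compact (K \<union> L)" "K \<union> L \<subseteq> S" "min e d > 0"
        using K L by (auto intro: compact_Un)
      ultimately show "\<exists>K e. compact K \<and> K \<subseteq> S \<and> e > 0 \<and> ?N f K e \<subseteq> U \<inter> V"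
        by (intro exI conjI)
    qed
  next
    fix \<U> assume *: "\<forall>U\<in>\<U>. ?P U"
    show "\<Union>\<U> \<subseteq> X" using * by blast
    show "\<forall>f\<in>\<Union>\<U>. \<exists>K e. compact K \<and> K \<subseteq> S \<and> e > 0 \<and> ?N f K e \<subseteq> \<Union>\<U>"
    proof
      fix f assume "f \<in> \<Union>\<U>"
      then obtain U where U: "U \<in> \<U>" "f \<in> U" by blast
      have "?P U"
        by (rule bspec [OF * U(1)])
      then have "\<exists>K e. compact K \<and> K \<subseteq> S \<and> e > 0 \<and> ?N f K e \<subseteq> U"
        using U(2) by (elim conjE bspec)
      then obtain K e where K: "compact K" "K \<subseteq> S" "e > 0" "?N f K e \<subseteq> U"
        by (elim exE conjE)
      have "?N f K e \<subseteq> \<Union>\<U>"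
        by (rule subset_trans [OF K(4) Union_upper [OF U(1)]])
      with K(1-3) show "\<exists>K e. compact K \<and> K \<subseteq> S \<and> e > 0 \<and> ?N f K e \<subseteq> \<Union>\<U>"
        by (intro exI conjI)
    qed
  qed
  then show ?thesis
    by (simp add: loc_unif_topology_def topology_inverse')
qed


section \<open>The Riemann sphere and the domain \<open>\<Omega>\<close>\<close>

text \<open>\<open>None\<close> is the point at infinity.\<close>

type_synonym sphere = "complex option"

definition sphere_topology :: "sphere topology" where
  "sphere_topology = Alexandroff_compactification euclidean"

fun sphere_inverse :: "sphere \<Rightarrow> sphere" where
  "sphere_inverse None = Some 0"
| "sphere_inverse (Some z) = (if z = 0 then None else Some (1 / z))"

fun sphere_mult :: "sphere \<Rightarrow> sphere \<Rightarrow> sphere" where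
  "sphere_mult (Some z) (Some w) = Some (z * w)"
| "sphere_mult (Some z) None = (if z = 0 then Some 1 else None)"
| "sphere_mult None (Some w) = (if w = 0 then Some 1 else None)"
| "sphere_mult None None = None"

definition neg_cnj :: "sphere \<Rightarrow> sphere" where
  "neg_cnj = map_option (\<lambda>z. - cnj z)"

definition sphere2_topology :: "(sphere \<times> sphere) topology" where
  "sphere2_topology = prod_topology sphere_topology sphere_topology"

definition Omega :: "(sphere \<times> sphere) set" where
  "Omega = {(z, w). sphere_mult z w \<noteq> Some 1}"

text \<open>The parametrizations inverse to the two charts.\<close>

fun std_chart :: "complex \<times> complex \<Rightarrow> sphere \<times> sphere" where
  "std_chart (z, w) = (Some z, Some w)"

fun flip_chart :: "complex \<times> complex \<Rightarrow> sphere \<times> sphere" where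
  "flip_chart (u, v) = (sphere_inverse (Some v), sphere_inverse (Some u))"

definition subdomain :: "(sphere \<times> sphere) set \<Rightarrow> bool" where
  "subdomain D \<longleftrightarrow> D \<subseteq> Omega \<and> D \<noteq> {} \<and>
     openin sphere2_topology D \<and> connectedin sphere2_topology D"

definition bidisk :: "(sphere \<times> sphere) set" where
  "bidisk = std_chart ` (ball 0 1 \<times> ball 0 1)"


section \<open>Holomorphic functions and eigenfunctions on subdomains of \<open>\<Omega>\<close>\<close>

definition holomorphic2_on :: "(complex \<times> complex \<Rightarrow> complex) \<Rightarrow> (complex \<times> complex) set \<Rightarrow> bool" where
  "holomorphic2_on F U \<longleftrightarrow>
     (\<forall>p\<in>U. \<exists>a b. (F has_derivative (\<lambda>(h, k). a * h + b * k)) (at p within U))"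

definition Hol :: "(sphere \<times> sphere) set \<Rightarrow> (sphere \<times> sphere \<Rightarrow> complex) set" where
  "Hol D = {F. (\<forall>p. p \<notin> D \<longrightarrow> F p = 0) \<and>
     holomorphic2_on (F \<circ> std_chart) (std_chart -` D) \<and>
     holomorphic2_on (F \<circ> flip_chart) (flip_chart -` D)}"

fun laplace_zw_formula :: "(complex \<times> complex \<Rightarrow> complex) \<Rightarrow> complex \<times> complex \<Rightarrow> complex" where
  "laplace_zw_formula F (z, w) =
     4 * (1 - z * w)\<^sup>2 * deriv (\<lambda>s. deriv (\<lambda>t. F (s, t)) w) z"

text \<open>
  The standard chart is used wherever it is available, and the flip chart, in which \<open>(z, w)\<close> has
  coordinates \<open>(1/w, 1/z)\<close>, at the points at infinity. On the overlap both charts give the same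
  value. Only the values of \<open>laplace_zw F\<close> at points of \<open>Omega\<close> are meaningful.
\<close>

fun laplace_zw :: "(sphere \<times> sphere \<Rightarrow> complex) \<Rightarrow> sphere \<times> sphere \<Rightarrow> complex" where
  "laplace_zw F (Some z, Some w) = laplace_zw_formula (F \<circ> std_chart) (z, w)"
| "laplace_zw F (Some z, None) = laplace_zw_formula (F \<circ> flip_chart) (0, 1 / z)"
| "laplace_zw F (None, Some w) = laplace_zw_formula (F \<circ> flip_chart) (1 / w, 0)"
| "laplace_zw F (None, None) = laplace_zw_formula (F \<circ> flip_chart) (0, 0)"

definition X_eig :: "complex \<Rightarrow> (sphere \<times> sphere) set \<Rightarrow> (sphere \<times> sphere \<Rightarrow> complex) set" where
  "X_eig lam D = {F \<in> Hol D. \<forall>p\<in>D. laplace_zw F p = lam * F p}"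

definition maximal_domain_of_existence ::
    "(sphere \<times> sphere) set \<Rightarrow> (sphere \<times> sphere \<Rightarrow> complex) \<Rightarrow> bool" where
  "maximal_domain_of_existence D F \<longleftrightarrow>
     subdomain D \<and> bidisk \<subseteq> D \<and> (\<exists>G\<in>Hol D. \<forall>p\<in>bidisk. G p = F p) \<and>
     (\<forall>D'. subdomain D' \<and> D \<subset> D' \<longrightarrow> \<not> (\<exists>G\<in>Hol D'. \<forall>p\<in>bidisk. G p = F p))"


section \<open>\<open>C\<^sup>2\<close> eigenfunctions on the disk and on the sphere\<close>

definition dx :: "(complex \<Rightarrow> complex) \<Rightarrow> complex \<Rightarrow> complex" where
  "dx f z = frechet_derivative f (at z) 1"

definition dy :: "(complex \<Rightarrow> complex) \<Rightarrow> complex \<Rightarrow> complex" where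
  "dy f z = frechet_derivative f (at z) \<i>"

definition C1_on :: "(complex \<Rightarrow> complex) \<Rightarrow> complex set \<Rightarrow> bool" where
  "C1_on f U \<longleftrightarrow> (\<forall>z\<in>U. f differentiable (at z)) \<and> continuous_on U (dx f) \<and> continuous_on U (dy f)"

definition C2_on :: "(complex \<Rightarrow> complex) \<Rightarrow> complex set \<Rightarrow> bool" where
  "C2_on f U \<longleftrightarrow> C1_on f U \<and> C1_on (dx f) U \<and> C1_on (dy f) U"

definition d_z :: "(complex \<Rightarrow> complex) \<Rightarrow> complex \<Rightarrow> complex" where
  "d_z f z = (dx f z - \<i> * dy f z) / 2"

definition d_zbar :: "(complex \<Rightarrow> complex) \<Rightarrow> complex \<Rightarrow> complex" where
  "d_zbar f z = (dx f z + \<i> * dy f z) / 2"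

definition laplace_disk :: "(complex \<Rightarrow> complex) \<Rightarrow> complex \<Rightarrow> complex" where
  "laplace_disk f z = 4 * (1 - (of_real (cmod z))\<^sup>2)\<^sup>2 * d_z (d_zbar f) z"

definition X_disk :: "complex \<Rightarrow> (complex \<Rightarrow> complex) set" where
  "X_disk lam = {f. (\<forall>z. z \<notin> ball 0 1 \<longrightarrow> f z = 0) \<and> C2_on f (ball 0 1) \<and>
     (\<forall>z\<in>ball 0 1. laplace_disk f z = lam * f z)}"

definition laplace_sphere_formula :: "(complex \<Rightarrow> complex) \<Rightarrow> complex \<Rightarrow> complex" where
  "laplace_sphere_formula g z = - 4 * (1 + (of_real (cmod z))\<^sup>2)\<^sup>2 * d_z (d_zbar g) z"

fun laplace_sphere :: "(sphere \<Rightarrow> complex) \<Rightarrow> sphere \<Rightarrow> complex" where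
  "laplace_sphere g (Some z) = laplace_sphere_formula (\<lambda>s. g (Some s)) z"
| "laplace_sphere g None = laplace_sphere_formula (\<lambda>s. g (sphere_inverse (Some s))) 0"

definition C2_sphere :: "(sphere \<Rightarrow> complex) \<Rightarrow> bool" where
  "C2_sphere g \<longleftrightarrow>
     C2_on (\<lambda>s. g (Some s)) UNIV \<and> C2_on (\<lambda>s. g (sphere_inverse (Some s))) UNIV"


section \<open>Moebius invariant subspaces and the hyperbolic restriction map\<close>

definition disk_automorphism :: "(complex \<Rightarrow> complex) \<Rightarrow> bool" where
  "disk_automorphism \<psi> \<longleftrightarrow> \<psi> holomorphic_on ball 0 1 \<and> bij_betw \<psi> (ball 0 1) (ball 0 1)"

definition moebius_invariant_subspace :: "complex \<Rightarrow> (complex \<Rightarrow> complex) set \<Rightarrow> bool" where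
  "moebius_invariant_subspace lam Y \<longleftrightarrow>
     cfun.subspace Y \<and> closedin (loc_unif_topology (ball 0 1) (X_disk lam)) Y \<and>
     (\<forall>f\<in>Y. \<forall>\<psi>. disk_automorphism \<psi> \<longrightarrow> restrict0 (ball 0 1) (f \<circ> \<psi>) \<in> Y)"

definition finite_dimensional :: "('a \<Rightarrow> complex) set \<Rightarrow> bool" where
  "finite_dimensional Y \<longleftrightarrow> (\<exists>B. finite B \<and> Y = cfun.span B)"

text \<open>
  The definite description is justified by a theorem of Rudin for
  \<open>lam = 4 * m * (m + 1)\<close> with a natural number \<open>m\<close>, and is only used for such \<open>lam\<close>.
\<close>

definition X0_disk :: "complex \<Rightarrow> (complex \<Rightarrow> complex) set" where
  "X0_disk lam = (THE Y. moebius_invariant_subspace lam Y \<and>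
     Y \<noteq> {\<lambda>_. 0} \<and> Y \<noteq> X_disk lam \<and> finite_dimensional Y)"

definition R_h :: "(sphere \<times> sphere \<Rightarrow> complex) \<Rightarrow> complex \<Rightarrow> complex" where
  "R_h F = restrict0 (ball 0 1) (\<lambda>z. F (Some z, Some (cnj z)))"

definition X0_bidisk :: "complex \<Rightarrow> (sphere \<times> sphere \<Rightarrow> complex) set" where
  "X0_bidisk lam = {F \<in> X_eig lam bidisk. R_h F \<in> X0_disk lam}"

end

(*
  An F in X_lambda(Omega) is determined by its restriction g(z) = F(z, -cnj z) to the sphere, which is
  an eigenfunction of the spherical Laplacian. In the variable t = r^2/(1 + r^2) the n-th Fourier
  coefficient of such a g solves a second-order equation on [0, 1]; pairing it with
  (t (1 - t))^(|n|/2) t^j gives a two-term recurrence for its moments. The recurrence forces g = 0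
  unless lambda = 4m(m+1), and in that case leaves one free constant for every |n| <= m. This matches
  the 2m+1 coefficients e_j of the powers of a in the eigenfunctions
  ((z - a)(1 - a w) / (1 - z w))^m, which extend to Omega.
  On the disk, a finite-dimensional invariant space Y is stable under the infinitesimal Moebius
  transformations A (lowering the rotation weight) and B (raising it). On weight n one has
  AB = lambda/4 - n(n+1) and BA = lambda/4 - n(n-1), so only weights |n| <= m occur, the weight-m
  vectors are annihilated by B and hence multiples of z^m / (1 - |z|^2)^m, and they generate Y.
*)
theory Submission
  imports Defs "HOL-Complex_Analysis.Complex_Analysis"
begin

text \<open>In the variable 1 - 2t the radial equation is the associated Legendre equation, singular
  at both ends. The weight (t(1 - t))^(|n|/2) is the shape of its bounded local solutions at either
  end. Pairing with the weight times t^j therefore leaves no boundary terms, and the adjoint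
  operator returns the weight times a combination of t^j and t^(j - 1). Since vanishing moments
  force a function to vanish, a solution is controlled on the whole interval at once, instead of
  matching local expansions at the two ends.

  \<open>X0_disk\<close> is a definite description, so existence is owed as well as uniqueness.
  Uniqueness holds because every candidate equals the span of one list of functions that does not
  mention it; the list is never computed. The candidate for existence consists of the diagonal
  restrictions of the eigenfunctions on Omega. Its delicate point is that it is not the whole
  eigenspace: s(s + 1) has the same value at s = m and at s = -m - 1, and the second exponent gives
  an eigenfunction that is more singular at the boundary.\<close>

section \<open>Fourier coefficients and limits in finite-dimensional function spaces\<close>

text \<open>\<open>H\<close> is stable under multiplication by linear functionals of
  \<open>\<gamma>\<close>, hence by every polynomial in \<open>\<gamma>\<close>, and its members
  have integral 0. Approximating the real part of \<open>k\<close> by such polynomials gives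
  integral 0 for its square, and likewise for the imaginary part. Used with the identity on [0, 1]
  for moments and with \<open>cis\<close> for Fourier coefficients.\<close>

lemma integral_annihilator:
  fixes k :: "'a::euclidean_space \<Rightarrow> complex" and \<gamma> :: "real \<Rightarrow> 'a" and H :: "(real \<Rightarrow> complex) set"
  assumes S: "compact S" "continuous_on S k"
    and \<gamma>: "continuous_on {a..b} \<gamma>" "\<And>t. t \<in> {a..b} \<Longrightarrow> \<gamma> t \<in> S"
    and H: "\<And>h. h \<in> H \<Longrightarrow> continuous_on {a..b} h"
      "\<And>h. h \<in> H \<Longrightarrow> integral {a..b} h = 0"
      "\<And>h g. h \<in> H \<Longrightarrow> g \<in> H \<Longrightarrow> (\<lambda>t. h t + g t) \<in> H"
      "\<And>h c. h \<in> H \<Longrightarrow> (\<lambda>t. complex_of_real c * h t) \<in> H"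
      "\<And>h L. h \<in> H \<Longrightarrow> bounded_linear L \<Longrightarrow> (\<lambda>t. complex_of_real (L (\<gamma> t)) * h t) \<in> H"
    and k: "(\<lambda>t. k (\<gamma> t)) \<in> H" and t: "t \<in> {a..b}" and ab: "a < b"
  shows "k (\<gamma> t) = 0"
proof -
  have poly: "real_polynomial_function p \<Longrightarrow> \<forall>h\<in>H. (\<lambda>t. complex_of_real (p (\<gamma> t)) * h t) \<in> H" for p
  proof (induction rule: real_polynomial_function.induct)
    case (add f g)
    show ?case
    proof
      fix h assume "h \<in> H"
      then have "(\<lambda>t. complex_of_real (f (\<gamma> t)) * h t + complex_of_real (g (\<gamma> t)) * h t) \<in> H"
        using add H(3) by auto
      then show "(\<lambda>t. complex_of_real (f (\<gamma> t) + g (\<gamma> t)) * h t) \<in> H"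
        by (simp add: algebra_simps)
    qed
  next
    case (mult f g)
    show ?case
    proof
      fix h assume "h \<in> H"
      then have "(\<lambda>t. complex_of_real (f (\<gamma> t)) * (complex_of_real (g (\<gamma> t)) * h t)) \<in> H"
        by (rule mult.IH(1)[rule_format, OF mult.IH(2)[rule_format]])
      then show "(\<lambda>t. complex_of_real (f (\<gamma> t) * g (\<gamma> t)) * h t) \<in> H"
        by (simp add: algebra_simps)
    qed
  qed (use H in auto)
  have cont: "continuous_on {a..b} (\<lambda>t. k (\<gamma> t))"
    using H(1)[OF k] .
  \<comment> \<open>The approximation theorem is about real functions, so the real and the imaginary
    part are treated as two instances of one bounded linear \<open>\<phi>\<close>.\<close>
  have main: "\<phi> (k (\<gamma> t)) = 0" if \<phi>: "\<phi> = Re \<or> \<phi> = Im" for \<phi>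
  proof -
    have lin: "bounded_linear \<phi>" using \<phi> bounded_linear_Re bounded_linear_Im by auto
    have c\<phi>: "continuous_on S (\<lambda>x. \<phi> (k x))"
      using \<phi> S(2) by (auto intro: continuous_intros)
    have c\<phi>': "continuous_on {a..b} (\<lambda>t. \<phi> (k (\<gamma> t)))"
      using \<phi> cont by (auto intro: continuous_intros)
    obtain C where C: "C > 0" "\<And>t. t \<in> {a..b} \<Longrightarrow> \<bar>\<phi> (k (\<gamma> t))\<bar> \<le> C"
    proof -
      have "bounded ((\<lambda>t. \<phi> (k (\<gamma> t))) ` {a..b})"
        using c\<phi>' compact_Icc compact_continuous_image compact_imp_bounded by blast
      then show ?thesis
        using that unfolding bounded_pos by auto
    qed
    have int0: "integral {a..b} (\<lambda>t. p (\<gamma> t) * \<phi> (k (\<gamma> t))) = 0" if p: "real_polynomial_function p" for p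
    proof -
      have "(\<lambda>t. complex_of_real (p (\<gamma> t)) * k (\<gamma> t)) \<in> H"
        using poly[OF p] by (rule bspec) (rule k)
      then have "integral {a..b} (\<lambda>t. complex_of_real (p (\<gamma> t)) * k (\<gamma> t)) = 0"
        "(\<lambda>t. complex_of_real (p (\<gamma> t)) * k (\<gamma> t)) integrable_on {a..b}"
        using H(1,2) by (auto intro: integrable_continuous_real)
      then have "integral {a..b} (\<phi> \<circ> (\<lambda>t. complex_of_real (p (\<gamma> t)) * k (\<gamma> t))) = 0"
        using integral_linear[OF _ lin] \<phi> by fastforce
      moreover have "(\<phi> \<circ> (\<lambda>t. complex_of_real (p (\<gamma> t)) * k (\<gamma> t))) = (\<lambda>t. p (\<gamma> t) * \<phi> (k (\<gamma> t)))"
        using \<phi> by auto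
      ultimately show ?thesis by simp
    qed
    have small: "integral {a..b} (\<lambda>t. (\<phi> (k (\<gamma> t)))\<^sup>2) \<le> e" if e: "e > 0" for e
    proof -
      \<comment> \<open>Chosen so that the pointwise bound d * C, integrated over an interval of
        length b - a, gives exactly e.\<close>
      define d where "d = e / (C * (b - a))"
      have d: "d > 0" using e C ab by (simp add: d_def)
      obtain p where p: "real_polynomial_function p" "\<And>x. x \<in> S \<Longrightarrow> \<bar>\<phi> (k x) - p x\<bar> < d"
        using Stone_Weierstrass_real_polynomial_function[OF S(1) c\<phi> d] by blast
      have cp: "continuous_on {a..b} (\<lambda>t. p (\<gamma> t))"
        using continuous_on_compose2[OF continuous_on_polymonial_function[of p UNIV] \<gamma>(1)]
          p(1) real_polynomial_function_eq by auto
      have "integral {a..b} (\<lambda>t. (\<phi> (k (\<gamma> t)))\<^sup>2)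
          = integral {a..b} (\<lambda>t. (\<phi> (k (\<gamma> t)))\<^sup>2) - integral {a..b} (\<lambda>t. p (\<gamma> t) * \<phi> (k (\<gamma> t)))"
        using int0[OF p(1)] by simp
      also have "\<dots> = integral {a..b} (\<lambda>t. (\<phi> (k (\<gamma> t)))\<^sup>2 - p (\<gamma> t) * \<phi> (k (\<gamma> t)))"
        by (rule integral_diff[symmetric])
           (auto intro!: integrable_continuous_real continuous_intros c\<phi>' cp)
      also have "\<dots> \<le> integral {a..b} (\<lambda>t. d * C)"
      proof (rule integral_le)
        fix t assume t: "t \<in> {a..b}"
        have "(\<phi> (k (\<gamma> t)))\<^sup>2 - p (\<gamma> t) * \<phi> (k (\<gamma> t)) = (\<phi> (k (\<gamma> t)) - p (\<gamma> t)) * \<phi> (k (\<gamma> t))"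
          by (simp add: power2_eq_square algebra_simps)
        also have "\<dots> \<le> \<bar>\<phi> (k (\<gamma> t)) - p (\<gamma> t)\<bar> * \<bar>\<phi> (k (\<gamma> t))\<bar>"
          by (metis abs_ge_self abs_mult)
        also have "\<dots> \<le> d * C"
          using p(2)[OF \<gamma>(2)[OF t]] C(2)[OF t] C(1) d by (intro mult_mono) auto
        finally show "(\<phi> (k (\<gamma> t)))\<^sup>2 - p (\<gamma> t) * \<phi> (k (\<gamma> t)) \<le> d * C" .
      qed (auto intro!: integrable_continuous_real continuous_intros c\<phi>' cp)
      also have "\<dots> = e"
        using ab C by (simp add: d_def)
      finally show ?thesis .
    qed
    have "integral {a..b} (\<lambda>t. (\<phi> (k (\<gamma> t)))\<^sup>2) = 0"
    proof (rule antisym)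
      show "integral {a..b} (\<lambda>t. (\<phi> (k (\<gamma> t)))\<^sup>2) \<le> 0"
        by (rule field_le_epsilon) (use small in auto)
    qed (auto intro!: integral_nonneg integrable_continuous_real continuous_intros c\<phi>')
    then have "\<forall>t\<in>cbox a b. (\<phi> (k (\<gamma> t)))\<^sup>2 = 0"
      using ab c\<phi>' by (subst (asm) integral_eq_0_iff) (auto intro!: continuous_intros)
    then show ?thesis using t by auto
  qed
  show ?thesis
    using main[of Re] main[of Im] by (simp add: complex_eq_iff)
qed

text \<open>Multiplication by t shifts the moment index, so the functions with vanishing moments are
  stable under the linear functionals of the real line, which are the multiples of t.\<close>

lemma moments_zero:
  fixes h :: "real \<Rightarrow> complex"
  assumes "continuous_on {0..1} h" "\<And>j::nat. integral {0..1} (\<lambda>t. complex_of_real t ^ j * h t) = 0" "t \<in> {0..1}"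
  shows "h t = 0"
proof -
  let ?H = "{h :: real \<Rightarrow> complex. continuous_on {0..1} h \<and> (\<forall>j::nat. integral {0..1} (\<lambda>t. complex_of_real t ^ j * h t) = 0)}"
  have int: "(\<lambda>t. complex_of_real t ^ j * h t) integrable_on {0..1}" if "h \<in> ?H" for h j
    using that by (auto intro!: integrable_continuous_real continuous_intros)
  show ?thesis
  proof (rule integral_annihilator[of "{0..1}" h 0 1 "\<lambda>t. t" ?H t])
    fix h assume h: "h \<in> ?H"
    show "integral {0..1} h = 0"
      using h by (auto dest: spec[of _ 0])
    show "(\<lambda>t. h t + g t) \<in> ?H" if g: "g \<in> ?H" for g
      using h g int[OF h] int[OF g] by (auto intro!: continuous_intros simp: algebra_simps integral_add)
    show "(\<lambda>t. complex_of_real c * h t) \<in> ?H" for c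
      using h by (auto intro!: continuous_intros simp: mult.left_commute)
    show "(\<lambda>t. complex_of_real (L t) * h t) \<in> ?H" if L: "bounded_linear L" for L
    proof -
      interpret bounded_linear L by fact
      have Lt: "L t = t * L 1" for t using scale[of t 1] by simp
      have "integral {0..1} (\<lambda>t. complex_of_real t ^ j * (complex_of_real (t * L 1) * h t)) = 0" for j
      proof -
        have "(\<lambda>t. complex_of_real t ^ j * (complex_of_real (t * L 1) * h t))
           = (\<lambda>t. complex_of_real (L 1) * (complex_of_real t ^ Suc j * h t))"
          by (auto simp: algebra_simps)
        then show ?thesis using h by (simp del: power_Suc)
      qed
      then show ?thesis using h by (subst Lt) (auto simp del: of_real_mult intro!: continuous_intros)
    qed
  qed (use assms in auto)
qed

section \<open>Fourier coefficients on circles about the origin\<close>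

text \<open>Kept as a function of the point z and not of the radius: for continuous f it is the
  component of f of weight n under rotations, and it can be a member of the same function space as
  f.\<close>

definition M :: "int \<Rightarrow> (complex \<Rightarrow> complex) \<Rightarrow> complex \<Rightarrow> complex" where
  "M n f z = 1 / (2 * pi) * integral {0..2*pi} (\<lambda>t. cis (- (of_int n * t)) * f (cis t * z))"

lemma continuous_on_cis' [continuous_intros]:
  "continuous_on S f \<Longrightarrow> continuous_on S (\<lambda>x. cis (f x))"
  by (simp add: cis_conv_exp continuous_intros)

lemma has_vector_derivative_cis:
  "((\<lambda>t. cis (c * t)) has_vector_derivative (\<i> * of_real c * cis (c * t))) (at t within A)"
proof -
  have "((\<lambda>z. exp (\<i> * (of_real c * z))) has_field_derivative \<i> * of_real c * exp (\<i> * (of_real c * of_real t))) (at (of_real t))"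
    by (auto intro!: derivative_eq_intros)
  then show ?thesis
    using has_vector_derivative_real_field[of "\<lambda>z. exp (\<i> * (of_real c * z))" _ t A]
    by (simp add: cis_conv_exp algebra_simps)
qed

lemma integral_cis:
  "integral {0..2*pi} (\<lambda>t. cis (of_int n * t)) = (if n = 0 then 2 * pi else 0)"
proof (cases "n = 0")
  case False
  have "((\<lambda>t. cis (of_int n * t)) has_integral
      (cis (of_int n * (2*pi)) / (\<i> * of_int n) - cis (of_int n * 0) / (\<i> * of_int n))) {0..2*pi}"
  proof (rule fundamental_theorem_of_calculus)
    fix t :: real
    show "((\<lambda>t. cis (of_int n * t) / (\<i> * of_int n)) has_vector_derivative cis (of_int n * t)) (at t within {0..2*pi})"
      using has_vector_derivative_divide[OF has_vector_derivative_cis[of "of_int n" t], of "\<i> * of_int n"] False by simp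
  qed auto
  moreover have "cis (of_int n * (2*pi)) = 1"
    by (metis cis_multiple_2pi Ints_of_int mult.commute mult.left_commute)
  ultimately show ?thesis using False by (simp add: integral_unique)
qed (simp add: scaleR_conv_of_real)

text \<open>A real-linear functional of cis t is a combination of cis t and cis (-t). Multiplication
  by it shifts the index of the coefficients by one in both directions, so the functions without
  Fourier coefficients are stable under it.\<close>

lemma fourier_zero:
  fixes k :: "complex \<Rightarrow> complex"
  assumes k: "continuous_on (sphere 0 1) k" and M: "\<And>n. M n k 1 = 0" and z: "cmod z = 1"
  shows "k z = 0"
proof -
  let ?H = "{h :: real \<Rightarrow> complex. continuous_on {0..2*pi} h \<and> (\<forall>n::int. integral {0..2*pi} (\<lambda>t. cis (- (of_int n * t)) * h t) = 0)}"
  have int: "(\<lambda>t. cis (- (of_int n * t)) * h t) integrable_on {0..2*pi}" if "h \<in> ?H" for h n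
    using that by (auto intro!: integrable_continuous_real continuous_intros)
  define t where "t = Arg2pi z"
  have t: "t \<in> {0..2*pi}" "z = cis t"
    using Arg2pi[of z] z by (auto simp: t_def cis_conv_exp is_Arg_def)
  have "k (cis t) = 0"
  proof (rule integral_annihilator[of "sphere 0 1" k 0 "2*pi" cis ?H t])
    fix h assume h: "h \<in> ?H"
    show "integral {0..2*pi} h = 0"
      using h by (auto dest: spec[of _ 0])
    show "(\<lambda>t. h t + g t) \<in> ?H" if g: "g \<in> ?H" for g
      using h g int[OF h] int[OF g] by (auto intro!: continuous_intros simp: algebra_simps integral_add)
    show "(\<lambda>t. complex_of_real c * h t) \<in> ?H" for c
      using h by (auto intro!: continuous_intros simp: mult.left_commute)
    show "(\<lambda>t. complex_of_real (L (cis t)) * h t) \<in> ?H" if L: "bounded_linear L" for L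
    proof -
      interpret bounded_linear L by fact
      \<comment> \<open>The constant with L (cis t) = c cis t + cnj c cis (-t), read off from the
        values of L at 1 and at the imaginary unit.\<close>
      define c where "c = Complex (L 1 / 2) (- L \<i> / 2)"
      have Lc: "complex_of_real (L (cis t)) = c * cis t + cnj c * cis (-t)" for t
      proof -
        have "L (cis t) = L (cos t *\<^sub>R 1 + sin t *\<^sub>R \<i>)"
          by (rule arg_cong[of _ _ L]) (simp add: complex_eq_iff)
        also have "\<dots> = cos t * L 1 + sin t * L \<i>" by (simp add: add scale)
        finally show ?thesis by (simp add: complex_eq_iff c_def)
      qed
      have "integral {0..2*pi} (\<lambda>t. cis (- (of_int n * t)) * (complex_of_real (L (cis t)) * h t)) = 0" for n
      proof -
        have "(\<lambda>t. cis (- (of_int n * t)) * (complex_of_real (L (cis t)) * h t))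
           = (\<lambda>t. c * (cis (- (of_int (n-1) * t)) * h t) + cnj c * (cis (- (of_int (n+1) * t)) * h t))"
          unfolding Lc by (auto simp: ring_distribs cis_mult[symmetric] divide_inverse simp flip: cis_divide cis_inverse)
        moreover have "integral {0..2*pi} (\<lambda>t. c * (cis (- (of_int (n-1) * t)) * h t) + cnj c * (cis (- (of_int (n+1) * t)) * h t)) = c * 0 + cnj c * 0"
          by (rule integral_unique[OF has_integral_add[OF has_integral_mult_right has_integral_mult_right]])
             (use h int[OF h] in \<open>auto simp del: of_int_diff of_int_add simp: has_integral_iff\<close>)
        ultimately show ?thesis by (simp only: mult_zero_right add_0_right)
      qed
      moreover have "continuous_on {0..2*pi} (\<lambda>t. complex_of_real (L (cis t)))"
        unfolding Lc by (intro continuous_intros)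
      ultimately show ?thesis using h by (auto intro!: continuous_intros)
    qed
  next
    have "continuous_on {0..2*pi} (\<lambda>t. k (cis t))"
      by (rule continuous_on_compose2[OF k]) (auto intro!: continuous_intros)
    then show "(\<lambda>t. k (cis t)) \<in> ?H"
      using M by (auto simp: M_def)
  qed (use k t in \<open>auto intro!: continuous_intros\<close>)
  then show ?thesis using t by simp
qed


lemma M_cong:
  "(\<And>t. f (cis t * z) = g (cis t * w)) \<Longrightarrow> M n f z = M n g w"
  by (simp add: M_def)

lemma fourier_zero_at:
  assumes f: "continuous_on {\<zeta>. cmod \<zeta> = cmod z} f" and M: "\<And>n. M n f z = 0"
  shows "f z = 0"
proof -
  have "(\<lambda>\<zeta>. f (\<zeta> * z)) 1 = 0"
  proof (rule fourier_zero[where k = "\<lambda>\<zeta>. f (\<zeta> * z)"])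
    show "continuous_on (sphere 0 1) (\<lambda>\<zeta>. f (\<zeta> * z))"
      by (rule continuous_on_compose2[OF f]) (auto intro!: continuous_intros simp: norm_mult)
    show "M n (\<lambda>\<zeta>. f (\<zeta> * z)) 1 = 0" for n
      using M[of n] by (subst M_cong[of _ _ f z]) auto
  qed auto
  then show ?thesis by simp
qed

lemma M_integrable:
  assumes f: "continuous_on {\<zeta>. cmod \<zeta> = cmod z} f"
  shows "(\<lambda>t. cis (- (of_int n * t)) * f (cis t * z)) integrable_on {a..b}"
  by (intro integrable_continuous_real continuous_intros continuous_on_compose2[OF f])
     (auto simp: norm_mult)

lemma M_add:
  assumes "continuous_on {\<zeta>. cmod \<zeta> = cmod z} f" "continuous_on {\<zeta>. cmod \<zeta> = cmod z} g"
  shows "M n (\<lambda>x. f x + g x) z = M n f z + M n g z"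
  using M_integrable[OF assms(1), of n 0 "2*pi"] M_integrable[OF assms(2), of n 0 "2*pi"]
  by (simp add: M_def integral_add ring_distribs)

lemma M_cmult: "M n (\<lambda>x. c * f x) z = c * M n f z"
proof -
  have "(\<lambda>t. cis (- (of_int n * t)) * (c * f (cis t * z))) = (\<lambda>t. c * (cis (- (of_int n * t)) * f (cis t * z)))"
    by (auto simp: algebra_simps)
  then show ?thesis by (simp add: M_def)
qed

lemma M_weight:
  assumes "\<And>t. f (cis t * z) = cis (of_int n * t) * f z"
  shows "M k f z = (if k = n then f z else 0)"
proof -
  have "integral {0..2*pi} (\<lambda>t. cis (- (of_int k * t)) * f (cis t * z))
     = integral {0..2*pi} (\<lambda>t. cis (of_int (n - k) * t) * f z)"
    unfolding assms mult.assoc[symmetric] cis_mult by (simp add: algebra_simps)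
  then show ?thesis using integral_cis[of "n - k"] by (auto simp: M_def)
qed

text \<open>The trigonometric polynomial with the coefficients of f is subtracted on the unit
  circle. All Fourier coefficients of the difference vanish, and its value at 1 is the
  claim.\<close>

lemma fourier_finite:
  assumes f: "continuous_on {\<zeta>. cmod \<zeta> = cmod z} f" and M: "\<And>n. n \<notin> I \<Longrightarrow> M n f z = 0" and I: "finite I"
  shows "f z = (\<Sum>n\<in>I. M n f z)"
proof -
  define k where "k \<zeta> = f (\<zeta> * z) + (- 1) * (\<Sum>n\<in>I. M n f z * \<zeta> powi n)" for \<zeta>
  have c1: "continuous_on (sphere 0 1) (\<lambda>\<zeta>. f (\<zeta> * z))"
    by (rule continuous_on_compose2[OF f]) (auto intro!: continuous_intros simp: norm_mult)
  have c2: "continuous_on (sphere 0 1) (\<lambda>\<zeta>. M n f z * \<zeta> powi n)" for n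
    by (auto intro!: continuous_intros)
  have Ms: "M j (\<lambda>\<zeta>. \<Sum>n\<in>I'. M n f z * \<zeta> powi n) 1 = (\<Sum>n\<in>I'. if j = n then M n f z else 0)"
    if "finite I'" for I' j using that
  proof (induction I' rule: finite_induct)
    case (insert n I')
    have "M j (\<lambda>\<zeta>. M n f z * \<zeta> powi n) 1 = M n f z * (if j = n then 1 else 0)"
      by (subst M_cmult) (subst M_weight[of _ _ n], auto simp: cis_power_int mult.commute)
    then show ?case
      using insert c2 by (auto simp: M_add continuous_on_sum sphere_def dist_norm)
  qed (simp add: M_def)
  have "k 1 = 0"
  proof (rule fourier_zero[where k = k])
    show "continuous_on (sphere 0 1) k"
      unfolding k_def by (intro continuous_intros c1 c2)
    fix j
    have "M j (\<lambda>\<zeta>. f (\<zeta> * z)) 1 = M j f z"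
      by (rule M_cong) auto
    then have "M j k 1 = M j f z + (- 1) * (\<Sum>n\<in>I. if j = n then M n f z else 0)"
      unfolding k_def using c1 c2
      by (subst M_add) (auto simp: M_cmult[of _ "-1", simplified] Ms I sphere_def dist_norm intro!: continuous_intros)
    also have "\<dots> = 0" using M[of j] I by (auto simp: sum.delta')
    finally show "M j k 1 = 0" .
  qed auto
  then show ?thesis by (simp add: k_def)
qed

text \<open>The substitution t -> t + a only shifts a periodic integrand, and an integral over a
  full period is not affected.\<close>

lemma M_rotate:
  assumes f: "continuous_on {\<zeta>. cmod \<zeta> = cmod z} f"
  shows "M n f (cis a * z) = cis (of_int n * a) * M n f z"
proof -
  define F where "F t = cis (- (of_int n * t)) * f (cis t * z)" for t
  have cF: "continuous_on A F" for A
    unfolding F_def by (intro continuous_intros continuous_on_compose2[OF f]) (auto simp: norm_mult)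
  have per: "F (t + 2 * pi) = F t" for t
  proof -
    have "cis (t + 2*pi) = cis t" by (simp add: cis_mult[symmetric])
    moreover have "cis (2 * pi * of_int n) = 1" by simp
    then have "cis (- (of_int n * (t + 2*pi))) = cis (- (of_int n * t))"
      by (simp add: ring_distribs cis_divide[symmetric] mult_ac flip: cis_inverse)
    ultimately show ?thesis by (simp add: F_def)
  qed
  have shift: "integral {u + c..v + c} F = integral {u..v} (\<lambda>t. F (t + c))" for u v c
    using integral_shift[OF cF, of u v c] by (simp add: o_def add.commute)
  have main: "integral {0..2*pi} (\<lambda>t. F (t + a)) = integral {0..2*pi} F" if a: "0 \<le> a" "a \<le> 2*pi" for a
  proof -
    have i: "F integrable_on {u..v}" for u v using cF by (rule integrable_continuous_real)
    have "integral {0..2*pi} (\<lambda>t. F (t + a)) = integral {a..2*pi + a} F"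
      using shift[of 0 a "2*pi"] by simp
    also have "\<dots> = integral {a..2*pi} F + integral {2*pi..2*pi+a} F"
      by (rule Henstock_Kurzweil_Integration.integral_combine[symmetric]) (use a i in auto)
    also have "integral {2*pi..2*pi+a} F = integral {0..a} F"
      using shift[of 0 "2*pi" a] per by (simp add: add.commute)
    also have "integral {a..2*pi} F + integral {0..a} F = integral {0..2*pi} F"
      using Henstock_Kurzweil_Integration.integral_combine[of 0 a "2*pi" F] a i by (simp add: add.commute)
    finally show ?thesis .
  qed
  \<comment> \<open>\<open>main\<close> covers shifts within one period only, so a is replaced by an
    angle in [0, 2 pi] with the same \<open>cis\<close>. As n is an integer, cis (n a) does not
    change.\<close>
  define b where "b = Arg2pi (cis a)"
  have b: "0 \<le> b" "b \<le> 2*pi" "cis b = cis a"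
    using Arg2pi[of "cis a"] by (auto simp: b_def cis_conv_exp is_Arg_def)
  have cb: "cis (of_int n * b) = cis (of_int n * a)"
    by (metis b(3) cis_power_int)
  have "cis (- (of_int n * t)) * f (cis t * (cis a * z)) = cis (of_int n * a) * F (t + b)" for t
  proof -
    have "cis (t + b) * z = cis t * (cis a * z)" by (simp add: cis_mult[symmetric] b)
    moreover have "cis (of_int n * a) * cis (- (of_int n * (t + b))) = cis (- (of_int n * t))"
      unfolding cb[symmetric] cis_mult by (simp add: algebra_simps)
    ultimately show ?thesis unfolding F_def by (metis mult.assoc)
  qed
  then have "M n f (cis a * z) = cis (of_int n * a) * (1 / (2*pi) * integral {0..2*pi} (\<lambda>t. F (t + b)))"
    by (simp add: M_def)
  also have "\<dots> = cis (of_int n * a) * M n f z"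
    unfolding main[OF b(1,2)] unfolding M_def F_def ..
  finally show ?thesis .
qed

section \<open>Fourier components as limits, and limits in finite-dimensional spaces\<close>

lemma riemann_sums:
  fixes h :: "real \<Rightarrow> complex"
  assumes h: "continuous_on {0..L} h" and L: "L > 0"
  shows "(\<lambda>N. (L / of_nat N) *\<^sub>R (\<Sum>k<N. h (L * of_nat k / of_nat N))) \<longlonglongrightarrow> integral {0..L} h"
proof (rule LIMSEQ_I)
  fix e :: real assume e: "e > 0"
  define d' where "d' = e / (2 * L)"
  have d': "d' > 0" using e L by (simp add: d'_def)
  have "uniformly_continuous_on {0..L} h"
    using h by (intro compact_uniformly_continuous) auto
  then obtain d where d: "d > 0" "\<And>x y. x \<in> {0..L} \<Longrightarrow> y \<in> {0..L} \<Longrightarrow> dist y x < d \<Longrightarrow> dist (h y) (h x) < d'"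
    unfolding uniformly_continuous_on_def using d' by metis
  obtain N0 where N0: "L / d < of_nat N0" "N0 > 0"
    by (metis L d(1) divide_pos_pos dual_order.strict_trans of_nat_0_less_iff reals_Archimedean2)
  show "\<exists>n0. \<forall>N\<ge>n0. norm ((L / of_nat N) *\<^sub>R (\<Sum>k<N. h (L * of_nat k / of_nat N)) - integral {0..L} h) < e"
  proof (intro exI allI impI)
    fix N assume N: "N \<ge> N0"
    then have Npos: "real N > 0" using N0 by auto
    have LN: "L / N < d"
    proof -
      have "L / d < N" using N0 N by linarith
      then show ?thesis using d(1) Npos by (simp add: field_simps)
    qed
    define x where "x k = L * real k / real N" for k
    have x: "x 0 = 0" "x N = L" "x (Suc k) - x k = L / N" "x k \<le> x (Suc k)" "x k \<ge> 0" for k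
      using Npos L by (auto simp: x_def field_simps)
    have xm: "x k \<le> L" if "k \<le> N" for k
      using that Npos L by (auto simp: x_def field_simps mult_left_mono)
    have int: "h integrable_on {u..v}" if "u \<ge> 0" "v \<le> L" for u v
      using that by (intro integrable_continuous_real continuous_on_subset[OF h]) auto
    have part: "norm ((L / N) *\<^sub>R h (x k) - integral {x k..x (Suc k)} h) \<le> L / N * d'" if k: "k < N" for k
    proof -
      have i1: "((\<lambda>t. h (x k)) has_integral (L / N) *\<^sub>R h (x k)) {x k..x (Suc k)}"
        using has_integral_const_real[of "h (x k)" "x k" "x (Suc k)"] x(3)[of k] x(4)[of k] by simp
      have i2: "(h has_integral integral {x k..x (Suc k)} h) {x k..x (Suc k)}"
        using int[of "x k" "x (Suc k)"] x xm[of "Suc k"] k by (simp add: has_integral_integral)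
      have "norm ((L / N) *\<^sub>R h (x k) - integral {x k..x (Suc k)} h) \<le> d' * measure lborel {x k..x (Suc k)}"
      proof (rule has_integral_bound_real[OF _ finite.emptyI has_integral_diff[OF i1 i2]])
        fix t assume t: "t \<in> {x k..x (Suc k)} - {}"
        have "x (Suc k) \<le> L" "x k \<le> L" using xm k by auto
        then have "dist (h (x k)) (h t) < d'"
          using t LN x(3,4,5)[of k] by (intro d(2)) (auto simp: dist_real_def)
        then show "norm (h (x k) - h t) \<le> d'" by (simp add: dist_norm)
      qed (use d' in auto)
      then show ?thesis using x(3)[of k] x(4)[of k] by (simp add: mult.commute)
    qed
    have "integral {0..x k} h = (\<Sum>i<k. integral {x i..x (Suc i)} h)" if "k \<le> N" for k using that
    proof (induction k)
      case (Suc k)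
      have "integral {0..x k} h + integral {x k..x (Suc k)} h = integral {0..x (Suc k)} h"
        by (rule Henstock_Kurzweil_Integration.integral_combine) (use x xm[of "Suc k"] Suc.prems int in auto)
      then show ?case using Suc by simp
    qed (simp add: x)
    from this[of N] have "integral {0..L} h = (\<Sum>i<N. integral {x i..x (Suc i)} h)" by (simp add: x)
    then have "norm ((L / N) *\<^sub>R (\<Sum>k<N. h (x k)) - integral {0..L} h)
       = norm (\<Sum>k<N. (L / N) *\<^sub>R h (x k) - integral {x k..x (Suc k)} h)"
      by (simp add: sum_subtractf scaleR_sum_right)
    also have "\<dots> \<le> (\<Sum>k<N. L / N * d')"
      by (rule order_trans[OF norm_sum sum_mono]) (use part in auto)
    also have "\<dots> = e / 2" using Npos L by (simp add: d'_def)
    also have "\<dots> < e" using e by simp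
    finally show "norm ((L / N) *\<^sub>R (\<Sum>k<N. h (L * k / N)) - integral {0..L} h) < e"
      by (simp add: x_def)
  qed
qed

text \<open>The approximating sums are finite linear combinations of rotated copies of f. Hence a
  rotation-invariant linear space that is closed under pointwise limits contains
  \<open>M n f\<close> along with f.\<close>

lemma M_riemann:
  assumes f: "continuous_on {\<zeta>. cmod \<zeta> = cmod z} f"
  shows "(\<lambda>N. (\<Sum>k<N. (cis (- (of_int n * (2 * pi * real k / real N))) / of_nat N) * f (cis (2 * pi * real k / real N) * z))) \<longlonglongrightarrow> M n f z"
proof -
  have pi2: "2 * pi > 0" by simp
  have "continuous_on {0..2*pi} (\<lambda>t. cis (- (of_int n * t)) * f (cis t * z))"
    by (intro continuous_intros continuous_on_compose2[OF f]) (auto simp: norm_mult)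
  from tendsto_mult[OF tendsto_const[of "complex_of_real (1 / (2 * pi))"] riemann_sums[OF this pi2]]
  have "(\<lambda>N. complex_of_real (1 / (2*pi)) * ((2*pi / of_nat N) *\<^sub>R (\<Sum>k<N. cis (- (of_int n * (2*pi * of_nat k / of_nat N))) * f (cis (2*pi * of_nat k / of_nat N) * z))))
     \<longlonglongrightarrow> M n f z"
    by (simp add: M_def)
  then show ?thesis
    by (simp add: scaleR_conv_of_real sum_distrib_left sum_divide_distrib algebra_simps divide_simps)
qed

text \<open>Induction on B without any norm: split off the coefficient c n of b. If the coefficients
  are bounded, a subsequence converges and the induction hypothesis applies to the rest. If not,
  division by large coefficients exhibits -b as a pointwise limit from the smaller span, so b is
  redundant.\<close>

lemma span_pointwise_closed:
  assumes "finite B" "\<And>n. f n \<in> cfun.span B" "\<And>x. (\<lambda>n. f n x) \<longlonglongrightarrow> g x"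
  shows "g \<in> cfun.span B"
  using assms
proof (induction B arbitrary: f g rule: finite_induct)
  case empty
  then have "f n x = 0" for n x by simp
  then have "g x = 0" for x
    using LIMSEQ_unique[OF empty(2)[of x], of 0] by simp
  then show ?case by (auto simp: cfun.span_zero zero_fun_def)
next
  case (insert b B)
  have "\<exists>c. f n - fscale c b \<in> cfun.span B" for n
    using insert.prems(1)[of n] unfolding cfun.span_breakdown_eq .
  then obtain c where c: "\<And>n. f n - fscale (c n) b \<in> cfun.span B" by metis
  show ?case
  proof (cases "bounded (range c)")
    case True
    then obtain l r where r: "strict_mono r" "(c \<circ> r) \<longlonglongrightarrow> l"
      using bounded_imp_convergent_subsequence by blast
    have "g - fscale l b \<in> cfun.span B"
    proof (rule insert.IH[of "\<lambda>n. f (r n) - fscale (c (r n)) b"])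
      fix x
      have "(\<lambda>n. f (r n) x) \<longlonglongrightarrow> g x"
        using LIMSEQ_subseq_LIMSEQ[OF insert.prems(2)[of x] r(1)] by (simp add: o_def)
      with r(2) show "(\<lambda>n. (f (r n) - fscale (c (r n)) b) x) \<longlonglongrightarrow> (g - fscale l b) x"
        by (auto simp: fscale_def o_def intro!: tendsto_intros)
    qed (rule c)
    then show ?thesis unfolding cfun.span_breakdown_eq by blast
  next
    case False
    have "\<exists>n. cmod (c n) > real k" for k
      using False unfolding bounded_iff by (metis not_le rangeE)
    then obtain s where s: "\<And>k. cmod (c (s k)) > real k" by metis
    define c' where "c' k = c (s k)" for k
    have inv0: "(\<lambda>k. inverse (c' k)) \<longlonglongrightarrow> 0"
    proof (rule Lim_null_comparison)
      show "\<forall>\<^sub>F k in sequentially. norm (inverse (c' k)) \<le> inverse (real k)"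
        using eventually_gt_at_top[of 0]
      proof eventually_elim
        case (elim k)
        then show ?case using s[of k] by (auto simp: c'_def norm_inverse intro!: le_imp_inverse_le)
      qed
      show "(\<lambda>k. inverse (real k)) \<longlonglongrightarrow> 0" by (rule lim_inverse_n)
    qed
    \<comment> \<open>For each x the values f n x are bounded, so after division by the growing
      coefficients only -b survives.\<close>
    have "- b \<in> cfun.span B"
    proof (rule insert.IH[of "\<lambda>k. fscale (inverse (c' k)) (f (s k) - fscale (c' k) b)"])
      fix x
      have "bounded (range (\<lambda>n. f n x))"
        using insert.prems(2)[of x] convergent_imp_bounded by blast
      then have "Bseq (\<lambda>k. f (s k) x)"
        unfolding Bseq_eq_bounded by (rule bounded_subset) auto
      then have "(\<lambda>k. inverse (c' k) * f (s k) x) \<longlonglongrightarrow> 0"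
        using bounded_bilinear.Zfun_prod_Bfun[OF bounded_bilinear_mult] inv0 by (simp add: tendsto_Zfun_iff)
      from tendsto_diff[OF this tendsto_const[of "b x"]]
      have *: "(\<lambda>k. inverse (c' k) * f (s k) x - b x) \<longlonglongrightarrow> (- b) x"
        by simp
      show "(\<lambda>k. fscale (inverse (c' k)) (f (s k) - fscale (c' k) b) x) \<longlonglongrightarrow> (- b) x"
      proof (rule tendsto_cong[THEN iffD1, OF _ *])
        show "\<forall>\<^sub>F k in sequentially. inverse (c' k) * f (s k) x - b x = fscale (inverse (c' k)) (f (s k) - fscale (c' k) b) x"
        proof (intro always_eventually allI)
          fix k
          have "c' k \<noteq> 0" using s[of k] by (auto simp: c'_def)
          then show "inverse (c' k) * f (s k) x - b x = fscale (inverse (c' k)) (f (s k) - fscale (c' k) b) x"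
            by (simp add: fscale_def field_simps)
        qed
      qed
    qed (simp only: c'_def cfun.span_scale c)
    then have "b \<in> cfun.span B" using cfun.span_neg[of "-b" B] by simp
    then have eq: "cfun.span (insert b B) = cfun.span B"
      by (rule cfun.span_redundant)
    show ?thesis unfolding eq
      by (rule insert.IH[OF insert.prems(1)[unfolded eq] insert.prems(2)])
  qed
qed

section \<open>Holomorphic functions of two variables\<close>

definition pz :: "(complex \<times> complex \<Rightarrow> complex) \<Rightarrow> complex \<times> complex \<Rightarrow> complex" where
  "pz F p = deriv (\<lambda>s. F (s, snd p)) (fst p)"

definition pw :: "(complex \<times> complex \<Rightarrow> complex) \<Rightarrow> complex \<times> complex \<Rightarrow> complex" where
  "pw F p = deriv (\<lambda>t. F (fst p, t)) (snd p)"

text \<open>Can be checked one variable at a time, and agrees with \<open>holomorphic2_on\<close> on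
  open sets by \<open>holomorphic2_iff\<close>. Continuity is built in, so that Cauchy integrals
  depend continuously on parameters.\<close>

definition sep_holomorphic :: "(complex \<times> complex \<Rightarrow> complex) \<Rightarrow> (complex \<times> complex) set \<Rightarrow> bool" where
  "sep_holomorphic F U \<longleftrightarrow> continuous_on U F \<and>
     (\<forall>z w. (z, w) \<in> U \<longrightarrow> (\<lambda>s. F (s, w)) field_differentiable at z \<and> (\<lambda>t. F (z, t)) field_differentiable at w)"

lemma laplace_zw_formula_eq: "laplace_zw_formula F (z, w) = 4 * (1 - z * w)\<^sup>2 * pz (pw F) (z, w)"
  by (simp add: pz_def pw_def)

lemma pw_swap: "pw F p = pz (F \<circ> prod.swap) (prod.swap p)"
  by (simp add: pz_def pw_def)

lemma pz_swap: "pz F p = pw (F \<circ> prod.swap) (prod.swap p)"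
  by (simp add: pz_def pw_def)

lemma open_swap: "open U \<Longrightarrow> open (prod.swap -` U :: ('a::topological_space \<times> 'b::topological_space) set)"
  by (rule open_vimage) (auto simp: prod.swap_def intro!: continuous_intros)

lemma sep_holomorphic_swap:
  assumes "sep_holomorphic F U"
  shows "sep_holomorphic (F \<circ> prod.swap) (prod.swap -` U)"
proof -
  have "continuous_on (prod.swap -` U) (F \<circ> prod.swap)"
    by (rule continuous_on_compose) (auto simp: prod.swap_def intro!: continuous_intros
        continuous_on_subset[of U F] assms[unfolded sep_holomorphic_def, THEN conjunct1])
  then show ?thesis using assms by (auto simp: sep_holomorphic_def)
qed

lemma holomorphic2_imp_sep:
  assumes F: "holomorphic2_on F U" and U: "open U"
  shows "sep_holomorphic F U"
  unfolding sep_holomorphic_def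
proof (intro conjI allI impI)
  show "continuous_on U F"
    using F by (auto simp: holomorphic2_on_def continuous_on_eq_continuous_within intro: has_derivative_continuous)
  fix z w assume zw: "(z, w) \<in> U"
  then obtain a b where "(F has_derivative (\<lambda>(h, k). a * h + b * k)) (at (z, w) within U)"
    using F by (auto simp: holomorphic2_on_def)
  then have D: "(F has_derivative (\<lambda>(h, k). a * h + b * k)) (at (z, w))"
    by (simp only: at_within_open[OF zw U])
  have "((\<lambda>s. F (s, w)) has_derivative (\<lambda>h. a * h)) (at z)"
    using has_derivative_compose[OF has_derivative_Pair[OF has_derivative_ident has_derivative_const] D] by simp
  then show "(\<lambda>s. F (s, w)) field_differentiable at z"
    unfolding field_differentiable_def has_field_derivative_def by blast
  have "((\<lambda>t. F (z, t)) has_derivative (\<lambda>h. b * h)) (at w)"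
    using has_derivative_compose[OF has_derivative_Pair[OF has_derivative_const has_derivative_ident] D] by simp
  then show "(\<lambda>t. F (z, t)) field_differentiable at w"
    unfolding field_differentiable_def has_field_derivative_def by blast
qed

lemma open_bidisk_nbhd:
  fixes U :: "(complex \<times> complex) set"
  assumes "open U" "(z, w) \<in> U"
  obtains r where "r > 0" "cball z r \<times> cball w r \<subseteq> U"
proof -
  obtain A B where AB: "open A" "open B" "(z, w) \<in> A \<times> B" "A \<times> B \<subseteq> U"
    using open_prod_elim[OF assms] by metis
  obtain r1 where r1: "r1 > 0" "cball z r1 \<subseteq> A" using AB open_contains_cball by auto blast
  obtain r2 where r2: "r2 > 0" "cball w r2 \<subseteq> B" using AB open_contains_cball by auto blast
  have "cball z (min r1 r2) \<times> cball w (min r1 r2) \<subseteq> U"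
    using r1 r2 AB(4) by (auto simp: subset_iff)
  then show ?thesis using that[of "min r1 r2"] r1 r2 by auto
qed

text \<open>Cauchy's formula for the derivative, written as an integral over [0, 1] so that the
  theorems on continuity and differentiation of parameter integrals apply to it.\<close>

lemma pz_integral:
  assumes r: "r > 0" and c: "continuous_on (cball z0 r \<times> B) F"
    and h: "\<And>z w. z \<in> ball z0 r \<Longrightarrow> w \<in> B \<Longrightarrow> (\<lambda>s. F (s, w)) field_differentiable at z"
    and z: "z \<in> ball z0 r" and w: "w \<in> B"
  shows "pz F (z, w) = integral (cbox 0 1)
    (\<lambda>x. F (circlepath z0 r x, w) / (circlepath z0 r x - z)\<^sup>2 * (r * exp (2 * of_real pi * \<i> * x)))"
proof -
  have "continuous_on (cball z0 r) (\<lambda>s. F (s, w))"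
    by (rule continuous_on_compose2[OF c]) (use w in \<open>auto intro!: continuous_intros\<close>)
  moreover have "(\<lambda>s. F (s, w)) holomorphic_on ball z0 r"
    using h w by (auto simp: holomorphic_on_open field_differentiable_def)
  ultimately have "((\<lambda>s. F (s, w)) has_field_derivative
     (1 / (2 * of_real pi * \<i>) * contour_integral (circlepath z0 r) (\<lambda>u. F (u, w) / (u-z)^2))) (at z)"
    using Cauchy_derivative_integral_circlepath(2) z by blast
  then have "pz F (z, w) = 1 / (2 * of_real pi * \<i>) * contour_integral (circlepath z0 r) (\<lambda>u. F (u, w) / (u-z)^2)"
    by (simp add: pz_def DERIV_imp_deriv)
  also have "\<dots> = integral (cbox 0 1)
    (\<lambda>x. F (circlepath z0 r x, w) / (circlepath z0 r x - z)\<^sup>2 * (r * exp (2 * of_real pi * \<i> * x)))"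
    unfolding contour_integral_integral vector_derivative_circlepath
    by (subst integral_mult_right[symmetric]) (simp add: algebra_simps)
  finally show ?thesis .
qed

lemma kernel_continuous:
  fixes F :: "complex \<times> complex \<Rightarrow> complex"
  assumes r: "r > 0" and c: "continuous_on (cball z0 r \<times> B) F"
  shows "continuous_on ((ball z0 r \<times> B) \<times> cbox 0 1)
    (\<lambda>(p, x::real). F (circlepath z0 r x, snd p) / (circlepath z0 r x - fst p)\<^sup>2 * (r * exp (2 * of_real pi * \<i> * x)))"
proof -
  have cp: "cmod (circlepath z0 r x - z0) = r" for x :: real
    using r by (simp add: circlepath norm_mult)
  have ne: "circlepath z0 r x - z \<noteq> 0" if "z \<in> ball z0 r" for x z
    using cp[of x] that by (auto simp: dist_norm norm_minus_commute)
  have cc: "continuous_on A (\<lambda>p. circlepath z0 r (snd p))" for A :: "((complex \<times> complex) \<times> real) set"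
    unfolding circlepath by (intro continuous_intros)
  show ?thesis
    unfolding split_beta
    by (intro continuous_intros cc continuous_on_compose2[OF c])
       (use cp ne in \<open>auto simp: dist_norm norm_minus_commute\<close>)
qed

lemma pz_continuous:
  assumes F: "sep_holomorphic F U" and U: "open U"
  shows "continuous_on U (pz F)"
proof -
  have "continuous (at p) (pz F)" if p: "p \<in> U" for p
  proof -
    obtain z w where pzw: "p = (z, w)" by (cases p)
    obtain r where r: "r > 0" "cball z r \<times> cball w r \<subseteq> U"
      using open_bidisk_nbhd U p pzw by metis
    have sub: "cball z r \<times> ball w r \<subseteq> U" using r(2) by (auto simp: subset_iff)
    have c: "continuous_on (cball z r \<times> ball w r) F"
      using F sub unfolding sep_holomorphic_def by (auto intro: continuous_on_subset)
    have h: "(\<lambda>s. F (s, w')) field_differentiable at z'" if "z' \<in> ball z r" "w' \<in> ball w r" for z' w'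
      using F r(2) that unfolding sep_holomorphic_def by (auto simp: subset_iff)
    have "continuous_on (ball z r \<times> ball w r) (\<lambda>p. integral (cbox 0 1)
      (\<lambda>x. F (circlepath z r x, snd p) / (circlepath z r x - fst p)\<^sup>2 * (r * exp (2 * of_real pi * \<i> * x))))"
      by (rule integral_continuous_on_param) (use kernel_continuous[OF r(1) c] in \<open>simp add: split_beta\<close>)
    then have "continuous_on (ball z r \<times> ball w r) (pz F)"
    proof (rule continuous_on_eq)
      fix p assume "p \<in> ball z r \<times> ball w r"
      then show "integral (cbox 0 1) (\<lambda>x. F (circlepath z r x, snd p) / (circlepath z r x - fst p)\<^sup>2 *
          (r * exp (2 * of_real pi * \<i> * x))) = pz F p"
        using pz_integral[OF r(1) c h, of "fst p" "snd p"] by (cases p) auto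
    qed
    then show ?thesis
      using r(1) pzw by (simp add: continuous_on_eq_continuous_at open_Times)
  qed
  then show ?thesis by (simp add: continuous_at_imp_continuous_on)
qed

lemma pw_continuous:
  assumes F: "sep_holomorphic F U" and U: "open U"
  shows "continuous_on U (pw F)"
proof -
  have "continuous_on (prod.swap -` U) (pz (F \<circ> prod.swap))"
    using pz_continuous[OF sep_holomorphic_swap[OF F] open_swap[OF U]] .
  then have "continuous_on U (\<lambda>p. pz (F \<circ> prod.swap) (prod.swap p))"
    by (rule continuous_on_compose2) (auto simp: prod.swap_def intro!: continuous_intros)
  then show ?thesis by (simp add: pw_swap[abs_def])
qed

lemma pz_DERIV:
  assumes "sep_holomorphic F U" "(z, w) \<in> U"
  shows "((\<lambda>s. F (s, w)) has_field_derivative pz F (z, w)) (at z)"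
  using assms by (auto simp: sep_holomorphic_def pz_def DERIV_deriv_iff_field_differentiable)

lemma pw_DERIV:
  assumes "sep_holomorphic F U" "(z, w) \<in> U"
  shows "((\<lambda>t. F (z, t)) has_field_derivative pw F (z, w)) (at w)"
  using assms by (auto simp: sep_holomorphic_def pw_def DERIV_deriv_iff_field_differentiable)

lemma sep_holomorphic_subset: "sep_holomorphic F U \<Longrightarrow> V \<subseteq> U \<Longrightarrow> sep_holomorphic F V"
  by (auto simp: sep_holomorphic_def intro: continuous_on_subset)

text \<open>Cauchy's integral for the z-derivative of G over the circle of radius r about z0. With G
  = \<open>pw F\<close> it is reached from both orders of differentiation.\<close>

definition cauchy_ker :: "(complex \<times> complex \<Rightarrow> complex) \<Rightarrow> complex \<Rightarrow> real \<Rightarrow> complex \<Rightarrow> complex \<Rightarrow> complex" where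
  "cauchy_ker G z0 r z w = integral (cbox 0 1)
     (\<lambda>x. G (circlepath z0 r x, w) / (circlepath z0 r x - z)\<^sup>2 * (r * exp (2 * of_real pi * \<i> * x)))"

text \<open>Cauchy's formula for \<open>pz F\<close> is differentiated in w under the integral sign,
  which the continuity of \<open>pw F\<close> permits.\<close>

lemma pz_hol_w:
  assumes F: "sep_holomorphic F U" and U: "open U" and p: "(z, w) \<in> U"
  shows "\<exists>r>0. cball z r \<times> cball w r \<subseteq> U \<and> (\<forall>z'\<in>ball z r. \<forall>w'\<in>ball w r.
    ((\<lambda>t. pz F (z', t)) has_field_derivative cauchy_ker (pw F) z r z' w') (at w'))"
proof -
  obtain r where r: "r > 0" "cball z r \<times> cball w r \<subseteq> U"
    using open_bidisk_nbhd U p by metis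
  have sub: "cball z r \<times> ball w r \<subseteq> U" using r(2) by (auto simp: subset_iff)
  have c: "continuous_on (cball z r \<times> ball w r) F"
    using F sub unfolding sep_holomorphic_def by (auto intro: continuous_on_subset)
  have cpw: "continuous_on (cball z r \<times> ball w r) (pw F)"
    using pw_continuous[OF F U] sub by (auto intro: continuous_on_subset)
  have h: "(\<lambda>s. F (s, w')) field_differentiable at z'" if "z' \<in> ball z r" "w' \<in> ball w r" for z' w'
    using F r(2) that unfolding sep_holomorphic_def by (auto simp: subset_iff)
  have cp: "circlepath z r x \<in> cball z r" for x :: real
    using r by (simp add: circlepath norm_mult dist_norm)
  have main: "((\<lambda>t. pz F (z', t)) has_field_derivative
     integral (cbox 0 1) (\<lambda>x. pw F (circlepath z r x, w') / (circlepath z r x - z')\<^sup>2 * (r * exp (2 * of_real pi * \<i> * x)))) (at w')"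
    if z': "z' \<in> ball z r" and w': "w' \<in> ball w r" for z' w'
  proof -
    let ?K = "\<lambda>t x. F (circlepath z r x, t) / (circlepath z r x - z')\<^sup>2 * (r * exp (2 * of_real pi * \<i> * x))"
    have "((\<lambda>t. integral (cbox 0 1) (?K t)) has_field_derivative
     integral (cbox 0 1) (\<lambda>x. pw F (circlepath z r x, w') / (circlepath z r x - z')\<^sup>2 * (r * exp (2 * of_real pi * \<i> * x)))) (at w' within ball w r)"
    proof (rule leibniz_rule_field_derivative)
      fix t and x :: real assume t: "t \<in> ball w r"
      have "(circlepath z r x, t) \<in> U" using cp[of x] t r by (auto simp: subset_iff)
      from pw_DERIV[OF F this]
      show "((\<lambda>t. ?K t x) has_field_derivative
         pw F (circlepath z r x, t) / (circlepath z r x - z')\<^sup>2 * (r * exp (2 * of_real pi * \<i> * x))) (at t within ball w r)"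
        by (rule DERIV_cmult_right[OF DERIV_cdivide[OF DERIV_subset[OF _ subset_UNIV]]])
    next
      fix t assume t: "t \<in> ball w r"
      have "continuous_on (cbox 0 1) (\<lambda>x. (\<lambda>(p, x::real). F (circlepath z r x, snd p) / (circlepath z r x - fst p)\<^sup>2 * (r * exp (2 * of_real pi * \<i> * x))) ((z', t), x))"
        by (rule continuous_on_compose2[OF kernel_continuous[OF r(1) c]]) (use t z' in \<open>auto intro!: continuous_intros\<close>)
      then show "?K t integrable_on cbox 0 1"
        by (intro integrable_continuous) simp
    next
      have "continuous_on (ball w r \<times> cbox 0 1) (\<lambda>q. (\<lambda>(p, x::real). pw F (circlepath z r x, snd p) / (circlepath z r x - fst p)\<^sup>2 * (r * exp (2 * of_real pi * \<i> * x))) ((z', fst q), snd q))"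
        by (rule continuous_on_compose2[OF kernel_continuous[OF r(1) cpw]]) (use z' in \<open>auto intro!: continuous_intros\<close>)
      then show "continuous_on (ball w r \<times> cbox 0 1)
        (\<lambda>(t, x). pw F (circlepath z r x, t) / (circlepath z r x - z')\<^sup>2 * (r * exp (2 * of_real pi * \<i> * x)))"
        by (simp add: split_beta)
    qed (use w' in auto)
    then have D: "((\<lambda>t. integral (cbox 0 1) (?K t)) has_field_derivative
     integral (cbox 0 1) (\<lambda>x. pw F (circlepath z r x, w') / (circlepath z r x - z')\<^sup>2 * (r * exp (2 * of_real pi * \<i> * x)))) (at w')"
      using w' by (simp add: at_within_open[of w' "ball w r"])
    show ?thesis
    proof (rule has_field_derivative_transform_within_open[OF D, of "ball w r"])
      fix t assume "t \<in> ball w r"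
      then show "integral (cbox 0 1) (?K t) = pz F (z', t)"
        using pz_integral[OF r(1) c h z', of t] by simp
    qed (use w' in auto)
  qed
  show ?thesis using r main[folded cauchy_ker_def] by blast
qed

lemma deriv_analytic_differentiable:
  fixes f :: "complex \<Rightarrow> complex"
  assumes "open S" "z \<in> S" "\<And>s. s \<in> S \<Longrightarrow> f field_differentiable at s"
  shows "deriv f field_differentiable at z"
proof -
  have "f holomorphic_on S" using assms by (auto simp: holomorphic_on_open field_differentiable_def)
  then have "deriv f holomorphic_on S" using assms holomorphic_deriv by blast
  then show ?thesis using assms holomorphic_on_imp_differentiable_at by blast
qed

lemma pz_sep:
  assumes F: "sep_holomorphic F U" and U: "open U"
  shows "sep_holomorphic (pz F) U"
  unfolding sep_holomorphic_def
proof (intro conjI allI impI)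
  show "continuous_on U (pz F)" by (rule pz_continuous[OF F U])
  fix z w assume p: "(z, w) \<in> U"
  obtain r where r: "r > 0" "cball z r \<times> cball w r \<subseteq> U" and
    D: "\<forall>z'\<in>ball z r. \<forall>w'\<in>ball w r. ((\<lambda>t. pz F (z', t)) has_field_derivative cauchy_ker (pw F) z r z' w') (at w')"
    using pz_hol_w[OF F U p] by blast
  show "(\<lambda>t. pz F (z, t)) field_differentiable at w"
    using D[rule_format, of z w] r(1) unfolding field_differentiable_def by force
  have "deriv (\<lambda>s. F (s, w)) field_differentiable at z"
    by (rule deriv_analytic_differentiable[of "ball z r"])
       (use r F in \<open>auto simp: sep_holomorphic_def subset_iff\<close>)
  then show "(\<lambda>s. pz F (s, w)) field_differentiable at z" by (simp add: pz_def)
qed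

lemma pw_sep:
  assumes F: "sep_holomorphic F U" and U: "open U"
  shows "sep_holomorphic (pw F) U"
proof -
  have "sep_holomorphic (pz (F \<circ> prod.swap) \<circ> prod.swap) (prod.swap -` (prod.swap -` U))"
    by (intro sep_holomorphic_swap pz_sep open_swap F U)
  moreover have "pz (F \<circ> prod.swap) \<circ> prod.swap = pw F" by (auto simp: pw_swap[abs_def])
  moreover have "prod.swap -` (prod.swap -` U) = U" by auto
  ultimately show ?thesis by simp
qed

text \<open>Differentiating Cauchy's formula for \<open>pz F\<close> in w, and applying Cauchy's
  formula to \<open>pw F\<close>, lead to the same integral.\<close>

lemma pz_pw_commute:
  assumes F: "sep_holomorphic F U" and U: "open U" and p: "p \<in> U"
  shows "pw (pz F) p = pz (pw F) p"
proof -
  obtain z w where pzw: "p = (z, w)" by (cases p)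
  obtain r where r: "r > 0" "cball z r \<times> cball w r \<subseteq> U" and
    D': "\<forall>z'\<in>ball z r. \<forall>w'\<in>ball w r. ((\<lambda>t. pz F (z', t)) has_field_derivative cauchy_ker (pw F) z r z' w') (at w')"
    using pz_hol_w[OF F U p[unfolded pzw]] by blast
  have D: "((\<lambda>t. pz F (z, t)) has_field_derivative cauchy_ker (pw F) z r z w) (at w)"
    using D'[rule_format, of z w] r(1) by simp
  have sw: "sep_holomorphic (pw F) U" by (rule pw_sep[OF F U])
  have "pz (pw F) (z, w) = cauchy_ker (pw F) z r z w"
    unfolding cauchy_ker_def
  proof (rule pz_integral[where B = "ball w r"])
    show "continuous_on (cball z r \<times> ball w r) (pw F)"
      by (rule continuous_on_subset[OF pw_continuous[OF F U]]) (use r(2) in \<open>auto simp: subset_iff\<close>)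
    show "(\<lambda>s. pw F (s, w')) field_differentiable at z'" if "z' \<in> ball z r" "w' \<in> ball w r" for z' w'
      using sw r(2) that unfolding sep_holomorphic_def by (auto simp: subset_iff)
  qed (use r in auto)
  then show ?thesis using DERIV_imp_deriv[OF D] by (simp add: pw_def pzw)
qed

text \<open>Partial derivatives, one of them continuous near the point, give total
  differentiability; the continuity of \<open>pw F\<close> comes from Cauchy's formula.\<close>

lemma sep_has_derivative:
  assumes F: "sep_holomorphic F U" and U: "open U" and p: "(z, w) \<in> U"
  shows "(F has_derivative (\<lambda>(h, k). pz F (z, w) * h + pw F (z, w) * k)) (at (z, w))"
proof -
  obtain r where r: "r > 0" "cball z r \<times> cball w r \<subseteq> U"
    using open_bidisk_nbhd U p by metis
  have sub: "ball z r \<times> ball w r \<subseteq> U" using r(2) by (auto simp: subset_iff)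
  have "((\<lambda>(x, y). F (x, y)) has_derivative (\<lambda>(tx, ty). pz F (z, w) * tx + blinfun_mult_right (pw F (z, w)) ty))
     (at (z, w) within ball z r \<times> ball w r)"
  proof (rule has_derivative_partialsI[where fy = "\<lambda>x y. blinfun_mult_right (pw F (x, y))"])
    show "((\<lambda>x. F (x, w)) has_derivative (*) (pz F (z, w))) (at z within ball z r)"
      using pz_DERIV[OF F p] by (auto simp: has_field_derivative_def intro: has_derivative_at_withinI)
    show "((\<lambda>y. F (x, y)) has_derivative blinfun_apply (blinfun_mult_right (pw F (x, y)))) (at y within ball w r)"
      if "x \<in> ball z r" "y \<in> ball w r" for x y
    proof -
      have "(x, y) \<in> U" using sub that by auto
      then show ?thesis using pw_DERIV[OF F, of x y]
        by (auto simp: has_field_derivative_def intro: has_derivative_at_withinI)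
    qed
    have "continuous_on (ball z r \<times> ball w r) (\<lambda>p. blinfun_mult_right (pw F p))"
      using pw_continuous[OF F U] sub
      by (intro bounded_linear.continuous_on[OF bounded_linear_blinfun_mult_right]) (auto intro: continuous_on_subset)
    then show "continuous (at (z, w) within ball z r \<times> ball w r) (\<lambda>(x, y). blinfun_mult_right (pw F (x, y)))"
      using r(1) by (auto simp: continuous_on_eq_continuous_within case_prod_beta' simp del: mem_ball)
  qed (use r in auto)
  moreover have "at (z, w) within ball z r \<times> ball w r = at (z, w)"
    using r by (intro at_within_open) (auto intro: open_Times)
  ultimately show ?thesis by simp
qed

lemma sep_imp_holomorphic2:
  assumes F: "sep_holomorphic F U" and U: "open U"
  shows "holomorphic2_on F U"
  unfolding holomorphic2_on_def
proof
  fix p assume "p \<in> U"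
  then have "(F has_derivative (\<lambda>(h, k). pz F p * h + pw F p * k)) (at p within U)"
    using sep_has_derivative[OF F U] by (cases p) (auto intro: has_derivative_at_withinI)
  then show "\<exists>a b. (F has_derivative (\<lambda>(h, k). a * h + b * k)) (at p within U)" by blast
qed

lemma holomorphic2_iff: "open U \<Longrightarrow> holomorphic2_on F U \<longleftrightarrow> sep_holomorphic F U"
  using holomorphic2_imp_sep sep_imp_holomorphic2 by blast

section \<open>Wirtinger calculus and identity theorems\<close>

text \<open>The numbers a and b are the Wirtinger derivatives of f at z. As a relation it carries
  differentiability and both derivatives together, so each calculus rule is one application of the
  real rule.\<close>

definition wirt :: "(complex \<Rightarrow> complex) \<Rightarrow> complex \<Rightarrow> complex \<Rightarrow> complex \<Rightarrow> bool" where
  "wirt f a b z \<longleftrightarrow> (f has_derivative (\<lambda>h. a * h + b * cnj h)) (at z)"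

lemma wirtD:
  assumes "wirt f a b z"
  shows "f differentiable (at z)" "dx f z = a + b" "dy f z = \<i> * (a - b)" "d_z f z = a" "d_zbar f z = b"
proof -
  have D: "(f has_derivative (\<lambda>h. a * h + b * cnj h)) (at z)" using assms by (simp add: wirt_def)
  then show "f differentiable (at z)" by (auto simp: differentiable_def)
  show 1: "dx f z = a + b" "dy f z = \<i> * (a - b)"
    using frechet_derivative_at[OF D, symmetric] by (auto simp: dx_def dy_def algebra_simps)
  show "d_z f z = a" "d_zbar f z = b" unfolding d_z_def d_zbar_def 1 by (auto simp: field_simps)
qed

lemma wirt_differentiable:
  assumes "f differentiable (at z)"
  shows "wirt f (d_z f z) (d_zbar f z) z"
proof -
  have D: "(f has_derivative frechet_derivative f (at z)) (at z)"
    using assms frechet_derivative_works by blast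
  interpret bounded_linear "frechet_derivative f (at z)" using D by (rule has_derivative_bounded_linear)
  have "frechet_derivative f (at z) h = d_z f z * h + d_zbar f z * cnj h" for h
  proof -
    have "frechet_derivative f (at z) h = frechet_derivative f (at z) (Re h *\<^sub>R 1 + Im h *\<^sub>R \<i>)"
      by (rule arg_cong) (simp add: complex_eq_iff)
    also have "\<dots> = Re h *\<^sub>R dx f z + Im h *\<^sub>R dy f z"
      unfolding dx_def dy_def by (simp only: add scaleR)
    also have "\<dots> = d_z f z * h + d_zbar f z * cnj h"
      by (cases h) (simp add: d_z_def d_zbar_def scaleR_conv_of_real complex_eq_iff field_simps)
    finally show ?thesis .
  qed
  then have "frechet_derivative f (at z) = (\<lambda>h. d_z f z * h + d_zbar f z * cnj h)" by auto
  with D show ?thesis by (simp add: wirt_def)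
qed

lemma wirt_const: "wirt (\<lambda>z. c) 0 0 z"
  by (simp add: wirt_def)

lemma wirt_ident: "wirt (\<lambda>z. z) 1 0 z"
  by (simp add: wirt_def)

lemma wirt_cnj: "wirt cnj 0 1 z"
  by (simp add: wirt_def bounded_linear_cnj bounded_linear_imp_has_derivative)

lemma wirt_add: "wirt f a b z \<Longrightarrow> wirt g c d z \<Longrightarrow> wirt (\<lambda>z. f z + g z) (a + c) (b + d) z"
  unfolding wirt_def by (drule (1) has_derivative_add) (simp add: algebra_simps)

lemma wirt_diff: "wirt f a b z \<Longrightarrow> wirt g c d z \<Longrightarrow> wirt (\<lambda>z. f z - g z) (a - c) (b - d) z"
  unfolding wirt_def by (drule (1) has_derivative_diff) (simp add: algebra_simps)

lemma wirt_mult: "wirt f a b z \<Longrightarrow> wirt g c d z \<Longrightarrow> wirt (\<lambda>z. f z * g z) (f z * c + a * g z) (f z * d + b * g z) z"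
  unfolding wirt_def by (drule (1) has_derivative_mult) (simp add: algebra_simps)

lemma wirt_cmult: "wirt f a b z \<Longrightarrow> wirt (\<lambda>z. c * f z) (c * a) (c * b) z"
  using wirt_mult[OF wirt_const] by force

lemma wirt_comp_cnj: "wirt f a b (cnj z) \<Longrightarrow> wirt (\<lambda>z. f (cnj z)) b a z"
  unfolding wirt_def
  by (drule has_derivative_compose[OF bounded_linear_imp_has_derivative[OF bounded_linear_cnj]])
     (simp add: add.commute)

lemma wirt_cong: "wirt f a b z \<Longrightarrow> open S \<Longrightarrow> z \<in> S \<Longrightarrow> (\<And>x. x \<in> S \<Longrightarrow> f x = g x) \<Longrightarrow> wirt g a b z"
  unfolding wirt_def by (rule has_derivative_transform_within_open)

lemma dx_eq: "dx f z = d_z f z + d_zbar f z" and dy_eq: "dy f z = \<i> * (d_z f z - d_zbar f z)"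
  by (auto simp: d_z_def d_zbar_def field_simps)

lemma C1_on_iff:
  "C1_on f S \<longleftrightarrow> (\<forall>z\<in>S. f differentiable (at z)) \<and> continuous_on S (d_z f) \<and> continuous_on S (d_zbar f)"
proof -
  have "continuous_on S (dx f) \<and> continuous_on S (dy f) \<longleftrightarrow> continuous_on S (d_z f) \<and> continuous_on S (d_zbar f)"
    unfolding dx_eq[abs_def] dy_eq[abs_def] 
  proof safe
    assume 1: "continuous_on S (\<lambda>z. d_z f z + d_zbar f z)" "continuous_on S (\<lambda>z. \<i> * (d_z f z - d_zbar f z))"
    have "continuous_on S (\<lambda>z. ((d_z f z + d_zbar f z) - \<i> * (\<i> * (d_z f z - d_zbar f z))) / 2)"
      "continuous_on S (\<lambda>z. ((d_z f z + d_zbar f z) + \<i> * (\<i> * (d_z f z - d_zbar f z))) / 2)"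
      by (intro continuous_intros 1; simp)+
    then show "continuous_on S (d_z f)" "continuous_on S (d_zbar f)"
      by (auto simp: mult.assoc[symmetric] algebra_simps)
  qed (intro continuous_intros; simp)+
  then show ?thesis by (auto simp: C1_on_def)
qed

lemma C1_onI:
  assumes "\<And>z. z \<in> S \<Longrightarrow> wirt f (a z) (b z) z" "continuous_on S a" "continuous_on S b"
  shows "C1_on f S"
proof -
  have "continuous_on S (d_z f)" "continuous_on S (d_zbar f)"
    using assms(2,3) by (auto simp: wirtD(4,5)[OF assms(1)] cong: continuous_on_cong)
  then show ?thesis using wirtD(1)[OF assms(1)] by (auto simp: C1_on_iff)
qed

lemma C1_wirt: "C1_on f S \<Longrightarrow> z \<in> S \<Longrightarrow> wirt f (d_z f z) (d_zbar f z) z"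
  using wirt_differentiable by (auto simp: C1_on_iff)

lemma C1_continuous: "C1_on f S \<Longrightarrow> continuous_on S f"
  by (auto simp: C1_on_def intro!: continuous_at_imp_continuous_on differentiable_imp_continuous_within)

lemma C1_cong:
  assumes "C1_on f S" "open S" "\<And>z. z \<in> S \<Longrightarrow> f z = g z"
  shows "C1_on g S"
proof (rule C1_onI)
  show "wirt g (d_z f z) (d_zbar f z) z" if "z \<in> S" for z
    using wirt_cong[OF C1_wirt[OF assms(1) that] assms(2) that] assms(3) by blast
qed (use assms(1) in \<open>auto simp: C1_on_iff\<close>)

lemma C1_add: "C1_on f S \<Longrightarrow> C1_on g S \<Longrightarrow> C1_on (\<lambda>z. f z + g z) S"
  by (rule C1_onI[OF wirt_add[OF C1_wirt C1_wirt]]) (auto simp: C1_on_iff intro!: continuous_intros)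

lemma C1_diff: "C1_on f S \<Longrightarrow> C1_on g S \<Longrightarrow> C1_on (\<lambda>z. f z - g z) S"
  by (rule C1_onI[OF wirt_diff[OF C1_wirt C1_wirt]]) (auto simp: C1_on_iff intro!: continuous_intros)

lemma C1_mult: "C1_on f S \<Longrightarrow> C1_on g S \<Longrightarrow> C1_on (\<lambda>z. f z * g z) S"
  using C1_continuous[of f S] C1_continuous[of g S]
  by (intro C1_onI[OF wirt_mult[OF C1_wirt C1_wirt]]) (auto simp: C1_on_iff intro!: continuous_intros)

lemma C1_const: "C1_on (\<lambda>z. c) S"
  by (rule C1_onI[OF wirt_const]) auto

lemma C1_cmult: "C1_on f S \<Longrightarrow> C1_on (\<lambda>z. c * f z) S"
  by (rule C1_mult[OF C1_const])

lemma C1_ident: "C1_on (\<lambda>z. z) S"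
  by (rule C1_onI[OF wirt_ident]) auto

lemma C1_comp_cnj:
  assumes "C1_on f (cnj -` S)"
  shows "C1_on (\<lambda>z. f (cnj z)) S"
proof -
  have c: "continuous_on (cnj -` S) (d_z f)" "continuous_on (cnj -` S) (d_zbar f)" using assms by (auto simp: C1_on_iff)
  have "continuous_on S (\<lambda>z. d_z f (cnj z))" "continuous_on S (\<lambda>z. d_zbar f (cnj z))"
    by (rule continuous_on_compose2[OF c(1)] continuous_on_compose2[OF c(2)]; auto intro!: continuous_intros)+
  then show ?thesis
    by (intro C1_onI[where a="\<lambda>z. d_zbar f (cnj z)" and b="\<lambda>z. d_z f (cnj z)"])
       (auto intro!: wirt_comp_cnj C1_wirt[OF assms])
qed

lemma C2_iff: "C2_on f S \<longleftrightarrow> C1_on f S \<and> C1_on (d_z f) S \<and> C1_on (d_zbar f) S"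
proof -
  have "C1_on (dx f) S \<and> C1_on (dy f) S \<longleftrightarrow> C1_on (d_z f) S \<and> C1_on (d_zbar f) S"
    unfolding dx_eq[abs_def] dy_eq[abs_def]
  proof safe
    assume 1: "C1_on (\<lambda>z. d_z f z + d_zbar f z) S" "C1_on (\<lambda>z. \<i> * (d_z f z - d_zbar f z)) S"
    have "C1_on (\<lambda>z. (1/2) * ((d_z f z + d_zbar f z) - \<i> * (\<i> * (d_z f z - d_zbar f z)))) S"
      "C1_on (\<lambda>z. (1/2) * ((d_z f z + d_zbar f z) + \<i> * (\<i> * (d_z f z - d_zbar f z)))) S"
      by (intro C1_cmult C1_add C1_diff 1 C1_mult C1_const)+
    then show "C1_on (d_z f) S" "C1_on (d_zbar f) S"
      by (auto simp: mult.assoc[symmetric] algebra_simps)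
  qed (intro C1_cmult C1_add C1_diff; assumption)+
  then show ?thesis by (auto simp: C2_on_def)
qed

lemma d_z_cong:
  assumes "C1_on f S" "open S" "\<And>z. z \<in> S \<Longrightarrow> f z = g z" "z \<in> S"
  shows "d_z g z = d_z f z" "d_zbar g z = d_zbar f z"
  using wirtD(4,5)[OF wirt_cong[OF C1_wirt[OF assms(1,4)] assms(2,4,3)]] by auto

lemma C2_cong:
  assumes "C2_on f S" "open S" "\<And>z. z \<in> S \<Longrightarrow> f z = g z"
  shows "C2_on g S" "z \<in> S \<Longrightarrow> d_z (d_zbar g) z = d_z (d_zbar f) z"
proof -
  have f: "C1_on f S" "C1_on (d_z f) S" "C1_on (d_zbar f) S" using assms(1) by (auto simp: C2_iff)
  show "C2_on g S"
    using C1_cong[OF f(1) assms(2,3)] C1_cong[OF f(2) assms(2)] C1_cong[OF f(3) assms(2)]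
      d_z_cong[OF f(1) assms(2,3)] by (auto simp: C2_iff)
  show "z \<in> S \<Longrightarrow> d_z (d_zbar g) z = d_z (d_zbar f) z"
    using d_z_cong(1)[OF f(3) assms(2)] d_z_cong(2)[OF f(1) assms(2,3)] by metis
qed

text \<open>Both surfaces of interest are slices of this form: s = 1 is the diagonal, which carries
  the disk, and s = -1 is the antidiagonal, which carries the sphere.\<close>

lemma sep_wirt:
  assumes F: "sep_holomorphic F U" and U: "open U" and z: "(z, s * cnj z) \<in> U"
  shows "wirt (\<lambda>z. F (z, s * cnj z)) (pz F (z, s * cnj z)) (s * pw F (z, s * cnj z)) z"
proof -
  have "((\<lambda>z. (z, s * cnj z)) has_derivative (\<lambda>h. (h, s * cnj h))) (at z)"
    by (intro derivative_intros bounded_linear_imp_has_derivative bounded_linear_const_mult bounded_linear_cnj)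
  from has_derivative_compose[OF this sep_has_derivative[OF F U z]]
  show ?thesis by (simp add: wirt_def algebra_simps)
qed

lemma sep_C1:
  assumes F: "sep_holomorphic F U" and U: "open U"
  shows "C1_on (\<lambda>z. F (z, s * cnj z)) {z. (z, s * cnj z) \<in> U}"
proof (rule C1_onI[OF sep_wirt[OF F U]])
  show "continuous_on {z. (z, s * cnj z) \<in> U} (\<lambda>z. pz F (z, s * cnj z))"
    by (rule continuous_on_compose2[OF pz_continuous[OF F U]]) (auto intro!: continuous_intros)
  have "continuous_on {z. (z, s * cnj z) \<in> U} (\<lambda>z. pw F (z, s * cnj z))"
    by (rule continuous_on_compose2[OF pw_continuous[OF F U]]) (auto intro!: continuous_intros)
  then show "continuous_on {z. (z, s * cnj z) \<in> U} (\<lambda>z. s * pw F (z, s * cnj z))"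
    by (rule continuous_on_mult_left)
qed auto

lemma open_antidiagonal: "open U \<Longrightarrow> open {z. (z, s * cnj z) \<in> U}"
  using open_vimage[of U "\<lambda>z. (z, s * cnj z)"] by (simp add: vimage_def continuous_intros)

text \<open>The conjugate derivative on the slice is s times the w-derivative, so the mixed
  derivative gains one factor s. For s = -1 this is the minus sign in the spherical Laplacian, while
  1 - zw becomes 1 + |z|^2.\<close>

lemma sep_C2:
  assumes F: "sep_holomorphic F U" and U: "open U"
  shows "C2_on (\<lambda>z. F (z, s * cnj z)) {z. (z, s * cnj z) \<in> U}"
    "(z, s * cnj z) \<in> U \<Longrightarrow> d_z (d_zbar (\<lambda>z. F (z, s * cnj z))) z = s * pz (pw F) (z, s * cnj z)"
proof -
  let ?S = "{z. (z, s * cnj z) \<in> U}"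
  have S: "open ?S" by (rule open_antidiagonal[OF U])
  have e: "d_z (\<lambda>z. F (z, s * cnj z)) z = pz F (z, s * cnj z)" "d_zbar (\<lambda>z. F (z, s * cnj z)) z = s * pw F (z, s * cnj z)"
    if "z \<in> ?S" for z using wirtD(4,5)[OF sep_wirt[OF F U]] that by auto
  have 1: "C1_on (\<lambda>z. pz F (z, s * cnj z)) ?S" by (rule sep_C1[OF pz_sep[OF F U] U])
  have 2: "C1_on (\<lambda>z. pw F (z, s * cnj z)) ?S" by (rule sep_C1[OF pw_sep[OF F U] U])
  show "C2_on (\<lambda>z. F (z, s * cnj z)) ?S"
    unfolding C2_iff
    by (intro conjI sep_C1[OF F U] C1_cong[OF 1 S] C1_cong[OF C1_cmult[OF 2] S]) (simp_all only: e)
  show "d_z (d_zbar (\<lambda>z. F (z, s * cnj z))) z = s * pz (pw F) (z, s * cnj z)" if "(z, s * cnj z) \<in> U"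
  proof -
    have z: "z \<in> ?S" using that by simp
    have "d_z (d_zbar (\<lambda>z. F (z, s * cnj z))) z = d_z (\<lambda>z. s * pw F (z, s * cnj z)) z"
      by (rule d_z_cong(1)[OF C1_cmult[OF 2] S _ z]) (simp only: e)
    also have "\<dots> = s * pz (pw F) (z, s * cnj z)"
      using wirtD(4)[OF wirt_cmult[OF sep_wirt[OF pw_sep[OF F U] U that]]] .
    finally show ?thesis .
  qed
qed

section \<open>Equality of the mixed second derivatives\<close>

lemma differentiable_line:
  fixes f :: "complex \<Rightarrow> complex"
  assumes "f differentiable (at (c + of_real t * d))"
  shows "((\<lambda>t. f (c + of_real t * d)) has_vector_derivative frechet_derivative f (at (c + of_real t * d)) d) (at t within A)"
proof -
  let ?D = "frechet_derivative f (at (c + of_real t * d))"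
  have D: "(f has_derivative ?D) (at (c + of_real t * d))"
    using assms frechet_derivative_works by blast
  interpret bounded_linear ?D using D by (rule has_derivative_bounded_linear)
  have "((\<lambda>t. c + of_real t * d) has_derivative (\<lambda>h. of_real h * d)) (at t within A)"
    using has_derivative_add[OF has_derivative_const[of c] has_derivative_mult_left[OF bounded_linear.has_derivative[OF bounded_linear_of_real has_derivative_ident]]]
    by simp
  from has_derivative_compose[OF this D]
  show ?thesis using scaleR[of _ d] by (simp add: has_vector_derivative_def scaleR_conv_of_real)
qed

lemma dx_line:
  fixes f :: "complex \<Rightarrow> complex"
  assumes "f differentiable (at (c + of_real t))"
  shows "((\<lambda>t. f (c + of_real t)) has_vector_derivative dx f (c + of_real t)) (at t within A)"
  using differentiable_line[of f c t 1] assms by (simp add: dx_def)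

lemma dy_line:
  fixes f :: "complex \<Rightarrow> complex"
  assumes "f differentiable (at (c + \<i> * of_real t))"
  shows "((\<lambda>t. f (c + \<i> * of_real t)) has_vector_derivative dy f (c + \<i> * of_real t)) (at t within A)"
  using differentiable_line[of f c t \<i>] assms by (simp add: dy_def mult.commute)

text \<open>The increment of f in y is the integral of \<open>dy f\<close>. It is differentiated in
  x under the integral sign, and then in y at the left end of the interval, where the one-sided
  derivative is still unique.\<close>

lemma dx_dy_commute:
  assumes f: "C2_on f S" and S: "open S" and z: "z \<in> S"
  shows "dx (dy f) z = dy (dx f) z"
proof -
  obtain r where r: "r > 0" "cball z r \<subseteq> S" using S z open_contains_cball by blast
  define \<delta> where "\<delta> = r / 2"
  have \<delta>: "\<delta> > 0" using r by (simp add: \<delta>_def)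
  define \<zeta> where "\<zeta> x y = z + \<i> * of_real y + of_real x" for x y
  have inS: "\<zeta> x y \<in> S" if "\<bar>x\<bar> \<le> \<delta>" "\<bar>y\<bar> \<le> \<delta>" for x y
  proof -
    have "dist z (\<zeta> x y) \<le> cmod (\<i> * of_real y) + cmod (of_real x)"
      unfolding \<zeta>_def dist_norm by (metis norm_triangle_ineq add_diff_cancel_left' norm_minus_commute add.assoc)
    also have "\<dots> \<le> r" using that by (simp add: norm_mult \<delta>_def)
    finally show ?thesis using r(2) by auto
  qed
  have df: "f differentiable (at p)" "dy f differentiable (at p)" "dx f differentiable (at p)" if "p \<in> S" for p
    using f that by (auto simp: C2_on_def C1_on_def)
  have cdy: "continuous_on S (dy f)" "continuous_on S (dx (dy f))"
    using f by (auto simp: C2_on_def C1_on_def)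
  have line: "((\<lambda>x. g (\<zeta> x y)) has_vector_derivative dx g (\<zeta> x y)) (at x within A)"
    if "g differentiable (at (\<zeta> x y))" for g x y A
    using dx_line[of g "z + \<i> * of_real y" x A] that by (simp add: \<zeta>_def)
  have liney: "((\<lambda>y. g (\<zeta> x y)) has_vector_derivative dy g (\<zeta> x y)) (at y within A)"
    if "g differentiable (at (\<zeta> x y))" for g x y A
    using dy_line[of g "z + of_real x" y A] that by (simp add: \<zeta>_def add_ac)
  have c\<zeta>: "continuous_on A (\<lambda>p. \<zeta> (fst p) (snd p))" for A
    unfolding \<zeta>_def by (intro continuous_intros)
  have c\<zeta>x: "continuous_on A (\<lambda>s. \<zeta> x s)" for x A
    unfolding \<zeta>_def by (intro continuous_intros)
  have ftc: "f (\<zeta> x y) - f (\<zeta> x 0) = integral (cbox 0 y) (\<lambda>s. dy f (\<zeta> x s))"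
    if "x \<in> {-\<delta>..\<delta>}" "y \<in> {0..\<delta>}" for x y
  proof -
    have "((\<lambda>s. dy f (\<zeta> x s)) has_integral f (\<zeta> x y) - f (\<zeta> x 0)) {0..y}"
      by (rule fundamental_theorem_of_calculus) (use that in \<open>auto intro!: liney df inS\<close>)
    then show ?thesis by (simp add: integral_unique)
  qed
  have key: "dx f (\<zeta> 0 y) - dx f (\<zeta> 0 0) = integral (cbox 0 y) (\<lambda>s. dx (dy f) (\<zeta> 0 s))" if y: "y \<in> {0..\<delta>}" for y
  proof -
    have a: "((\<lambda>x. integral (cbox 0 y) (\<lambda>s. dy f (\<zeta> x s))) has_vector_derivative
       integral (cbox 0 y) (\<lambda>s. dx (dy f) (\<zeta> 0 s))) (at 0 within {-\<delta>..\<delta>})"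
    proof (rule leibniz_rule_vector_derivative)
      show "((\<lambda>x. dy f (\<zeta> x t)) has_vector_derivative dx (dy f) (\<zeta> x t)) (at x within {- \<delta>..\<delta>})"
        if "x \<in> {- \<delta>..\<delta>}" "t \<in> cbox 0 y" for x t
        by (rule line) (use that y in \<open>auto intro!: df inS\<close>)
      show "(\<lambda>s. dy f (\<zeta> x s)) integrable_on cbox 0 y" if "x \<in> {- \<delta>..\<delta>}" for x
        by (intro integrable_continuous continuous_on_compose2[OF cdy(1)])
           (use that y in \<open>auto intro!: inS c\<zeta>x\<close>)
      show "continuous_on ({- \<delta>..\<delta>} \<times> cbox 0 y) (\<lambda>(x, t). dx (dy f) (\<zeta> x t))"
        unfolding split_beta
        by (rule continuous_on_compose2[OF cdy(2) c\<zeta>]) (use y in \<open>auto intro!: inS\<close>)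
    qed (use \<delta> in auto)
    have b: "((\<lambda>x. f (\<zeta> x y) - f (\<zeta> x 0)) has_vector_derivative dx f (\<zeta> 0 y) - dx f (\<zeta> 0 0)) (at 0 within {-\<delta>..\<delta>})"
      by (intro has_vector_derivative_diff line df inS) (use y \<delta> in auto)
    have c: "((\<lambda>x. integral (cbox 0 y) (\<lambda>s. dy f (\<zeta> x s))) has_vector_derivative dx f (\<zeta> 0 y) - dx f (\<zeta> 0 0)) (at 0 within {-\<delta>..\<delta>})"
      by (rule has_vector_derivative_transform[OF _ _ b]) (use \<delta> ftc y in auto)
    show ?thesis
      by (rule vector_derivative_unique_within[OF _ c a]) (use \<delta> in \<open>simp add: trivial_limit_within islimpt_Icc\<close>)
  qed
  have cI: "continuous_on {0..\<delta>} (\<lambda>s. dx (dy f) (\<zeta> 0 s))"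
    by (rule continuous_on_compose2[OF cdy(2)]) (use \<delta> in \<open>auto intro!: inS c\<zeta>x\<close>)
  have "((\<lambda>y. integral {0..y} (\<lambda>s. dx (dy f) (\<zeta> 0 s))) has_vector_derivative dx (dy f) (\<zeta> 0 0)) (at 0 within {0..\<delta>})"
    by (rule integral_has_vector_derivative[OF cI]) (use \<delta> in auto)
  then have a: "((\<lambda>y. dx f (\<zeta> 0 y) - dx f (\<zeta> 0 0)) has_vector_derivative dx (dy f) (\<zeta> 0 0)) (at 0 within {0..\<delta>})"
    by (rule has_vector_derivative_transform[rotated 2]) (use \<delta> key in auto)
  have b: "((\<lambda>y. dx f (\<zeta> 0 y) - dx f (\<zeta> 0 0)) has_vector_derivative dy (dx f) (\<zeta> 0 0) - 0) (at 0 within {0..\<delta>})"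
    by (intro has_vector_derivative_diff liney df inS has_vector_derivative_const) (use \<delta> in auto)
  have "dx (dy f) (\<zeta> 0 0) = dy (dx f) (\<zeta> 0 0) - 0"
    by (rule vector_derivative_unique_within[OF _ a b]) (use \<delta> in \<open>simp add: trivial_limit_within islimpt_Icc\<close>)
  then show ?thesis by (simp add: \<zeta>_def)
qed

lemma d_z_d_zbar_commute:
  assumes f: "C2_on f S" and S: "open S" and z: "z \<in> S"
  shows "d_zbar (d_z f) z = d_z (d_zbar f) z"
proof -
  have f1: "C1_on (dx f) S" "C1_on (dy f) S" using f by (auto simp: C2_on_def)
  note wx = C1_wirt[OF f1(1) z] and wy = C1_wirt[OF f1(2) z]
  have 1: "d_z f = (\<lambda>z. 1/2 * (dx f z - \<i> * dy f z))" "d_zbar f = (\<lambda>z. 1/2 * (dx f z + \<i> * dy f z))"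
    by (auto simp: d_z_def d_zbar_def)
  have "d_zbar (d_z f) z = 1/2 * (d_zbar (dx f) z - \<i> * d_zbar (dy f) z)"
    unfolding 1 by (rule wirtD(5)[OF wirt_cmult[OF wirt_diff[OF wx wirt_cmult[OF wy]]]])
  moreover have "d_z (d_zbar f) z = 1/2 * (d_z (dx f) z + \<i> * d_z (dy f) z)"
    unfolding 1 by (rule wirtD(4)[OF wirt_cmult[OF wirt_add[OF wx wirt_cmult[OF wy]]]])
  moreover have "dx (dy f) z = dy (dx f) z" by (rule dx_dy_commute[OF f S z])
  ultimately have "8 * d_zbar (d_z f) z = 8 * d_z (d_zbar f) z"
    unfolding d_z_def[of "dy f" z] d_z_def[of "dx f" z] d_zbar_def[of "dy f" z] d_zbar_def[of "dx f" z]
    by (simp add: field_simps) algebra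
  then show ?thesis by simp
qed


section \<open>Identity theorems on the bidisk and on the set zw \<noteq> 1\<close>

lemma islimpt_ray:
  fixes z :: complex
  assumes "z \<noteq> 0"
  shows "0 islimpt {of_real x / z |x. 0 < x \<and> x < cmod z}"
  unfolding islimpt_approachable
proof (intro allI impI)
  fix e :: real assume e: "e > 0"
  define x where "x = min (cmod z / 2) (e * cmod z / 2)"
  have x: "0 < x" "x < cmod z" "x < e * cmod z" using e assms by (auto simp: x_def min_less_iff_disj)
  show "\<exists>x'\<in>{of_real x / z |x. 0 < x \<and> x < cmod z}. x' \<noteq> 0 \<and> dist x' 0 < e"
    by (rule bexI[of _ "of_real x / z"]) (use x assms in \<open>auto simp: norm_divide divide_less_eq\<close>)
qed

text \<open>
  For \<open>0 < r < 1\<close> the function \<open>\<zeta> \<mapsto> f (r \<zeta>, r / \<zeta>)\<close> vanishes on the unit circle, hence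
  on its annulus of definition. So \<open>f\<close> vanishes where \<open>z w \<in> (0, 1)\<close>.
\<close>

lemma bidisk_identity:
  assumes f: "sep_holomorphic f (ball 0 1 \<times> ball 0 1)"
    and 0: "\<And>z. cmod z < 1 \<Longrightarrow> f (z, cnj z) = 0"
    and zw: "cmod z < 1" "cmod w < 1"
  shows "f (z, w) = 0"
proof -
  have hz: "(\<lambda>t. f (z, t)) holomorphic_on ball 0 1" if "cmod z < 1" for z
    using f that by (auto simp: sep_holomorphic_def holomorphic_on_open field_differentiable_def)
  have hw: "(\<lambda>s. f (s, w)) holomorphic_on ball 0 1" if "cmod w < 1" for w
    using f that by (auto simp: sep_holomorphic_def holomorphic_on_open field_differentiable_def)
  have step1: "f (z, of_real (r\<^sup>2) / z) = 0" if z: "z \<noteq> 0" "cmod z < 1" and r: "0 < r" "r\<^sup>2 < cmod z" for z r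
  proof -
    define A where "A = {\<zeta>. r < cmod (\<zeta> - 0) \<and> cmod (\<zeta> - 0) < 1 / r}"
    have "r\<^sup>2 < 1\<^sup>2" using r z by simp
    then have r1: "r < 1" using r power2_less_imp_less[of r 1] by simp
    have oA: "open A" unfolding A_def by (auto intro!: open_Collect_conj open_Collect_less continuous_intros)
    have cA: "connected A" unfolding A_def by (intro connected_annulus) simp
    have A0: "\<zeta> \<noteq> 0" if "\<zeta> \<in> A" for \<zeta> using that r by (auto simp: A_def)
    have inA: "cmod (of_real r * \<zeta>) < 1" "cmod (of_real r / \<zeta>) < 1" if "\<zeta> \<in> A" for \<zeta>
      using that A0[OF that] r by (auto simp: A_def norm_mult norm_divide field_simps)
    have "(\<lambda>\<zeta>. f (of_real r * \<zeta>, of_real r / \<zeta>)) field_differentiable at \<zeta>" if \<zeta>: "\<zeta> \<in> A" for \<zeta>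
    proof -
      let ?p = "(of_real r * \<zeta>, of_real r / \<zeta>)"
      have D: "(f has_derivative (\<lambda>(h, k). pz f ?p * h + pw f ?p * k)) (at ?p)"
        by (rule sep_has_derivative[OF f]) (use inA[OF \<zeta>] in \<open>auto intro: open_Times\<close>)
      have d1: "((\<lambda>\<zeta>. of_real r * \<zeta>) has_derivative (*) (of_real r)) (at \<zeta>)"
        using DERIV_cmult_Id[of "of_real r :: complex" \<zeta> UNIV] by (simp add: has_field_derivative_def)
      have "((\<lambda>\<zeta>. of_real r / \<zeta>) has_field_derivative - of_real r / \<zeta>\<^sup>2) (at \<zeta>)"
        using A0[OF \<zeta>] by (auto intro!: derivative_eq_intros simp: power2_eq_square)
      then have d2: "((\<lambda>\<zeta>. of_real r / \<zeta>) has_derivative (*) (- of_real r / \<zeta>\<^sup>2)) (at \<zeta>)"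
        by (simp add: has_field_derivative_def)
      have "((\<lambda>\<zeta>. f (of_real r * \<zeta>, of_real r / \<zeta>)) has_derivative
         (\<lambda>h. (pz f ?p * of_real r + pw f ?p * (- of_real r / \<zeta>\<^sup>2)) * h)) (at \<zeta>)"
        using has_derivative_compose[OF has_derivative_Pair[OF d1 d2] D] by (simp add: algebra_simps)
      then show ?thesis unfolding field_differentiable_def has_field_derivative_def by blast
    qed
    then have hol: "(\<lambda>\<zeta>. f (of_real r * \<zeta>, of_real r / \<zeta>)) holomorphic_on A"
      using oA by (auto simp: holomorphic_on_open field_differentiable_def)
    have sub: "sphere 0 1 \<subseteq> A" using r r1 by (auto simp: A_def)
    have lim: "(1::complex) islimpt sphere 0 1"
    proof (rule connected_imp_perfect[OF connected_sphere])
      fix x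
      show "sphere 0 (1::real) \<noteq> {x :: complex}"
      proof
        assume "sphere 0 (1::real) = {x :: complex}"
        moreover have "(1::complex) \<in> sphere 0 1" "(-1::complex) \<in> sphere 0 1" by auto
        ultimately show False by (metis one_neq_neg_one singletonD)
      qed
    qed auto
    have zr: "z / of_real r \<in> A"
      using z r by (auto simp: A_def norm_divide field_simps power2_eq_square)
    have "f (of_real r * (z / of_real r), of_real r / (z / of_real r)) = 0"
    proof (rule analytic_continuation[OF hol oA cA sub _ lim _ zr])
      show "1 \<in> A" using r r1 by (simp add: A_def)
      fix \<zeta> :: complex assume \<zeta>: "\<zeta> \<in> sphere 0 1"
      then have "of_real r / \<zeta> = cnj (of_real r * \<zeta>)"
        by (simp add: complex_div_cnj[of _ \<zeta>])
      then show "f (of_real r * \<zeta>, of_real r / \<zeta>) = 0"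
        using 0[of "of_real r * \<zeta>"] \<zeta> r r1 by (simp add: norm_mult)
    qed
    then show ?thesis using r by (simp add: power2_eq_square)
  qed
  have step2: "f (z, w) = 0" if z: "z \<noteq> 0" "cmod z < 1" and w: "cmod w < 1" for z w
  \<comment> \<open>For fixed z the known zeros x / z with small positive x accumulate at 0, which
    suffices in the connected disk.\<close>
  proof (rule analytic_continuation[OF hz[OF z(2)] open_ball connected_ball _ _ islimpt_ray[OF z(1)]])
    fix u assume "u \<in> {of_real x / z |x. 0 < x \<and> x < cmod z}"
    then obtain x where x: "u = of_real x / z" "0 < x" "x < cmod z" by blast
    then show "f (z, u) = 0" using step1[OF z, of "sqrt x"] by simp
  qed (use z w in \<open>auto simp: norm_divide\<close>)
  show ?thesis
  \<comment> \<open>Points with z = 0 escape \<open>step2\<close>; they are reached by continuation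
    in the first variable.\<close>
  proof (rule analytic_continuation[OF hw[OF zw(2)] open_ball connected_ball, of "ball 0 1 - {0}" 0])
    show "(0::complex) islimpt (ball 0 1 - {0})"
      by (simp add: islimpt_punctured[symmetric] islimpt_ball)
  qed (use step2 zw in auto)
qed

lemma open_zw: "open {(z, w). z * w \<noteq> (1::complex)}"
proof -
  have "open {p :: complex \<times> complex. fst p * snd p \<noteq> 1}"
    by (intro open_Collect_neq continuous_intros)
  then show ?thesis by (simp add: case_prod_beta')
qed

lemma connected_slice: "connected {s. s * w \<noteq> (1::complex)}" "open {s. s * w \<noteq> (1::complex)}"
proof -
  have "{s. s * w \<noteq> (1::complex)} = (if w = 0 then UNIV else - {1 / w})"
    by (auto simp: field_simps)
  then show "connected {s. s * w \<noteq> (1::complex)}" "open {s. s * w \<noteq> (1::complex)}"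
    by (auto intro: connected_punctured_universe)
qed

text \<open>A slice with one coordinate fixed is the plane with at most one point removed, hence
  connected. Continuation goes in z for |w| < 1, and then in w for arbitrary z, starting from small
  w.\<close>

lemma Omega_identity:
  assumes f: "sep_holomorphic f {(z, w). z * w \<noteq> 1}"
    and 0: "\<And>z w. cmod z < 1 \<Longrightarrow> cmod w < 1 \<Longrightarrow> f (z, w) = 0"
    and zw: "z * w \<noteq> 1"
  shows "f (z, w) = 0"
proof -
  have hz: "(\<lambda>t. f (z, t)) holomorphic_on {t. t * z \<noteq> 1}" for z
    using f connected_slice(2)[of z] by (auto simp: sep_holomorphic_def holomorphic_on_open field_differentiable_def mult.commute)
  have hw: "(\<lambda>s. f (s, w)) holomorphic_on {s. s * w \<noteq> 1}" for w
    using f connected_slice(2)[of w] by (auto simp: sep_holomorphic_def holomorphic_on_open field_differentiable_def)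
  have ne: "z * w \<noteq> 1" if "cmod z < 1" "cmod w < 1" for z w
    by (metis that norm_mult_less norm_one order.irrefl mult_1)
  have step: "f (z, w) = 0" if w: "cmod w < 1" "z * w \<noteq> 1" for z w
  proof (rule analytic_continuation[OF hw connected_slice(2) connected_slice(1), of "ball 0 1" w 0])
    show "(0::complex) islimpt ball 0 1" by (simp add: islimpt_ball)
  qed (use w 0 ne in auto)
  show ?thesis
  proof (rule analytic_continuation[OF hz connected_slice(2) connected_slice(1), of "ball 0 1 \<inter> {t. t * z \<noteq> 1}" z 0])
    show "(0::complex) islimpt (ball 0 1 \<inter> {t. t * z \<noteq> 1})"
      by (rule interior_limit_point) (simp add: interior_open open_Int connected_slice(2))
  qed (use zw step in \<open>auto simp: mult.commute\<close>)
qed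

section \<open>The complex manifold \<open>\<Omega>\<close>\<close>

lemma sphere_inverse_invol [simp]: "sphere_inverse (sphere_inverse p) = p"
  by (cases p) auto

lemma inj_sphere_inverse: "inj sphere_inverse"
  by (metis injI sphere_inverse_invol)

abbreviation inv_chart :: "complex \<Rightarrow> sphere" where
  "inv_chart z \<equiv> sphere_inverse (Some z)"

text \<open>Replaces the one-point compactification by its two coordinates. The complement of a
  neighbourhood of infinity is closed and bounded in the plane, and boundedness says that the set
  contains the reciprocals of a small disk about 0.\<close>

lemma openin_sphere_iff:
  "openin sphere_topology S \<longleftrightarrow> open (Some -` S) \<and> open (inv_chart -` S)"
proof -
  have vS: "inv_chart -` S - {0} = - {0} \<inter> (\<lambda>z. 1 / z) -` (Some -` S)" by auto
  have cont: "open (inv_chart -` S - {0})" if "open (Some -` S)"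
    unfolding vS
    by (rule continuous_open_preimage) (use that in \<open>auto intro!: continuous_intros\<close>)
  show ?thesis
  proof (cases "None \<in> S")
    case False
    then obtain V where V: "S = Some ` V"
      by (metis (full_types) imageI not_None_eq subsetI subset_imageE)
    have "openin sphere_topology S \<longleftrightarrow> open V"
      unfolding V sphere_topology_def by simp
    moreover have "Some -` S = V" using V by auto
    moreover have "0 \<notin> inv_chart -` S" using V by auto
    ultimately show ?thesis using cont by auto
  next
    case True
    have eq: "openin sphere_topology S \<longleftrightarrow> compact (- (Some -` S))"
    proof
      assume "openin sphere_topology S"
      then obtain C where C: "compact C" "S = insert None (Some ` (UNIV - C))"
        using True unfolding sphere_topology_def openin_Alexandroff_compactification by auto
      then have "- (Some -` S) = C" by auto
      with C show "compact (- (Some -` S))" by simp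
    next
      assume c: "compact (- (Some -` S))"
      have "S = insert None (Some ` (UNIV - (- (Some -` S))))"
      proof (rule set_eqI)
        fix x show "x \<in> S \<longleftrightarrow> x \<in> insert None (Some ` (UNIV - (- (Some -` S))))"
          using True by (cases x) auto
      qed
      then show "openin sphere_topology S"
        using c unfolding sphere_topology_def openin_Alexandroff_compactification
        by (metis closed_closedin compact_imp_closed compactin_euclidean_iff topspace_euclidean)
    qed
    show ?thesis
    proof
      assume "openin sphere_topology S"
      then have comp: "compact (- (Some -` S))" by (simp add: eq)
      then have op: "open (Some -` S)" using compact_imp_closed[OF comp] by (simp add: closed_def)
      obtain B where B: "B > 0" "\<And>z. z \<in> - (Some -` S) \<Longrightarrow> cmod z \<le> B"
        using compact_imp_bounded[OF comp] unfolding bounded_pos by auto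
      \<comment> \<open>Nonzero points of this ball have reciprocals of modulus above 2B, beyond the
        bound B of the complement.\<close>
      have "ball 0 (1 / (2 * B)) \<subseteq> inv_chart -` S"
      proof
        fix z :: complex assume z: "z \<in> ball 0 (1 / (2 * B))"
        show "z \<in> inv_chart -` S"
        proof (cases "z = 0")
          case False
          have "cmod (1 / z) > B" using z False B(1) by (simp add: norm_divide field_simps)
          then have "1 / z \<in> Some -` S" using B(2)[of "1 / z"] by fastforce
          then show ?thesis using False by simp
        qed (use True in simp)
      qed
      then have "inv_chart -` S = (inv_chart -` S - {0}) \<union> ball 0 (1 / (2 * B))"
        using B(1) by auto
      then show "open (Some -` S) \<and> open (inv_chart -` S)"
        using op cont[OF op] by (metis open_Un open_ball)
    next
      assume o: "open (Some -` S) \<and> open (inv_chart -` S)"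
      then obtain e where e: "e > 0" "ball 0 e \<subseteq> inv_chart -` S"
        using True open_contains_ball[of "inv_chart -` S"] by (auto dest: bspec[of _ _ 0])
      have "- (Some -` S) \<subseteq> cball 0 (1 / e)"
      proof
        fix z assume z: "z \<in> - (Some -` S)"
        show "z \<in> cball 0 (1 / e)"
        proof (rule ccontr)
          assume "z \<notin> cball 0 (1 / e)"
          then have c: "cmod z > 1 / e" by simp
          then have "z \<noteq> 0" using e by (auto simp: not_less)
          moreover from this c have "1 / z \<in> ball 0 e" using e by (simp add: norm_divide field_simps)
          ultimately show False using e(2) z by (auto simp: subset_iff dest: spec[of _ "1 / z"])
        qed
      qed
      moreover have "closed (- (Some -` S))" using o by (simp add: closed_def)
      ultimately show "openin sphere_topology S"
        unfolding eq using bounded_cball bounded_subset compact_eq_bounded_closed by blast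
    qed
  qed
qed

lemma topspace_sphere [simp]: "topspace sphere_topology = UNIV"
proof -
  have "openin sphere_topology UNIV" by (simp add: openin_sphere_iff)
  then show ?thesis using openin_subset by blast
qed

lemma topspace_sphere2 [simp]: "topspace sphere2_topology = UNIV"
  by (simp add: sphere2_topology_def)

lemma continuous_Some: "continuous_map euclidean sphere_topology Some"
  and continuous_inv_chart: "continuous_map euclidean sphere_topology inv_chart"
  by (auto simp: continuous_map_def openin_sphere_iff vimage_def)

lemma std_chart_eq: "std_chart = (\<lambda>p. (Some (fst p), Some (snd p)))"
  and flip_chart_eq: "flip_chart = (\<lambda>p. (inv_chart (snd p), inv_chart (fst p)))"
  by (auto simp del: sphere_inverse.simps)

lemma continuous_std_chart: "continuous_map euclidean sphere2_topology std_chart"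
  unfolding std_chart_eq sphere2_topology_def
  by (intro continuous_map_pairedI continuous_map_compose[OF _ continuous_Some, unfolded o_def])
     (auto intro!: continuous_intros)

lemma continuous_flip_chart: "continuous_map euclidean sphere2_topology flip_chart"
  unfolding flip_chart_eq sphere2_topology_def
  by (intro continuous_map_pairedI continuous_map_compose[OF _ continuous_inv_chart, unfolded o_def])
     (auto intro!: continuous_intros)

lemma openin_Some_image: "open A \<Longrightarrow> openin sphere_topology (Some ` A)"
  by (simp add: sphere_topology_def)

lemma openin_inv_chart_image:
  assumes "open A" shows "openin sphere_topology (inv_chart ` A)"
proof -
  have "openin sphere_topology (Some ` A)" by (rule openin_Some_image[OF assms])
  then have 1: "open (inv_chart -` (Some ` A))" by (simp add: openin_sphere_iff)
  have "Some -` (inv_chart ` A) = inv_chart -` (Some ` A)"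
    by (auto simp del: sphere_inverse.simps) (metis sphere_inverse_invol imageI)+
  moreover have "inv_chart -` (inv_chart ` A) = A"
    using inj_sphere_inverse by (auto simp: inj_def simp del: sphere_inverse.simps)
  ultimately show ?thesis using 1 assms by (simp add: openin_sphere_iff del: sphere_inverse.simps)
qed

lemma openin_std_image:
  assumes "open W" shows "openin sphere2_topology (std_chart ` W)"
  unfolding sphere2_topology_def openin_prod_topology_alt
proof (intro allI impI)
  fix p q assume "(p, q) \<in> std_chart ` W"
  then obtain z w where zw: "p = Some z" "q = Some w" "(z, w) \<in> W" by auto
  obtain A B where "open A" "open B" "(z, w) \<in> A \<times> B" "A \<times> B \<subseteq> W"
    using open_prod_elim[OF assms zw(3)] by metis
  note AB = this
  show "\<exists>U V. openin sphere_topology U \<and> openin sphere_topology V \<and> p \<in> U \<and> q \<in> V \<and> U \<times> V \<subseteq> std_chart ` W"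
  proof (intro exI conjI)
    show "Some ` A \<times> Some ` B \<subseteq> std_chart ` W"
      using AB(4) by (force simp: std_chart_eq image_iff)
  qed (use AB zw in \<open>auto intro: openin_Some_image\<close>)
qed

lemma openin_flip_image:
  assumes "open W" shows "openin sphere2_topology (flip_chart ` W)"
  unfolding sphere2_topology_def openin_prod_topology_alt
proof (intro allI impI)
  fix p q assume "(p, q) \<in> flip_chart ` W"
  then obtain u v where uv: "p = inv_chart v" "q = inv_chart u" "(u, v) \<in> W" by auto
  obtain A B where AB: "open A" "open B" "(u, v) \<in> A \<times> B" "A \<times> B \<subseteq> W"
    using open_prod_elim[OF assms uv(3)] by metis
  show "\<exists>U V. openin sphere_topology U \<and> openin sphere_topology V \<and> p \<in> U \<and> q \<in> V \<and> U \<times> V \<subseteq> flip_chart ` W"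
  proof (intro exI conjI)
    show "inv_chart ` B \<times> inv_chart ` A \<subseteq> flip_chart ` W"
      using AB(4) by (force simp: flip_chart_eq image_iff simp del: sphere_inverse.simps)
  qed (use AB uv in \<open>auto intro: openin_inv_chart_image simp del: sphere_inverse.simps\<close>)
qed

section \<open>Omega as the union of its two charts\<close>

lemma Omega_std [simp]: "(Some z, Some w) \<in> Omega \<longleftrightarrow> z * w \<noteq> 1"
  and Omega_zinf [simp]: "(Some z, None) \<in> Omega \<longleftrightarrow> z \<noteq> 0"
  and Omega_infw [simp]: "(None, Some w) \<in> Omega \<longleftrightarrow> w \<noteq> 0"
  and Omega_infinf [simp]: "(None, None) \<in> Omega"
  by (auto simp: Omega_def)

lemma flip_in_Omega: "flip_chart (u, v) \<in> Omega \<longleftrightarrow> u * v \<noteq> 1"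
  by (auto simp: field_simps)

lemma std_vimage_Omega: "std_chart -` Omega = {(z, w). z * w \<noteq> 1}"
  and flip_vimage_Omega: "flip_chart -` Omega = {(z, w). z * w \<noteq> 1}"
proof -
  show "std_chart -` Omega = {(z, w). z * w \<noteq> 1}" by auto
  have "p \<in> flip_chart -` Omega \<longleftrightarrow> p \<in> {(z, w). z * w \<noteq> 1}" for p
    using flip_in_Omega[of "fst p" "snd p"] by (simp add: case_prod_beta' del: flip_chart.simps)
  then show "flip_chart -` Omega = {(z, w). z * w \<noteq> 1}" by blast
qed

text \<open>The second case is restricted to the axes of the flip chart, that is, to points with an
  infinite coordinate; all others are already in the standard chart.\<close>

lemma Omega_cases:
  assumes "p \<in> Omega"
  obtains z w where "p = std_chart (z, w)" "z * w \<noteq> 1" | u v where "p = flip_chart (u, v)" "u * v \<noteq> 1" "u = 0 \<or> v = 0"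
proof -
  obtain a b where p: "p = (a, b)" by (cases p)
  show ?thesis
  proof (cases a; cases b)
    fix z w assume "a = Some z" "b = Some w"
    then show ?thesis using that(1)[of z w] assms p by auto
  next
    fix z assume "a = Some z" "b = None"
    then show ?thesis using that(2)[of 0 "1 / z"] assms p by auto
  next
    fix w assume "a = None" "b = Some w"
    then show ?thesis using that(2)[of "1 / w" 0] assms p by auto
  next
    assume "a = None" "b = None"
    then show ?thesis using that(2)[of 0 0] assms p by auto
  qed
qed

lemma Omega_eq: "Omega = std_chart ` {(z, w). z * w \<noteq> 1} \<union> flip_chart ` {(z, w). z * w \<noteq> 1}"
proof -
  have "p \<in> std_chart ` {(z, w). z * w \<noteq> 1} \<union> flip_chart ` {(z, w). z * w \<noteq> 1}" if "p \<in> Omega" for p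
    using that by (rule Omega_cases) (auto simp del: std_chart.simps flip_chart.simps)
  then show ?thesis using std_vimage_Omega flip_vimage_Omega by blast
qed

text \<open>Each point is joined to the origin by two connected slices: the points (s, 0) with s
  arbitrary, and the points (z, t) with tz \<noteq> 1.\<close>

lemma connected_zw: "connected {(z, w). z * w \<noteq> (1::complex)}"
proof -
  let ?U = "{(z, w). z * w \<noteq> (1::complex)}"
  have "connected_component ?U (0, 0) (z, w)" if zw: "z * w \<noteq> 1" for z w
  proof -
    have "connected ((\<lambda>s::complex. (s, 0::complex)) ` UNIV)"
      by (rule connected_continuous_image) (auto intro!: continuous_intros convex_connected[OF convex_UNIV])
    moreover have "connected ((\<lambda>t. (z, t)) ` {t. t * z \<noteq> 1})"
      by (rule connected_continuous_image) (auto intro!: continuous_intros connected_slice)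
    ultimately have "connected_component ?U (0, 0) (z, 0)" "connected_component ?U (z, 0) (z, w)"
      unfolding connected_component_def using zw
      by (intro exI[of _ "(\<lambda>s::complex. (s, 0::complex)) ` UNIV"] exI[of _ "(\<lambda>t. (z, t)) ` {t. t * z \<noteq> 1}"];
          force simp: mult.commute)+
    then show ?thesis by (rule connected_component_trans)
  qed
  then show ?thesis
    by (intro connected_iff_connected_component[THEN iffD2]) (auto, meson connected_component_sym connected_component_trans)
qed

lemma subdomain_Omega: "subdomain Omega"
proof -
  let ?U = "{(z, w). z * w \<noteq> (1::complex)}"
  have "openin sphere2_topology Omega"
    unfolding Omega_eq by (intro openin_Un openin_std_image openin_flip_image open_zw)
  moreover have "connectedin sphere2_topology Omega"
    unfolding Omega_eq
  proof (rule connectedin_Un)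
    show "connectedin sphere2_topology (std_chart ` ?U)"
      by (rule connectedin_continuous_map_image[OF continuous_std_chart]) (simp add: connected_zw)
    show "connectedin sphere2_topology (flip_chart ` ?U)"
      by (rule connectedin_continuous_map_image[OF continuous_flip_chart]) (simp add: connected_zw)
    \<comment> \<open>A point with finite nonzero coordinates, so that the two connected chart
      images meet.\<close>
    have "std_chart (1, 2) \<in> std_chart ` ?U" by (rule imageI) simp
    moreover have "std_chart (1, 2) = flip_chart (1/2, 1)" by simp
    moreover have "flip_chart (1/2, 1) \<in> flip_chart ` ?U" by (rule imageI) simp
    ultimately show "std_chart ` ?U \<inter> flip_chart ` ?U \<noteq> {}" by (metis IntI empty_iff)
  qed
  moreover have "(None, None) \<in> Omega" by simp
  ultimately show ?thesis unfolding subdomain_def by blast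
qed

lemma bidisk_zw: "cmod z < 1 \<Longrightarrow> cmod w < 1 \<Longrightarrow> z * w \<noteq> 1"
  by (metis norm_mult_less norm_one order.irrefl mult_1)

lemma bidisk_subset: "bidisk \<subseteq> Omega"
  using bidisk_zw by (auto simp: bidisk_def)

lemma std_vimage_bidisk: "std_chart -` bidisk = ball 0 1 \<times> ball 0 1"
  by (auto simp: bidisk_def)

lemma in_bidisk [simp]: "(Some z, Some w) \<in> bidisk \<longleftrightarrow> cmod z < 1 \<and> cmod w < 1"
  by (auto simp: bidisk_def std_chart_eq image_iff)

abbreviation UO :: "(complex \<times> complex) set" where "UO \<equiv> {(z, w). z * w \<noteq> 1}"

lemma Hol_Omega_iff:
  "F \<in> Hol Omega \<longleftrightarrow> (\<forall>p. p \<notin> Omega \<longrightarrow> F p = 0) \<and> sep_holomorphic (F \<circ> std_chart) UO \<and> sep_holomorphic (F \<circ> flip_chart) UO"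
  unfolding Hol_def std_vimage_Omega flip_vimage_Omega by (simp add: holomorphic2_iff open_zw)

lemma Hol_bidiskD:
  assumes "F \<in> Hol bidisk"
  shows "p \<notin> bidisk \<Longrightarrow> F p = 0" "sep_holomorphic (F \<circ> std_chart) (ball 0 1 \<times> ball 0 1)"
proof -
  show "p \<notin> bidisk \<Longrightarrow> F p = 0" using assms unfolding Hol_def by blast
  show "sep_holomorphic (F \<circ> std_chart) (ball 0 1 \<times> ball 0 1)"
    using assms unfolding Hol_def std_vimage_bidisk by (auto simp: holomorphic2_iff open_Times)
qed

lemma holomorphic2_cong:
  assumes "holomorphic2_on F U" "\<And>p. p \<in> V \<Longrightarrow> F p = G p" "V \<subseteq> U"
  shows "holomorphic2_on G V"
  unfolding holomorphic2_on_def
proof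
  fix p assume p: "p \<in> V"
  then obtain a b where "(F has_derivative (\<lambda>(h, k). a * h + b * k)) (at p within U)"
    using assms unfolding holomorphic2_on_def by blast
  then have "(F has_derivative (\<lambda>(h, k). a * h + b * k)) (at p within V)"
    using assms(3) has_derivative_subset by blast
  then have "(G has_derivative (\<lambda>(h, k). a * h + b * k)) (at p within V)"
    by (rule has_derivative_transform[OF p, rotated]) (use assms(2) in auto)
  then show "\<exists>a b. (G has_derivative (\<lambda>(h, k). a * h + b * k)) (at p within V)" by blast
qed

lemma Hol_restrict0:
  assumes "F \<in> Hol D" "D' \<subseteq> D"
  shows "restrict0 D' F \<in> Hol D'"
proof -
  have F: "holomorphic2_on (F \<circ> std_chart) (std_chart -` D)" "holomorphic2_on (F \<circ> flip_chart) (flip_chart -` D)"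
    using assms(1) unfolding Hol_def by blast+
  have "holomorphic2_on (restrict0 D' F \<circ> std_chart) (std_chart -` D')"
    by (rule holomorphic2_cong[OF F(1)]) (use assms(2) in \<open>simp_all add: restrict0_def vimage_mono\<close>)
  moreover have "holomorphic2_on (restrict0 D' F \<circ> flip_chart) (flip_chart -` D')"
    by (rule holomorphic2_cong[OF F(2)]) (use assms(2) in \<open>simp_all add: restrict0_def vimage_mono\<close>)
  ultimately show ?thesis by (simp add: Hol_def restrict0_def)
qed

lemma sep_cong: "sep_holomorphic f U \<Longrightarrow> open U \<Longrightarrow> (\<And>p. p \<in> U \<Longrightarrow> f p = g p) \<Longrightarrow> sep_holomorphic g U"
  by (metis holomorphic2_cong holomorphic2_iff order_refl)

lemma pz_cong:
  assumes "open U" "\<And>p. p \<in> U \<Longrightarrow> f p = g p" "p \<in> U"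
  shows "pz f p = pz g p" 
proof -
  have "open {s. (s, snd p) \<in> U}"
    using open_vimage[OF assms(1), of "\<lambda>s. (s, snd p)"] by (simp add: vimage_def continuous_intros)
  then have "\<forall>\<^sub>F s in nhds (fst p). s \<in> {s. (s, snd p) \<in> U}"
    by (rule eventually_nhds_in_open) (use assms in simp)
  then have "\<forall>\<^sub>F s in nhds (fst p). f (s, snd p) = g (s, snd p)"
    by (rule eventually_mono) (use assms in auto)
  then show ?thesis unfolding pz_def by (rule deriv_cong_ev) simp
qed

lemma pw_cong:
  assumes "open U" "\<And>p. p \<in> U \<Longrightarrow> f p = g p" "p \<in> U"
  shows "pw f p = pw g p" 
  unfolding pw_swap by (rule pz_cong[OF open_swap[OF assms(1)]]) (use assms in auto)

lemma pz_pw_cong: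
  assumes "open U" "\<And>p. p \<in> U \<Longrightarrow> f p = g p" "p \<in> U"
  shows "pz (pw f) p = pz (pw g) p" 
  by (rule pz_cong[OF assms(1) pw_cong[OF assms(1,2)] assms(3)])

lemma sep_const: "sep_holomorphic (\<lambda>p. c) U"
  by (auto simp: sep_holomorphic_def)

lemma sep_fst: "sep_holomorphic fst U" and sep_snd: "sep_holomorphic snd U"
  by (auto simp: sep_holomorphic_def intro!: continuous_intros)

lemma sep_add: "sep_holomorphic f U \<Longrightarrow> sep_holomorphic g U \<Longrightarrow> sep_holomorphic (\<lambda>p. f p + g p) U"
  and sep_diff: "sep_holomorphic f U \<Longrightarrow> sep_holomorphic g U \<Longrightarrow> sep_holomorphic (\<lambda>p. f p - g p) U"
  and sep_mult: "sep_holomorphic f U \<Longrightarrow> sep_holomorphic g U \<Longrightarrow> sep_holomorphic (\<lambda>p. f p * g p) U"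
  and sep_power: "sep_holomorphic f U \<Longrightarrow> sep_holomorphic (\<lambda>p. f p ^ n) U"
  and sep_divide: "sep_holomorphic f U \<Longrightarrow> sep_holomorphic g U \<Longrightarrow> (\<And>p. p \<in> U \<Longrightarrow> g p \<noteq> 0) \<Longrightarrow> sep_holomorphic (\<lambda>p. f p / g p) U"
  by (auto simp: sep_holomorphic_def intro!: continuous_intros derivative_intros)

section \<open>Continuation across the charts of Omega\<close>

lemma isCont_punctured_zero:
  fixes g :: "complex \<Rightarrow> complex"
  assumes "isCont g a" "\<forall>\<^sub>F x in at a. g x = 0"
  shows "g a = 0"
proof -
  have "(g \<longlongrightarrow> 0) (at a)"
    by (rule tendsto_cong[THEN iffD2, OF assms(2) tendsto_const])
  then show ?thesis using assms(1) LIM_unique isCont_def by blast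
qed

text \<open>The two charts overlap only off the axes of the flip chart. Continuity carries an
  identity across them, in u for v \<noteq> 0 and then in v.\<close>

lemma zero_off_axes:
  assumes f: "sep_holomorphic f UO" and 0: "\<And>u v. u \<noteq> 0 \<Longrightarrow> v \<noteq> 0 \<Longrightarrow> u * v \<noteq> 1 \<Longrightarrow> f (u, v) = 0"
    and uv: "u * v \<noteq> 1"
  shows "f (u, v) = 0"
proof -
  have c1: "isCont (\<lambda>s. f (s, v)) u" "isCont (\<lambda>t. f (u, t)) v" if "u * v \<noteq> 1" for u v
    using f that unfolding sep_holomorphic_def by (auto intro: field_differentiable_imp_continuous_at)
  have ev: "\<forall>\<^sub>F s in at 0. s \<noteq> 0 \<and> s * v \<noteq> 1" for v :: complex
  proof -
    have "\<forall>\<^sub>F s in at 0. s \<in> {s. s * v \<noteq> 1}"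
      by (rule eventually_at_in_open') (auto simp: connected_slice)
    then show ?thesis by (auto simp: eventually_conj_iff eventually_at_filter)
  qed
  have 1: "f (u, v) = 0" if "v \<noteq> 0" "u * v \<noteq> 1" for u v
  proof (cases "u = 0")
    case True
    show ?thesis unfolding True
    proof (rule isCont_punctured_zero[OF c1(1)])
      show "\<forall>\<^sub>F s in at 0. f (s, v) = 0" using ev[of v] by eventually_elim (use 0 that in auto)
    qed auto
  qed (use 0 that in auto)
  show ?thesis
  proof (cases "v = 0")
    case True
    show ?thesis unfolding True
    proof (rule isCont_punctured_zero[OF c1(2)])
      show "\<forall>\<^sub>F t in at 0. f (u, t) = 0" using ev[of u]
        by eventually_elim (use 1 in \<open>auto simp: mult.commute\<close>)
    qed auto
  qed (use 1 uv in auto)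
qed

lemma flip_std: "u \<noteq> 0 \<Longrightarrow> v \<noteq> 0 \<Longrightarrow> flip_chart (u, v) = std_chart (1 / v, 1 / u)"
  by simp

lemma Hol_Omega_zero:
  assumes F: "F \<in> Hol Omega" and 0: "\<And>z w. cmod z < 1 \<Longrightarrow> cmod w < 1 \<Longrightarrow> F (Some z, Some w) = 0"
  shows "F = (\<lambda>_. 0)"
proof
  fix p
  have s: "sep_holomorphic (F \<circ> std_chart) UO" "sep_holomorphic (F \<circ> flip_chart) UO"
    using F by (auto simp: Hol_Omega_iff)
  have 1: "F (Some z, Some w) = 0" if "z * w \<noteq> 1" for z w
    using Omega_identity[OF s(1) _ that] 0 by simp
  have 2: "F (flip_chart (u, v)) = 0" if "u * v \<noteq> 1" for u v
    using zero_off_axes[OF s(2) _ that] 1 by (simp add: field_simps)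
  show "F p = 0"
  proof (cases "p \<in> Omega")
    case True
    then show ?thesis by (rule Omega_cases) (use 1 2 in auto)
  qed (use F in \<open>unfold Hol_def, blast\<close>)
qed

text \<open>Chain rule for (u, v) -> (1/v, 1/u). The two derivatives change places, whence the
  appeal to \<open>pz_pw_commute\<close>, and the resulting factor 1/(uv)^2 is absorbed by (1 -
  uv)^2.\<close>

lemma laplace_flip:
  assumes F: "F \<in> Hol Omega" and uv: "u \<noteq> 0" "v \<noteq> 0" "u * v \<noteq> 1"
  shows "laplace_zw_formula (F \<circ> flip_chart) (u, v) = laplace_zw_formula (F \<circ> std_chart) (1 / v, 1 / u)"
proof -
  define f where "f = F \<circ> std_chart"
  have f: "sep_holomorphic f UO" using F by (auto simp: Hol_Omega_iff f_def)
  define W where "W = UO \<inter> {p. fst p \<noteq> 0 \<and> snd p \<noteq> 0}"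
  have "open {p :: complex \<times> complex. fst p \<noteq> 0 \<and> snd p \<noteq> 0}"
    by (intro open_Collect_conj open_Collect_neq continuous_intros)
  then have W: "open W" unfolding W_def by (rule open_Int[OF open_zw])
  have inU: "(1 / v, 1 / u) \<in> UO" if "(u, v) \<in> W" for u v using that by (auto simp: W_def field_simps)
  have 1: "pw (F \<circ> flip_chart) p = - (1 / (snd p)\<^sup>2) * pz f (1 / snd p, 1 / fst p)" if p: "p \<in> W" for p
  proof -
    have "pw (F \<circ> flip_chart) p = pw (\<lambda>p. f (1 / snd p, 1 / fst p)) p"
      by (rule pw_cong[OF W _ p]) (auto simp: W_def f_def)
    also have "\<dots> = - (1 / (snd p)\<^sup>2) * pz f (1 / snd p, 1 / fst p)"
      unfolding pw_def
    proof (rule DERIV_imp_deriv)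
      have d: "((\<lambda>t. 1 / t) has_field_derivative - (1 / (snd p)\<^sup>2)) (at (snd p))"
        using p by (auto intro!: derivative_eq_intros simp: W_def power2_eq_square)
      have "((\<lambda>s. f (s, 1 / fst p)) has_field_derivative pz f (1 / snd p, 1 / fst p)) (at (1 / snd p))"
        using pz_DERIV[OF f inU[of "fst p" "snd p"]] p by simp
      from DERIV_chain2[OF this d]
      show "((\<lambda>t. f (1 / snd (fst p, t), 1 / fst (fst p, t))) has_field_derivative - (1 / (snd p)\<^sup>2) * pz f (1 / snd p, 1 / fst p)) (at (snd p))"
        by (simp add: mult.commute)
    qed
    finally show ?thesis .
  qed
  have uvW: "(u, v) \<in> W" using uv by (auto simp: W_def)
  have "pz (pw (F \<circ> flip_chart)) (u, v) = pz (\<lambda>p. - (1 / (snd p)\<^sup>2) * pz f (1 / snd p, 1 / fst p)) (u, v)"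
    by (rule pz_cong[OF W 1 uvW])
  also have "\<dots> = - (1 / v\<^sup>2) * (pw (pz f) (1 / v, 1 / u) * (- (1 / u\<^sup>2)))"
    unfolding pz_def[of "\<lambda>p. - (1 / (snd p)\<^sup>2) * pz f (1 / snd p, 1 / fst p)"]
  proof (rule DERIV_imp_deriv)
    have d: "((\<lambda>t. 1 / t) has_field_derivative - (1 / u\<^sup>2)) (at u)"
      using uv by (auto intro!: derivative_eq_intros simp: power2_eq_square)
    have "((\<lambda>t. pz f (1 / v, t)) has_field_derivative pw (pz f) (1 / v, 1 / u)) (at (1 / u))"
      using pw_DERIV[OF pz_sep[OF f open_zw] inU[OF uvW]] .
    from DERIV_cmult[OF DERIV_chain2[OF this d], of "- (1 / v\<^sup>2)"]
    show "((\<lambda>s. - (1 / (snd (s, snd (u, v)))\<^sup>2) * pz f (1 / snd (s, snd (u, v)), 1 / fst (s, snd (u, v)))) has_field_derivative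
       - (1 / v\<^sup>2) * (pw (pz f) (1 / v, 1 / u) * (- (1 / u\<^sup>2)))) (at (fst (u, v)))" by simp
  qed
  also have "pw (pz f) (1 / v, 1 / u) = pz (pw f) (1 / v, 1 / u)"
    by (rule pz_pw_commute[OF f open_zw inU[OF uvW]])
  also have "- (1 / v\<^sup>2) * (pz (pw f) (1 / v, 1 / u) * - (1 / u\<^sup>2)) = pz (pw f) (1 / v, 1 / u) / (u * v)\<^sup>2"
    by (simp add: power_mult_distrib)
  finally have "pz (pw (F \<circ> flip_chart)) (u, v) = pz (pw f) (1 / v, 1 / u) / (u * v)\<^sup>2" .
  moreover have "(1 - u * v)\<^sup>2 / (u * v)\<^sup>2 = (1 - 1 / v * (1 / u))\<^sup>2"
  proof -
    have "(1 - u * v) / (u * v) = - (1 - 1 / v * (1 / u))" using uv by (simp add: field_simps)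
    then show ?thesis by (metis power2_minus power_divide)
  qed
  ultimately show ?thesis
    unfolding laplace_zw_formula_eq f_def[symmetric] by (metis (no_types, lifting) mult.assoc times_divide_eq_left times_divide_eq_right)
qed

text \<open>The eigenvalue equation is an identity between holomorphic functions. Being true on the
  bidisk it persists in the standard chart, and then across the axes in the flip chart.\<close>

lemma X_eig_Omega_extend:
  assumes F: "F \<in> X_eig lam bidisk" and G: "G \<in> Hol Omega" and eq: "\<And>p. p \<in> bidisk \<Longrightarrow> G p = F p"
  shows "G \<in> X_eig lam Omega"
proof -
  have s: "sep_holomorphic (G \<circ> std_chart) UO" "sep_holomorphic (G \<circ> flip_chart) UO"
    using G by (auto simp: Hol_Omega_iff)
  have K: "sep_holomorphic (\<lambda>p. 4 * (1 - fst p * snd p)\<^sup>2 * pz (pw g) p - lam * g p) UO"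
    if "sep_holomorphic g UO" for g
    by (intro sep_mult sep_diff sep_power sep_const sep_fst sep_snd pz_sep pw_sep open_zw that)
  have "4 * (1 - z * w)\<^sup>2 * pz (pw (G \<circ> std_chart)) (z, w) - lam * G (Some z, Some w) = 0"
    if zw: "cmod z < 1" "cmod w < 1" for z w
  proof -
    have b: "(Some z, Some w) \<in> bidisk" using zw by simp
    have "laplace_zw F (Some z, Some w) = lam * F (Some z, Some w)"
      using F b unfolding X_eig_def by blast
    moreover have "pz (pw (G \<circ> std_chart)) (z, w) = pz (pw (F \<circ> std_chart)) (z, w)"
      by (rule pz_pw_cong[of "ball 0 1 \<times> ball 0 1"]) (use zw eq in \<open>auto intro: open_Times\<close>)
    ultimately show ?thesis using eq[OF b] by (simp add: laplace_zw_formula_eq del: laplace_zw_formula.simps)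
  qed
  then have "(\<lambda>p. 4 * (1 - fst p * snd p)\<^sup>2 * pz (pw (G \<circ> std_chart)) p - lam * (G \<circ> std_chart) p) (z, w) = 0"
    if "z * w \<noteq> 1" for z w
    by (intro Omega_identity[OF K[OF s(1)] _ that]) auto
  then have 1: "laplace_zw_formula (G \<circ> std_chart) (z, w) = lam * G (Some z, Some w)" if "z * w \<noteq> 1" for z w
    using that by (simp add: laplace_zw_formula_eq del: laplace_zw_formula.simps)
  have "(\<lambda>p. 4 * (1 - fst p * snd p)\<^sup>2 * pz (pw (G \<circ> flip_chart)) p - lam * (G \<circ> flip_chart) p) (u, v) = 0"
    if "u * v \<noteq> 1" for u v
  proof (rule zero_off_axes[OF K[OF s(2)] _ that])
    fix u v :: complex assume uv: "u \<noteq> 0" "v \<noteq> 0" "u * v \<noteq> 1"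
    then have "1 / v * (1 / u) \<noteq> 1" by (simp add: field_simps)
    from 1[OF this] laplace_flip[OF G uv]
    show "4 * (1 - fst (u, v) * snd (u, v))\<^sup>2 * pz (pw (G \<circ> flip_chart)) (u, v) - lam * (G \<circ> flip_chart) (u, v) = 0"
      using uv by (simp add: laplace_zw_formula_eq del: laplace_zw_formula.simps)
  qed
  then have 2: "laplace_zw_formula (G \<circ> flip_chart) (u, v) = lam * G (flip_chart (u, v))" if "u * v \<noteq> 1" for u v
    using that by (simp add: laplace_zw_formula_eq del: laplace_zw_formula.simps flip_chart.simps)
  have "laplace_zw G p = lam * G p" if "p \<in> Omega" for p
  proof -
    obtain a b where p: "p = (a, b)" by (cases p)
    show ?thesis
    proof (cases a; cases b)
      fix z w assume "a = Some z" "b = Some w"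
      then show ?thesis using 1 that p by auto
    next
      fix z assume "a = Some z" "b = None"
      then show ?thesis using 2[of 0 "1 / z"] that p by auto
    next
      fix w assume "a = None" "b = Some w"
      then show ?thesis using 2[of "1 / w" 0] that p by auto
    next
      assume "a = None" "b = None"
      then show ?thesis using 2[of 0 0] that p by auto
    qed
  qed
  then show ?thesis using G by (simp add: X_eig_def)
qed

section \<open>Explicit eigenfunctions on \<open>\<Omega>\<close>\<close>

abbreviation LF :: "(complex \<times> complex \<Rightarrow> complex) \<Rightarrow> complex \<times> complex \<Rightarrow> complex" where
  "LF \<equiv> laplace_zw_formula"

declare laplace_zw_formula.simps [simp del] flip_chart.simps [simp del] std_chart.simps [simp del]

lemma X_eig_OmegaI:
  assumes "G \<in> Hol Omega"
    and "\<And>p. p \<in> UO \<Longrightarrow> LF (G \<circ> std_chart) p = lam * G (std_chart p)"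
    and "\<And>p. p \<in> UO \<Longrightarrow> LF (G \<circ> flip_chart) p = lam * G (flip_chart p)"
  shows "G \<in> X_eig lam Omega"
proof -
  have 1: "LF (G \<circ> std_chart) (z, w) = lam * G (Some z, Some w)" if "z * w \<noteq> 1" for z w
    using assms(2)[of "(z, w)"] that by (simp add: std_chart.simps)
  have 2: "LF (G \<circ> flip_chart) (u, v) = lam * G (flip_chart (u, v))" if "u * v \<noteq> 1" for u v
    using assms(3)[of "(u, v)"] that by simp
  have "laplace_zw G p = lam * G p" if "p \<in> Omega" for p
  proof -
    obtain a b where p: "p = (a, b)" by (cases p)
    show ?thesis
    proof (cases a; cases b)
      fix z w assume "a = Some z" "b = Some w"
      then show ?thesis using 1 that p by auto
    next
      fix z assume "a = Some z" "b = None"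
      then show ?thesis using 2[of 0 "1 / z"] that p by (auto simp: flip_chart.simps)
    next
      fix w assume "a = None" "b = Some w"
      then show ?thesis using 2[of "1 / w" 0] that p by (auto simp: flip_chart.simps)
    next
      assume "a = None" "b = None"
      then show ?thesis using 2[of 0 0] that p by (auto simp: flip_chart.simps)
    qed
  qed
  then show ?thesis using assms(1) by (simp add: X_eig_def)
qed

text \<open>\<open>laplace_zw\<close> consults the flip chart only at points with an infinite
  coordinate. At the other points of that chart the equation is transported from the standard chart
  by \<open>laplace_flip\<close>.\<close>

lemma X_eig_OmegaD:
  assumes "F \<in> X_eig lam Omega"
  shows "F \<in> Hol Omega"
    and "p \<in> UO \<Longrightarrow> LF (F \<circ> std_chart) p = lam * F (std_chart p)"
    and "p \<in> UO \<Longrightarrow> LF (F \<circ> flip_chart) p = lam * F (flip_chart p)"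
proof -
  show F: "F \<in> Hol Omega" using assms by (simp add: X_eig_def)
  have eq: "laplace_zw F q = lam * F q" if "q \<in> Omega" for q
    using assms that by (simp add: X_eig_def)
  have 1: "LF (F \<circ> std_chart) (z, w) = lam * F (std_chart (z, w))" if "z * w \<noteq> 1" for z w
    using eq[of "(Some z, Some w)"] that by (simp add: std_chart.simps)
  then show "LF (F \<circ> std_chart) p = lam * F (std_chart p)" if "p \<in> UO" using that by auto
  show "LF (F \<circ> flip_chart) p = lam * F (flip_chart p)" if p: "p \<in> UO"
  proof -
    obtain u v where uv: "p = (u, v)" "u * v \<noteq> 1" using p by auto
    show ?thesis
    proof (cases "u = 0 \<or> v = 0")
      case False
      then have "1 / v * (1 / u) \<noteq> 1" using uv by (auto simp: field_simps)
      from 1[OF this] show ?thesis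
        using laplace_flip[OF F, of u v] False uv flip_std[of u v] by auto
    next
      case True
      consider "u = 0" "v = 0" | "u = 0" "v \<noteq> 0" | "u \<noteq> 0" "v = 0" using True by auto
      then show ?thesis
        by cases (use uv eq[of "(None, None)"] eq[of "(Some (1 / v), None)"] eq[of "(None, Some (1 / u))"]
          in \<open>auto simp: flip_chart.simps\<close>)
    qed
  qed
qed

lemma pw_DERIV': "sep_holomorphic F U \<Longrightarrow> p \<in> U \<Longrightarrow> ((\<lambda>t. F (fst p, t)) has_field_derivative pw F p) (at (snd p))"
  using pw_DERIV[of F U "fst p" "snd p"] by simp

lemma pz_DERIV': "sep_holomorphic F U \<Longrightarrow> p \<in> U \<Longrightarrow> ((\<lambda>s. F (s, snd p)) has_field_derivative pz F p) (at (fst p))"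
  using pz_DERIV[of F U "fst p" "snd p"] by simp

lemma pw_add: "sep_holomorphic f U \<Longrightarrow> sep_holomorphic g U \<Longrightarrow> p \<in> U \<Longrightarrow> pw (\<lambda>p. f p + g p) p = pw f p + pw g p"
  unfolding pw_def[of "\<lambda>p. f p + g p"] by (rule DERIV_imp_deriv[OF DERIV_add[OF pw_DERIV' pw_DERIV']])

lemma pz_add: "sep_holomorphic f U \<Longrightarrow> sep_holomorphic g U \<Longrightarrow> p \<in> U \<Longrightarrow> pz (\<lambda>p. f p + g p) p = pz f p + pz g p"
  unfolding pz_def[of "\<lambda>p. f p + g p"] by (rule DERIV_imp_deriv[OF DERIV_add[OF pz_DERIV' pz_DERIV']])

lemma pw_cmult: "sep_holomorphic f U \<Longrightarrow> p \<in> U \<Longrightarrow> pw (\<lambda>p. c * f p) p = c * pw f p"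
  unfolding pw_def[of "\<lambda>p. c * f p"] by (rule DERIV_imp_deriv[OF DERIV_cmult[OF pw_DERIV']])

lemma pz_cmult: "sep_holomorphic f U \<Longrightarrow> p \<in> U \<Longrightarrow> pz (\<lambda>p. c * f p) p = c * pz f p"
  unfolding pz_def[of "\<lambda>p. c * f p"] by (rule DERIV_imp_deriv[OF DERIV_cmult[OF pz_DERIV']])

lemma LF_eq: "LF f p = 4 * (1 - fst p * snd p)\<^sup>2 * pz (pw f) p"
  by (cases p) (simp add: laplace_zw_formula_eq)

lemma LF_add:
  assumes "sep_holomorphic f U" "sep_holomorphic g U" "open U" "p \<in> U"
  shows "LF (\<lambda>p. f p + g p) p = LF f p + LF g p"
proof -
  have "pz (pw (\<lambda>p. f p + g p)) p = pz (\<lambda>p. pw f p + pw g p) p"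
    by (rule pz_cong[OF assms(3) _ assms(4)]) (rule pw_add[OF assms(1,2)])
  also have "\<dots> = pz (pw f) p + pz (pw g) p"
    by (rule pz_add[OF pw_sep pw_sep]) (use assms in auto)
  finally show ?thesis by (simp add: LF_eq algebra_simps)
qed

lemma LF_cmult:
  assumes "sep_holomorphic f U" "open U" "p \<in> U"
  shows "LF (\<lambda>p. c * f p) p = c * LF f p"
proof -
  have "pz (pw (\<lambda>p. c * f p)) p = pz (\<lambda>p. c * pw f p) p"
    by (rule pz_cong[OF assms(2) _ assms(3)]) (rule pw_cmult[OF assms(1)])
  also have "\<dots> = c * pz (pw f) p"
    by (rule pz_cmult[OF pw_sep]) (use assms in auto)
  finally show ?thesis by (simp add: LF_eq algebra_simps)
qed

lemma LF_cong: "open U \<Longrightarrow> (\<And>p. p \<in> U \<Longrightarrow> f p = g p) \<Longrightarrow> p \<in> U \<Longrightarrow> LF f p = LF g p"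
  using pz_pw_cong[of U f g p] by (simp add: LF_eq)

lemma subspace_X_eig_Omega: "cfun.subspace (X_eig lam Omega)"
proof (rule cfun.subspaceI)
  have z: "LF (\<lambda>p. 0) p = 0" for p
    by (simp add: LF_eq pz_def pw_def)
  show "0 \<in> X_eig lam Omega"
    by (rule X_eig_OmegaI) (auto simp: Hol_Omega_iff zero_fun_def o_def sep_const z)
next
  fix F G assume F: "F \<in> X_eig lam Omega" and G: "G \<in> X_eig lam Omega"
  have o: "(F + G) \<circ> h = (\<lambda>p. (F \<circ> h) p + (G \<circ> h) p)" for h :: "complex \<times> complex \<Rightarrow> _" by (auto simp: o_def)
  note HF = X_eig_OmegaD(1)[OF F, unfolded Hol_Omega_iff]
  note HG = X_eig_OmegaD(1)[OF G, unfolded Hol_Omega_iff]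
  show "F + G \<in> X_eig lam Omega"
  proof (rule X_eig_OmegaI)
    show "F + G \<in> Hol Omega"
      unfolding Hol_Omega_iff o
      using HF HG sep_add[of "F \<circ> std_chart" UO "G \<circ> std_chart"] sep_add[of "F \<circ> flip_chart" UO "G \<circ> flip_chart"]
      by simp
  next
    fix p assume p: "p \<in> UO"
    show "LF ((F + G) \<circ> std_chart) p = lam * (F + G) (std_chart p)"
      unfolding o using LF_add[of "F \<circ> std_chart" UO "G \<circ> std_chart" p] HF HG p open_zw
        X_eig_OmegaD(2)[OF F p] X_eig_OmegaD(2)[OF G p] by (auto simp: algebra_simps)
    show "LF ((F + G) \<circ> flip_chart) p = lam * (F + G) (flip_chart p)"
      unfolding o using LF_add[of "F \<circ> flip_chart" UO "G \<circ> flip_chart" p] HF HG p open_zw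
        X_eig_OmegaD(3)[OF F p] X_eig_OmegaD(3)[OF G p] by (auto simp: algebra_simps)
  qed
next
  fix c F assume F: "F \<in> X_eig lam Omega"
  have o: "fscale c F \<circ> h = (\<lambda>p. c * (F \<circ> h) p)" for h :: "complex \<times> complex \<Rightarrow> _" by (auto simp: o_def fscale_def)
  note HF = X_eig_OmegaD(1)[OF F, unfolded Hol_Omega_iff]
  show "fscale c F \<in> X_eig lam Omega"
  proof (rule X_eig_OmegaI)
    show "fscale c F \<in> Hol Omega"
      unfolding Hol_Omega_iff o
      using HF sep_mult[OF sep_const[of c], of "F \<circ> std_chart" UO] sep_mult[OF sep_const[of c], of "F \<circ> flip_chart" UO]
      by (simp add: fscale_def)
  next
    fix p assume p: "p \<in> UO"
    show "LF (fscale c F \<circ> std_chart) p = lam * (fscale c F) (std_chart p)"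
      unfolding o using LF_cmult[of "F \<circ> std_chart" UO p c] HF p open_zw
        X_eig_OmegaD(2)[OF F p] by (auto simp: fscale_def)
    show "LF (fscale c F \<circ> flip_chart) p = lam * (fscale c F) (flip_chart p)"
      unfolding o using LF_cmult[of "F \<circ> flip_chart" UO p c] HF p open_zw
        X_eig_OmegaD(3)[OF F p] by (auto simp: fscale_def)
  qed
qed

text \<open>Glues f in the standard chart with s f in the flip chart. The factor s is what f picks
  up under the coordinate change, so that the pieces agree on the overlap.\<close>

definition lift :: "complex \<Rightarrow> (complex \<times> complex \<Rightarrow> complex) \<Rightarrow> sphere \<times> sphere \<Rightarrow> complex" where
  "lift s f p = (if p \<in> Omega then case p of (Some z, Some w) \<Rightarrow> f (z, w)
      | (Some z, None) \<Rightarrow> s * f (0, 1 / z) | (None, Some w) \<Rightarrow> s * f (1 / w, 0)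
      | (None, None) \<Rightarrow> s * f (0, 0) else 0)"

lemma lift_std: "p \<in> UO \<Longrightarrow> lift s f (std_chart p) = f p"
  by (auto simp: lift_def std_chart.simps)

lemma lift_flip:
  assumes "\<And>u v. u \<noteq> 0 \<Longrightarrow> v \<noteq> 0 \<Longrightarrow> u * v \<noteq> 1 \<Longrightarrow> f (1 / v, 1 / u) = s * f (u, v)" "p \<in> UO"
  shows "lift s f (flip_chart p) = s * f p"
proof -
  obtain u v where uv: "p = (u, v)" "u * v \<noteq> 1" using assms(2) by auto
  have "flip_chart (u, v) \<in> Omega" using uv(2) flip_in_Omega by simp
  then show ?thesis using assms(1)[of u v] uv by (auto simp: lift_def flip_chart.simps)
qed

lemma lift_X_eig:
  assumes f: "sep_holomorphic f UO" and s: "\<And>u v. u \<noteq> 0 \<Longrightarrow> v \<noteq> 0 \<Longrightarrow> u * v \<noteq> 1 \<Longrightarrow> f (1 / v, 1 / u) = s * f (u, v)"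
    and L: "\<And>p. p \<in> UO \<Longrightarrow> LF f p = lam * f p"
  shows "lift s f \<in> X_eig lam Omega"
proof (rule X_eig_OmegaI)
  have "sep_holomorphic (lift s f \<circ> std_chart) UO"
    by (rule sep_cong[OF f open_zw]) (simp add: lift_std del: mem_Collect_eq)
  moreover have "sep_holomorphic (lift s f \<circ> flip_chart) UO"
    by (rule sep_cong[OF sep_mult[OF sep_const[of s] f] open_zw]) (simp add: lift_flip[OF s] del: mem_Collect_eq)
  moreover have "lift s f p = 0" if "p \<notin> Omega" for p using that by (simp add: lift_def)
  ultimately show "lift s f \<in> Hol Omega" unfolding Hol_Omega_iff by blast
  fix p assume p: "p \<in> UO"
  have "LF (lift s f \<circ> std_chart) p = LF f p"
    by (rule LF_cong[OF open_zw _ p]) (simp add: lift_std del: mem_Collect_eq)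
  then show "LF (lift s f \<circ> std_chart) p = lam * lift s f (std_chart p)"
    using L[OF p] p by (simp add: lift_std del: mem_Collect_eq)
  have "LF (lift s f \<circ> flip_chart) p = LF (\<lambda>p. s * f p) p"
    by (rule LF_cong[OF open_zw _ p]) (simp add: lift_flip[OF s] del: mem_Collect_eq)
  also have "\<dots> = s * LF f p" by (rule LF_cmult[OF f open_zw p])
  finally show "LF (lift s f \<circ> flip_chart) p = lam * lift s f (flip_chart p)"
    using L[OF p] p by (simp add: lift_flip[OF s] del: mem_Collect_eq)
qed

section \<open>Powers of a reciprocal Poisson kernel\<close>

text \<open>The base (z - a)(1 - aw)/(1 - zw) with homogeneous parameters (a, b), on which disk
  automorphisms will act linearly. On the diagonal, for |a| = 1 and b = 1, it is -a times the
  reciprocal of the Poisson kernel of the boundary point a.\<close>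

definition X_ab :: "complex \<Rightarrow> complex \<Rightarrow> complex \<times> complex \<Rightarrow> complex" where
  "X_ab a b p = (b * fst p - a) * (b - a * snd p) / (1 - fst p * snd p)"

lemma LF_X_ab_algebra:
  fixes q :: complex
  assumes "q \<noteq> 0"
  shows "4 * q\<^sup>2 * (F2 * (B\<^sup>2 / q\<^sup>2) * (A\<^sup>2 / q\<^sup>2) + F1 * (2 * A * B / q ^ 3))
    = 4 * ((A * B / q)\<^sup>2 * F2 + 2 * (A * B / q) * F1)"
  using assms by (simp add: power2_eq_square power3_eq_cube field_simps)

text \<open>On functions of x = \<open>X_ab a b p\<close> the operator becomes the Euler operator 4
  (x^2 D^2 + 2x D), so x^s has the eigenvalue 4s(s + 1). The open set W is a parameter because
  negative exponents are possible only where the base is nonzero.\<close>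

lemma LF_X_ab:
  assumes W: "open W" "W \<subseteq> UO" and p: "p \<in> W"
    and \<phi>: "\<And>p. p \<in> W \<Longrightarrow> (\<phi> has_field_derivative \<phi>' (X_ab a b p)) (at (X_ab a b p))"
      "\<And>p. p \<in> W \<Longrightarrow> (\<phi>' has_field_derivative \<phi>'' (X_ab a b p)) (at (X_ab a b p))"
  shows "LF (\<lambda>p. \<phi> (X_ab a b p)) p = 4 * ((X_ab a b p)\<^sup>2 * \<phi>'' (X_ab a b p) + 2 * X_ab a b p * \<phi>' (X_ab a b p))"
proof -
  have ne: "1 - fst p * snd p \<noteq> 0" if "p \<in> W" for p using that W(2) by auto
  have 1: "pw (\<lambda>p. \<phi> (X_ab a b p)) p = \<phi>' (X_ab a b p) * ((b * fst p - a)\<^sup>2 / (1 - fst p * snd p)\<^sup>2)" if p: "p \<in> W" for p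
    unfolding pw_def
  proof (rule DERIV_imp_deriv)
    have "((\<lambda>t. X_ab a b (fst p, t)) has_field_derivative (b * fst p - a)\<^sup>2 / (1 - fst p * snd p)\<^sup>2) (at (snd p))"
      unfolding X_ab_def using ne[OF p]
      by (auto intro!: derivative_eq_intros simp: power2_eq_square algebra_simps divide_simps)
    from DERIV_chain2[OF _ this, of \<phi> "\<phi>' (X_ab a b p)"] \<phi>(1)[OF p]
    show "((\<lambda>t. \<phi> (X_ab a b (fst p, t))) has_field_derivative \<phi>' (X_ab a b p) * ((b * fst p - a)\<^sup>2 / (1 - fst p * snd p)\<^sup>2)) (at (snd p))"
      by simp
  qed
  let ?Q = "1 - fst p * snd p"
  have "pz (pw (\<lambda>p. \<phi> (X_ab a b p))) p = pz (\<lambda>p. \<phi>' (X_ab a b p) * ((b * fst p - a)\<^sup>2 / (1 - fst p * snd p)\<^sup>2)) p"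
    by (rule pz_cong[OF W(1) 1 p])
  also have "\<dots> = \<phi>'' (X_ab a b p) * ((b - a * snd p)\<^sup>2 / ?Q\<^sup>2) * ((b * fst p - a)\<^sup>2 / ?Q\<^sup>2)
      + \<phi>' (X_ab a b p) * (2 * (b * fst p - a) * (b - a * snd p) / ?Q ^ 3)"
    unfolding pz_def
  proof (rule DERIV_imp_deriv)
    have "((\<lambda>s. X_ab a b (s, snd p)) has_field_derivative (b - a * snd p)\<^sup>2 / ?Q\<^sup>2) (at (fst p))"
      unfolding X_ab_def using ne[OF p]
      by (auto intro!: derivative_eq_intros simp: power2_eq_square algebra_simps divide_simps)
    from DERIV_chain2[OF _ this, of \<phi>' "\<phi>'' (X_ab a b p)"] \<phi>(2)[OF p]
    have d1: "((\<lambda>s. \<phi>' (X_ab a b (s, snd p))) has_field_derivative \<phi>'' (X_ab a b p) * ((b - a * snd p)\<^sup>2 / ?Q\<^sup>2)) (at (fst p))"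
      by simp
    have "((\<lambda>s. (b * s - a) / (1 - s * snd p)) has_field_derivative (b - a * snd p) / ?Q\<^sup>2) (at (fst p))"
      using ne[OF p] by (auto intro!: derivative_eq_intros simp: power2_eq_square algebra_simps divide_simps)
    note d = this
    have d2: "((\<lambda>s. (b * s - a)\<^sup>2 / (1 - s * snd p)\<^sup>2) has_field_derivative 2 * (b * fst p - a) * (b - a * snd p) / ?Q ^ 3) (at (fst p))"
      unfolding power_divide[symmetric]
      by (rule DERIV_cong[OF DERIV_power[OF d, of 2]]) (use ne[OF p] in \<open>simp add: power3_eq_cube power2_eq_square field_simps\<close>)
    show "((\<lambda>s. \<phi>' (X_ab a b (s, snd p)) * ((b * fst (s, snd p) - a)\<^sup>2 / (1 - fst (s, snd p) * snd (s, snd p))\<^sup>2))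
       has_field_derivative \<phi>'' (X_ab a b p) * ((b - a * snd p)\<^sup>2 / ?Q\<^sup>2) * ((b * fst p - a)\<^sup>2 / ?Q\<^sup>2)
      + \<phi>' (X_ab a b p) * (2 * (b * fst p - a) * (b - a * snd p) / ?Q ^ 3)) (at (fst p))"
      using DERIV_mult[OF d1 d2] by (simp add: add.commute mult.commute)
  qed
  finally have "LF (\<lambda>p. \<phi> (X_ab a b p)) p = 4 * ?Q\<^sup>2 * (\<phi>'' (X_ab a b p) * ((b - a * snd p)\<^sup>2 / ?Q\<^sup>2) * ((b * fst p - a)\<^sup>2 / ?Q\<^sup>2)
      + \<phi>' (X_ab a b p) * (2 * (b * fst p - a) * (b - a * snd p) / ?Q ^ 3))"
    by (simp add: LF_eq)
  also have "\<dots> = 4 * (((b * fst p - a) * (b - a * snd p) / ?Q)\<^sup>2 * \<phi>'' (X_ab a b p) + 2 * ((b * fst p - a) * (b - a * snd p) / ?Q) * \<phi>' (X_ab a b p))"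
    by (rule LF_X_ab_algebra[OF ne[OF p]])
  finally show ?thesis by (simp add: X_ab_def[symmetric])
qed

lemma sep_X_ab: "W \<subseteq> UO \<Longrightarrow> sep_holomorphic (X_ab a b) W"
  unfolding X_ab_def by (intro sep_divide sep_mult sep_diff sep_const sep_fst sep_snd) auto

definition E0 :: "nat \<Rightarrow> complex \<Rightarrow> complex \<Rightarrow> complex \<times> complex \<Rightarrow> complex" where
  "E0 m a b p = X_ab a b p ^ m"

abbreviation eigval :: "nat \<Rightarrow> complex" where
  "eigval m \<equiv> 4 * of_nat m * (of_nat m + 1)"

lemma LF_E0:
  assumes "p \<in> UO"
  shows "LF (E0 m a b) p = eigval m * E0 m a b p"
proof -
  let ?x = "X_ab a b p"
  have "LF (\<lambda>p. X_ab a b p ^ m) p = 4 * (?x\<^sup>2 * (of_nat m * (of_nat (m - 1) * ?x ^ (m - 1 - 1))) + 2 * ?x * (of_nat m * ?x ^ (m - 1)))"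
    by (rule LF_X_ab[OF open_zw order_refl assms, where \<phi> = "\<lambda>x. x ^ m" and \<phi>' = "\<lambda>x. of_nat m * x ^ (m - 1)" and \<phi>'' = "\<lambda>x. of_nat m * (of_nat (m - 1) * x ^ (m - 1 - 1))"])
       (auto intro!: derivative_eq_intros)
  also have "\<dots> = eigval m * ?x ^ m"
  proof (cases m)
    case (Suc k)
    then show ?thesis by (cases k) (simp_all add: power2_eq_square algebra_simps)
  qed simp
  finally show ?thesis by (simp add: E0_def[abs_def])
qed

text \<open>The base changes sign under the coordinate change; hence the factor (-1)^m in
  \<open>E_Omega\<close>.\<close>

lemma E0_flip:
  assumes "u \<noteq> 0" "v \<noteq> 0" "u * v \<noteq> 1"
  shows "E0 m a b (1 / v, 1 / u) = (- 1) ^ m * E0 m a b (u, v)"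
proof -
  have "X_ab a b (1 / v, 1 / u) = - X_ab a b (u, v)"
    using assms by (simp add: X_ab_def divide_simps) (simp add: algebra_simps)
  then show ?thesis by (simp add: E0_def power_minus[of "X_ab a b (u, v)"])
qed

definition E_Omega :: "nat \<Rightarrow> complex \<Rightarrow> complex \<Rightarrow> sphere \<times> sphere \<Rightarrow> complex" where
  "E_Omega m a b = lift ((- 1) ^ m) (E0 m a b)"

lemma E_Omega_X_eig: "E_Omega m a b \<in> X_eig (eigval m) Omega"
  unfolding E_Omega_def
  by (rule lift_X_eig[OF _ E0_flip LF_E0]) (auto simp: E0_def[abs_def] intro!: sep_power sep_X_ab)

section \<open>The 2m + 1 coefficient functions and their independence\<close>

text \<open>The coefficient of (-a)^j b^(2m - j) in \<open>E0 m a b\<close>, written out so that its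
  homogeneity and the positivity of its numerator can be read off.\<close>

definition e0 :: "nat \<Rightarrow> nat \<Rightarrow> complex \<times> complex \<Rightarrow> complex" where
  "e0 m j p = (\<Sum>i\<le>m. \<Sum>k\<le>m. if i + k = j then of_nat (m choose i) * of_nat (m choose k) * fst p ^ (m - i) * snd p ^ k else 0)
     / (1 - fst p * snd p) ^ m"

definition e_Omega :: "nat \<Rightarrow> nat \<Rightarrow> sphere \<times> sphere \<Rightarrow> complex" where
  "e_Omega m j = lift ((- 1) ^ m) (e0 m j)"

text \<open>Both factors of the numerator are expanded by the binomial theorem, and the products of
  terms are collected by j = i + k.\<close>

lemma E0_expand: "E0 m a b p = (\<Sum>j\<le>2 * m. ((- a) ^ j * b ^ (2 * m - j)) * e0 m j p)"
proof -
  obtain z w where p: "p = (z, w)" by (cases p)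
  define N where "N j = (\<Sum>i\<le>m. \<Sum>k\<le>m. if i + k = j then
      of_nat (m choose i) * of_nat (m choose k) * z ^ (m - i) * w ^ k else 0)" for j
  have 1: "(b * z - a) ^ m = (\<Sum>i\<le>m. of_nat (m choose i) * (- a) ^ i * (b * z) ^ (m - i))"
    using binomial_ring[of "- a" "b * z" m] by simp
  have 2: "(b - a * w) ^ m = (\<Sum>k\<le>m. of_nat (m choose k) * (- a * w) ^ k * b ^ (m - k))"
    using binomial_ring[of "- a * w" b m] by simp
  have "(b * z - a) ^ m * (b - a * w) ^ m = (\<Sum>i\<le>m. \<Sum>k\<le>m.
      (of_nat (m choose i) * (- a) ^ i * (b * z) ^ (m - i)) * (of_nat (m choose k) * (- a * w) ^ k * b ^ (m - k)))"
    unfolding 1 2 by (rule sum_product)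
  also have "\<dots> = (\<Sum>i\<le>m. \<Sum>k\<le>m. \<Sum>j\<le>2 * m. if i + k = j then
      ((- a) ^ j * b ^ (2 * m - j)) * (of_nat (m choose i) * of_nat (m choose k) * z ^ (m - i) * w ^ k) else 0)"
  proof (intro sum.cong refl)
    fix i k assume "i \<in> {..m}" "k \<in> {..m}"
    then have ik: "i + k \<le> 2 * m" "2 * m - (i + k) = (m - i) + (m - k)" by auto
    have "(of_nat (m choose i) * (- a) ^ i * (b * z) ^ (m - i)) * (of_nat (m choose k) * (- a * w) ^ k * b ^ (m - k))
      = ((- a) ^ (i + k) * b ^ (2 * m - (i + k))) * (of_nat (m choose i) * of_nat (m choose k) * z ^ (m - i) * w ^ k)"
      unfolding ik(2) power_add power_mult_distrib by (simp only: mult_ac)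
    then show "(of_nat (m choose i) * (- a) ^ i * (b * z) ^ (m - i)) * (of_nat (m choose k) * (- a * w) ^ k * b ^ (m - k))
      = (\<Sum>j\<le>2 * m. if i + k = j then
      ((- a) ^ j * b ^ (2 * m - j)) * (of_nat (m choose i) * of_nat (m choose k) * z ^ (m - i) * w ^ k) else 0)"
      using ik(1) by (simp add: sum.delta')
  qed
  also have "\<dots> = (\<Sum>i\<le>m. \<Sum>j\<le>2 * m. \<Sum>k\<le>m. if i + k = j then
      ((- a) ^ j * b ^ (2 * m - j)) * (of_nat (m choose i) * of_nat (m choose k) * z ^ (m - i) * w ^ k) else 0)"
    by (intro sum.cong refl sum.swap)
  also have "\<dots> = (\<Sum>j\<le>2 * m. \<Sum>i\<le>m. \<Sum>k\<le>m. if i + k = j then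
      ((- a) ^ j * b ^ (2 * m - j)) * (of_nat (m choose i) * of_nat (m choose k) * z ^ (m - i) * w ^ k) else 0)"
    by (rule sum.swap)
  also have "\<dots> = (\<Sum>j\<le>2 * m. ((- a) ^ j * b ^ (2 * m - j)) * (\<Sum>i\<le>m. \<Sum>k\<le>m. if i + k = j then
      of_nat (m choose i) * of_nat (m choose k) * z ^ (m - i) * w ^ k else 0))"
    by (simp add: sum_distrib_left if_distrib[of "\<lambda>x. _ * x"] cong: if_cong)
  finally have prod: "(b * z - a) ^ m * (b - a * w) ^ m = (\<Sum>j\<le>2 * m. ((- a) ^ j * b ^ (2 * m - j)) * N j)"
    by (simp only: N_def)
  have eN: "e0 m j p = N j / (1 - z * w) ^ m" for j
    unfolding e0_def p fst_conv snd_conv N_def ..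
  have "E0 m a b p = (b * z - a) ^ m * (b - a * w) ^ m / (1 - z * w) ^ m"
    by (simp add: E0_def X_ab_def p power_divide power_mult_distrib)
  also have "\<dots> = (\<Sum>j\<le>2 * m. ((- a) ^ j * b ^ (2 * m - j)) * e0 m j p)"
    unfolding prod eN by (simp add: sum_divide_distrib)
  finally show ?thesis .
qed

text \<open>Interpolation without a Vandermonde determinant: replacing a by 2a and subtracting 2^N
  times the original relation removes the top term of degree N and multiplies the others by nonzero
  constants. The value a = 0 is excluded because a will also serve as a divisor.\<close>

lemma subspace_filter:
  assumes S: "cfun.subspace S" and x: "\<And>a. a \<noteq> 0 \<Longrightarrow> (\<Sum>j\<le>N. fscale (a ^ j) (x j)) \<in> S" and j: "j \<le> N"
  shows "x j \<in> S"
  using x j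
proof (induction N arbitrary: x j)
  case 0
  then show ?case using 0(1)[of 1] by (simp add: fscale_def)
next
  case (Suc N)
  have sc: "fscale c (sum f A) = (\<Sum>i\<in>A. fscale c (f i))" for c and f :: "nat \<Rightarrow> 'a \<Rightarrow> complex" and A
    by (rule cfun.scale_sum_right)
  have 1: "fscale (2 ^ j - 2 ^ Suc N) (x j) \<in> S" if "j \<le> N" for j
  proof (rule Suc.IH[where x = "\<lambda>j. fscale (2 ^ j - 2 ^ Suc N) (x j)"])
    fix a :: complex assume a: "a \<noteq> 0"
    have "(\<Sum>j\<le>Suc N. fscale ((2 * a) ^ j) (x j)) - fscale (2 ^ Suc N) (\<Sum>j\<le>Suc N. fscale (a ^ j) (x j)) \<in> S"
      by (intro cfun.subspace_diff[OF S] cfun.subspace_scale[OF S] Suc.prems(1)) (use a in auto)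
    also have "(\<Sum>j\<le>Suc N. fscale ((2 * a) ^ j) (x j)) - fscale (2 ^ Suc N) (\<Sum>j\<le>Suc N. fscale (a ^ j) (x j))
      = (\<Sum>j\<le>N. fscale (a ^ j) (fscale (2 ^ j - 2 ^ Suc N) (x j)))"
    proof -
      have t: "fscale ((2 * a) ^ j) (x j) - fscale (2 ^ Suc N) (fscale (a ^ j) (x j)) = fscale (a ^ j) (fscale (2 ^ j - 2 ^ Suc N) (x j))" for j
        by (auto simp: fscale_def fun_eq_iff power_mult_distrib algebra_simps)
      show ?thesis
        unfolding sc unfolding sum_subtractf[symmetric] t unfolding sum.atMost_Suc
        by (simp add: fscale_def zero_fun_def[symmetric])
    qed
    finally show "(\<Sum>j\<le>N. fscale (a ^ j) (fscale (2 ^ j - 2 ^ Suc N) (x j))) \<in> S" .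
  qed fact
  have 2: "x j \<in> S" if "j \<le> N" for j
  proof -
    have "(2::complex) ^ j \<noteq> 2 ^ Suc N"
    proof
      assume "(2::complex) ^ j = 2 ^ Suc N"
      then have "cmod (2 ^ j) = cmod (2 ^ Suc N)" by simp
      then have "(2::real) ^ j = 2 ^ Suc N" by (simp add: norm_power)
      then show False using that power_inject_exp[of "2::real" j "Suc N"] by simp
    qed
    then have "x j = fscale (1 / (2 ^ j - 2 ^ Suc N)) (fscale (2 ^ j - 2 ^ Suc N) (x j))"
      by (simp add: fscale_def)
    then show ?thesis using cfun.subspace_scale[OF S 1[OF that]] by metis
  qed
  have "(\<Sum>j\<le>Suc N. fscale (1 ^ j) (x j)) - (\<Sum>j\<le>N. x j) \<in> S"
    by (intro cfun.subspace_diff[OF S] cfun.subspace_sum[OF S] Suc.prems(1) 2) auto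
  then have "x (Suc N) \<in> S" by (simp add: fscale_def)
  then show ?case using 2 Suc.prems(2) by (cases "j = Suc N") auto
qed

lemma lift_sum: "lift s (\<lambda>p. \<Sum>j\<in>A. c j * f j p) = (\<Sum>j\<in>A. fscale (c j) (lift s (f j)))"
proof
  fix p :: "sphere \<times> sphere"
  have ev: "(\<Sum>j\<in>A. fscale (c j) (lift s (f j))) p = (\<Sum>j\<in>A. c j * lift s (f j) p)"
    by (induction A rule: infinite_finite_induct) (auto simp: fscale_def)
  show "lift s (\<lambda>p. \<Sum>j\<in>A. c j * f j p) p = (\<Sum>j\<in>A. fscale (c j) (lift s (f j))) p"
  proof -
    obtain a b where "p = (a, b)" by (cases p)
    then show ?thesis
      unfolding ev lift_def by (cases a; cases b) (auto simp: sum_distrib_left mult_ac intro!: sum.cong)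
  qed
qed

lemma E_Omega_expand: "E_Omega m a b = (\<Sum>j\<le>2 * m. fscale ((- a) ^ j * b ^ (2 * m - j)) (e_Omega m j))"
proof -
  have "E0 m a b = (\<lambda>p. \<Sum>j\<le>2 * m. ((- a) ^ j * b ^ (2 * m - j)) * e0 m j p)"
    by (rule ext) (rule E0_expand)
  then show ?thesis by (simp only: E_Omega_def e_Omega_def lift_sum)
qed

lemma e_Omega_in_subspace:
  assumes S: "cfun.subspace S" and E: "\<And>a. E_Omega m a 1 \<in> S" and j: "j \<le> 2 * m"
  shows "e_Omega m j \<in> S"
proof -
  have "(\<Sum>j\<le>2 * m. fscale (a ^ j) (e_Omega m j)) = E_Omega m (- a) 1" for a
    by (simp add: E_Omega_expand)
  then show ?thesis using subspace_filter[OF S, where N = "2 * m" and x = "e_Omega m"] E j by simp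
qed

lemma e_Omega_X_eig: "j \<le> 2 * m \<Longrightarrow> e_Omega m j \<in> X_eig (eigval m) Omega"
  using e_Omega_in_subspace[OF subspace_X_eig_Omega E_Omega_X_eig] .

text \<open>The monomials of the numerator have z-degree m - i and w-degree k with i + k = j, while
  zw is invariant under the scaling.\<close>

lemma e0_rotate:
  assumes "j \<le> 2 * m" "\<zeta> \<noteq> 0"
  shows "\<zeta> ^ m * e0 m j (z / \<zeta>, w * \<zeta>) = \<zeta> ^ j * e0 m j (z, w)"
proof -
  have "(\<zeta> ^ m * (\<Sum>i\<le>m. \<Sum>k\<le>m. if i + k = j then of_nat (m choose i) * of_nat (m choose k) * (z / \<zeta>) ^ (m - i) * (w * \<zeta>) ^ k else 0))
   = \<zeta> ^ j * (\<Sum>i\<le>m. \<Sum>k\<le>m. if i + k = j then of_nat (m choose i) * of_nat (m choose k) * z ^ (m - i) * w ^ k else 0)"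
    unfolding sum_distrib_left
  proof (intro sum.cong refl)
    fix i k assume "i \<in> {..m}" "k \<in> {..m}"
    then have "\<zeta> ^ m = \<zeta> ^ i * \<zeta> ^ (m - i)" by (simp add: power_add[symmetric])
    then show "\<zeta> ^ m * (if i + k = j then of_nat (m choose i) * of_nat (m choose k) * (z / \<zeta>) ^ (m - i) * (w * \<zeta>) ^ k else 0)
     = \<zeta> ^ j * (if i + k = j then of_nat (m choose i) * of_nat (m choose k) * z ^ (m - i) * w ^ k else 0)"
      using assms(2) by (auto simp: power_divide power_mult_distrib power_add field_simps)
  qed
  moreover have "z / \<zeta> * (w * \<zeta>) = z * w" using assms(2) by simp
  ultimately show ?thesis unfolding e0_def fst_conv snd_conv by simp
qed

lemma e0_half_nonzero:
  assumes j: "j \<le> 2 * m"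
  shows "e0 m j (1/2, 1/2) \<noteq> 0"
proof -
  let ?t = "\<lambda>i k. if i + k = j then real (m choose i) * real (m choose k) * (1/2) ^ (m - i) * (1/2) ^ k else 0"
  have nn: "?t i k \<ge> 0" for i k by simp
  \<comment> \<open>Two halves of j, each at most m because j \<le> 2m. This single pair makes the
    sum of nonnegative terms positive.\<close>
  define i where "i = j - j div 2" define k where "k = j div 2"
  have ik: "i + k = j" "i \<le> m" "k \<le> m" using j by (auto simp: i_def k_def)
  have "?t i k > 0" using ik by simp
  also have "?t i k \<le> (\<Sum>k\<le>m. ?t i k)" by (rule member_le_sum) (use ik nn in auto)
  also have "\<dots> \<le> (\<Sum>i\<le>m. \<Sum>k\<le>m. ?t i k)"
    by (rule member_le_sum[where f = "\<lambda>i. \<Sum>k\<le>m. ?t i k"]) (use ik nn in \<open>auto intro!: sum_nonneg\<close>)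
  finally have pos: "(\<Sum>i\<le>m. \<Sum>k\<le>m. ?t i k) > 0" .
  have "e0 m j (1/2, 1/2) = complex_of_real (\<Sum>i\<le>m. \<Sum>k\<le>m. ?t i k) / (1 - 1/4) ^ m"
    by (auto simp: e0_def intro!: arg_cong2[of _ _ _ _ "(/)"] sum.cong)
  then show ?thesis using pos by (simp del: of_real_sum)
qed

text \<open>A relation is evaluated along the orbit of (1/2, 1/2) under (z, w) -> (z/a, aw). By
  homogeneity it becomes a polynomial in a that vanishes for all a \<noteq> 0, and
  \<open>subspace_filter\<close> isolates its terms.\<close>

lemma e_Omega_independent_aux:
  assumes "(\<Sum>j\<le>2 * m. fscale (c j) (e_Omega m j)) = 0" and j: "j \<le> 2 * m"
  shows "c j = 0"
proof -
  have z: "(\<Sum>j\<le>2 * m. c j * e0 m j p) = 0" if "p \<in> UO" for p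
  proof -
    have "(\<Sum>j\<le>2 * m. c j * e0 m j p) = lift ((-1)^m) (\<lambda>p. \<Sum>j\<le>2 * m. c j * e0 m j p) (std_chart p)"
      using that by (simp add: lift_std del: mem_Collect_eq)
    also have "\<dots> = 0" using assms(1) by (simp add: lift_sum e_Omega_def)
    finally show ?thesis .
  qed
  \<comment> \<open>Scalars are viewed as functions on the one-point type, so that
    \<open>subspace_filter\<close> applies to the zero subspace.\<close>
  have "(\<lambda>_::unit. c j * e0 m j (1/2, 1/2)) \<in> {0}"
  proof (rule subspace_filter[OF cfun.subspace_single_0 _ j, where x = "\<lambda>j _. c j * e0 m j (1/2, 1/2)"])
    fix a :: complex assume a: "a \<noteq> 0"
    have "(\<Sum>j\<le>2 * m. a ^ j * (c j * e0 m j (1/2, 1/2))) = (\<Sum>j\<le>2 * m. c j * (a ^ m * e0 m j (1/2 / a, 1/2 * a)))"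
    proof (intro sum.cong refl)
      fix j assume "j \<in> {..2 * m}"
      then have "a ^ m * e0 m j (1/2 / a, 1/2 * a) = a ^ j * e0 m j (1/2, 1/2)"
        using e0_rotate[of j m a "1/2" "1/2"] a by simp
      then show "a ^ j * (c j * e0 m j (1/2, 1/2)) = c j * (a ^ m * e0 m j (1/2 / a, 1/2 * a))"
        by (simp only: mult.left_commute)
    qed
    also have "\<dots> = a ^ m * (\<Sum>j\<le>2 * m. c j * e0 m j (1/2 / a, 1/2 * a))"
      by (simp add: sum_distrib_left mult_ac)
    also have "\<dots> = 0" using z[of "(1/2 / a, 1/2 * a)"] a by simp
    finally have *: "(\<Sum>j\<le>2 * m. a ^ j * (c j * e0 m j (1/2, 1/2))) = 0" .
    have ev: "(\<Sum>j\<in>A. fscale (a ^ j) (\<lambda>_::unit. c j * e0 m j (1/2, 1/2))) = (\<lambda>_. \<Sum>j\<in>A. a ^ j * (c j * e0 m j (1/2, 1/2)))" for A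
      by (induction A rule: infinite_finite_induct) (auto simp: fscale_def fun_eq_iff)
    show "(\<Sum>j\<le>2 * m. fscale (a ^ j) (\<lambda>_::unit. c j * e0 m j (1/2, 1/2))) \<in> {0}"
      unfolding ev * by (simp add: zero_fun_def)
  qed
  then show ?thesis using e0_half_nonzero[OF j] by (auto simp: fun_eq_iff)
qed

lemma e_Omega_inj: "inj_on (e_Omega m) {..2 * m}"
proof (rule inj_onI, rule ccontr)
  fix j k assume jk: "j \<in> {..2 * m}" "k \<in> {..2 * m}" "e_Omega m j = e_Omega m k" "j \<noteq> k"
  let ?c = "\<lambda>i. (if i = j then 1 else 0) + (if i = k then -1 else 0) :: complex"
  have "(\<Sum>i\<le>2 * m. fscale (?c i) (e_Omega m i)) = (\<Sum>i\<le>2 * m. (if i = j then e_Omega m i else 0) + (if i = k then - e_Omega m i else 0))"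
    by (intro sum.cong) (auto simp: fscale_def fun_eq_iff)
  also have "\<dots> = 0" using jk by (simp add: sum.distrib)
  finally have "?c j = 0" using e_Omega_independent_aux[where m = m and c = ?c and j = j] jk by auto
  then show False using jk(4) by simp
qed

lemma e_Omega_independent: "cfun.independent (e_Omega m ` {..2 * m})"
proof -
  have "u v = 0" if "(\<Sum>v\<in>e_Omega m ` {..2 * m}. fscale (u v) v) = 0" "v \<in> e_Omega m ` {..2 * m}" for u v
  proof -
    have "(\<Sum>j\<le>2 * m. fscale (u (e_Omega m j)) (e_Omega m j)) = 0"
      using that(1) by (simp add: sum.reindex[OF e_Omega_inj])
    from e_Omega_independent_aux[OF this] show ?thesis using that(2) by auto
  qed
  then show ?thesis by (subst cfun.dependent_finite) auto
qed

lemma dim_span_e_Omega: "cfun.dim (cfun.span (e_Omega m ` {..2 * m})) = 2 * m + 1"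
  using cfun.dim_span_eq_card_independent[OF e_Omega_independent, of m] card_image[OF e_Omega_inj, of m] by simp

section \<open>Eigenfunctions on the sphere\<close>

definition S_eig :: "complex \<Rightarrow> (sphere \<Rightarrow> complex) set" where
  "S_eig lam = {g. C2_sphere g \<and> (\<forall>z. laplace_sphere g z = lam * g z)}"

text \<open>The antidiagonal w = -cnj z is a copy of the sphere inside Omega: at its finite points 1
  - zw = 1 + |z|^2 never vanishes.\<close>

definition anti :: "(sphere \<times> sphere \<Rightarrow> complex) \<Rightarrow> sphere \<Rightarrow> complex" where
  "anti F = (\<lambda>z. F (z, neg_cnj z))"

lemma antidiag_UO: "{z. (z, (- 1) * cnj z) \<in> UO} = UNIV"
proof -
  have "z * (- cnj z) \<noteq> 1" for z
  proof
    assume "z * (- cnj z) = 1"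
    then have "- complex_of_real ((cmod z)\<^sup>2) = 1" unfolding complex_norm_square by simp
    then have "- ((cmod z)\<^sup>2) = 1" by (metis of_real_minus of_real_eq_1_iff)
    then show False by (smt (verit) zero_le_power2)
  qed
  then show ?thesis by auto
qed

lemma swap_UO: "prod.swap -` UO = UO"
  by (auto simp: mult.commute)

text \<open>The flip chart exchanges the two variables: over the point 1/s of the sphere its
  coordinates are (-cnj s, s). Hence the swap.\<close>

lemma anti_charts:
  "anti F (Some s) = (F \<circ> std_chart) (s, (- 1) * cnj s)"
  "anti F (inv_chart s) = (F \<circ> flip_chart \<circ> prod.swap) (s, (- 1) * cnj s)"
  by (auto simp: anti_def neg_cnj_def std_chart.simps flip_chart.simps)

lemma anti_S_eig:
  assumes F: "F \<in> X_eig lam Omega"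
  shows "anti F \<in> S_eig lam"
proof -
  have s: "sep_holomorphic (F \<circ> std_chart) UO" "sep_holomorphic (F \<circ> flip_chart) UO"
    using X_eig_OmegaD(1)[OF F] by (auto simp: Hol_Omega_iff)
  have s': "sep_holomorphic (F \<circ> flip_chart \<circ> prod.swap) UO"
    using sep_holomorphic_swap[OF s(2)] by (simp only: swap_UO)
  have C: "C2_sphere (anti F)"
    unfolding C2_sphere_def anti_charts
    using sep_C2(1)[OF s(1) open_zw, of "-1"] sep_C2(1)[OF s' open_zw, of "-1"]
    by (simp only: antidiag_UO)
  have in_UO: "(z, (- 1) * cnj z) \<in> UO" for z using antidiag_UO by blast
  have "laplace_sphere (anti F) (Some z) = lam * anti F (Some z)" for z
  proof -
    have cn: "(complex_of_real (cmod z))\<^sup>2 = z * cnj z" by (metis complex_norm_square of_real_power)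
    have "laplace_sphere (anti F) (Some z) = LF (F \<circ> std_chart) (z, (- 1) * cnj z)"
      using sep_C2(2)[OF s(1) open_zw in_UO[of z]]
      by (simp add: laplace_sphere_formula_def anti_charts LF_eq cn)
    also have "\<dots> = lam * F (std_chart (z, (- 1) * cnj z))"
      by (rule X_eig_OmegaD(2)[OF F in_UO])
    finally show ?thesis by (simp add: anti_charts)
  qed
  moreover have "laplace_sphere (anti F) None = lam * anti F None"
  proof -
    let ?h = "F \<circ> flip_chart"
    have "pw (?h \<circ> prod.swap) = pz ?h \<circ> prod.swap"
      by (simp add: fun_eq_iff pw_def pz_def)
    then have "pz (pw (?h \<circ> prod.swap)) (0, 0) = pw (pz ?h) (0, 0)"
      by (simp add: pz_swap[of "pz ?h \<circ> prod.swap"]) (simp add: o_def)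
    also have "\<dots> = pz (pw ?h) (0, 0)" by (rule pz_pw_commute[OF s(2) open_zw]) simp
    finally have "laplace_sphere (anti F) None = LF ?h (0, 0)"
      using sep_C2(2)[OF s' open_zw in_UO[of 0]]
      by (simp add: laplace_sphere_formula_def anti_charts LF_eq del: sphere_inverse.simps)
    also have "\<dots> = lam * F (flip_chart (0, 0))"
      by (rule X_eig_OmegaD(3)[OF F]) simp
    finally show ?thesis by (simp add: anti_def neg_cnj_def flip_chart.simps)
  qed
  ultimately have "laplace_sphere (anti F) z = lam * anti F z" for z by (cases z) auto
  then show ?thesis using C by (simp add: S_eig_def)
qed

text \<open>The function f (z, -w) vanishes on the diagonal, so \<open>bidisk_identity\<close>
  applies to it.\<close>

lemma anti_zero:
  assumes F: "F \<in> Hol Omega" and 0: "anti F = (\<lambda>_. 0)"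
  shows "F = (\<lambda>_. 0)"
proof (rule Hol_Omega_zero[OF F])
  fix z w :: complex assume zw: "cmod z < 1" "cmod w < 1"
  let ?f = "F \<circ> std_chart"
  have s: "sep_holomorphic ?f UO" using F by (auto simp: Hol_Omega_iff)
  have inU: "(z, - w) \<in> UO" if "(z, w) \<in> ball 0 1 \<times> ball 0 1" for z w
    using that bidisk_zw[of z "- w"] by auto
  have "sep_holomorphic (\<lambda>p. ?f (fst p, - snd p)) (ball 0 1 \<times> ball 0 1)"
    unfolding sep_holomorphic_def
  proof (intro conjI allI impI)
    show "continuous_on (ball 0 1 \<times> ball 0 1) (\<lambda>p. ?f (fst p, - snd p))"
      by (rule continuous_on_compose2[OF s[unfolded sep_holomorphic_def, THEN conjunct1]])
         (use inU in \<open>auto intro!: continuous_intros\<close>)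
    fix z w :: complex assume "(z, w) \<in> ball 0 1 \<times> ball 0 1"
    note p = inU[OF this]
    show "(\<lambda>s. ?f (fst (s, w), - snd (s, w))) field_differentiable at z"
      using pz_DERIV[OF s p] by (auto simp: field_differentiable_def)
    have "((\<lambda>t. ?f (z, - t)) has_field_derivative pw ?f (z, - w) * (- 1)) (at w)"
      by (rule DERIV_chain2[where f = "\<lambda>t. ?f (z, t)" and g = uminus and x = w, OF pw_DERIV[OF s p]]) (auto intro!: derivative_eq_intros)
    then show "(\<lambda>t. ?f (fst (z, t), - snd (z, t))) field_differentiable at w"
      by (auto simp: field_differentiable_def)
  qed
  from bidisk_identity[OF this, of z "- w"]
  show "F (Some z, Some w) = 0"
    using zw fun_cong[OF 0, of "Some _"] by (simp add: anti_def neg_cnj_def std_chart.simps)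
qed

text \<open>
  In the variable \<open>t = r\<^sup>2 / (1 + r\<^sup>2)\<close> the \<open>n\<close>-th Fourier coefficient \<open>U\<close> of an eigenfunction and
  \<open>r\<close> times the \<open>(n + 1)\<close>-st Fourier coefficient of its \<open>\<partial>/\<partial>\<zeta>\<^bsup>-\<^esup>\<close> derivative solve this system.
\<close>

definition sys :: "int \<Rightarrow> complex \<Rightarrow> (real \<Rightarrow> complex) \<Rightarrow> (real \<Rightarrow> complex) \<Rightarrow> bool" where
  "sys n \<nu> U Z \<longleftrightarrow> continuous_on {0..1} U \<and> continuous_on {0..1} Z \<and> Z 0 = 0 \<and> Z 1 = 0 \<and>
     (\<forall>t\<in>{0<..<1}. (U has_vector_derivative (of_int n * U t + 2 * Z t) / of_real (2 * t * (1 - t))) (at t) \<and>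
       (Z has_vector_derivative (- of_int n * Z t / of_real (2 * t * (1 - t)) - \<nu> * U t)) (at t))"

lemma sys_diff:
  assumes "sys n \<nu> U Z" "sys n \<nu> U' Z'"
  shows "sys n \<nu> (\<lambda>t. U t - c * U' t) (\<lambda>t. Z t - c * Z' t)"
  unfolding sys_def
proof (intro conjI ballI)
  fix t :: real assume t: "t \<in> {0<..<1}"
  have D: "(U has_vector_derivative (of_int n * U t + 2 * Z t) / of_real (2 * t * (1 - t))) (at t)"
    "(U' has_vector_derivative (of_int n * U' t + 2 * Z' t) / of_real (2 * t * (1 - t))) (at t)"
    "(Z has_vector_derivative (- of_int n * Z t / of_real (2 * t * (1 - t)) - \<nu> * U t)) (at t)"
    "(Z' has_vector_derivative (- of_int n * Z' t / of_real (2 * t * (1 - t)) - \<nu> * U' t)) (at t)"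
    using assms t by (auto simp: sys_def)
  show "((\<lambda>t. U t - c * U' t) has_vector_derivative (of_int n * (U t - c * U' t) + 2 * (Z t - c * Z' t)) / of_real (2 * t * (1 - t))) (at t)"
    by (rule has_vector_derivative_eq_rhs[OF has_vector_derivative_diff[OF D(1) has_vector_derivative_mult_right[OF D(2)]]])
       (simp add: divide_inverse algebra_simps)
  show "((\<lambda>t. Z t - c * Z' t) has_vector_derivative (- of_int n * (Z t - c * Z' t) / of_real (2 * t * (1 - t)) - \<nu> * (U t - c * U' t))) (at t)"
    by (rule has_vector_derivative_eq_rhs[OF has_vector_derivative_diff[OF D(3) has_vector_derivative_mult_right[OF D(4)]]])
       (simp add: divide_inverse algebra_simps)
qed (use assms in \<open>auto simp: sys_def intro!: continuous_intros\<close>)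

section \<open>Moments of solutions of the radial system\<close>

definition moment :: "int \<Rightarrow> (real \<Rightarrow> complex) \<Rightarrow> nat \<Rightarrow> complex" where
  "moment n U j = integral {0..1} (\<lambda>t. of_real t ^ j * (of_real (sqrt (t * (1 - t)) ^ nat \<bar>n\<bar>) * U t))"

text \<open>Computes the derivative of the function \<open>W\<close> in
  \<open>moment_recurrence\<close>. Since n^2 = N^2, the bracket that multiplies u P contains the
  factor 4(1 - t), which cancels against T and leaves only a division by t.\<close>

lemma moment_algebra:
  fixes N j n t u z \<nu> P T :: complex
  assumes "n\<^sup>2 = N\<^sup>2" "T = t * (1 - t)" "T \<noteq> 0"
  shows "(n * u + 2 * z) / (2 * T) * (P * ((N + 2 * j) - 2 * (N + j) * t - n)) +
    u * (P * ((N + 2 * j) - 2 * (N + j) * t) / (2 * T) * ((N + 2 * j) - 2 * (N + j) * t - n) + P * (- 2 * (N + j)))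
    - 2 * ((- n * z / (2 * T) - \<nu> * u) * P + z * (P * ((N + 2 * j) - 2 * (N + j) * t) / (2 * T)))
   = 2 * u * ((\<nu> - (N + j) * (N + j + 1)) * P + j * (N + j) * (P / t))"
proof -
  have t: "t \<noteq> 0" "1 - t \<noteq> 0" using assms by auto
  have "2 * T * ((n * u + 2 * z) / (2 * T) * (P * ((N + 2 * j) - 2 * (N + j) * t - n)) +
    u * (P * ((N + 2 * j) - 2 * (N + j) * t) / (2 * T) * ((N + 2 * j) - 2 * (N + j) * t - n) + P * (- 2 * (N + j)))
    - 2 * ((- n * z / (2 * T) - \<nu> * u) * P + z * (P * ((N + 2 * j) - 2 * (N + j) * t) / (2 * T))))
    = (n * u + 2 * z) * (P * ((N + 2 * j) - 2 * (N + j) * t - n)) +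
    u * (P * ((N + 2 * j) - 2 * (N + j) * t) * ((N + 2 * j) - 2 * (N + j) * t - n) + P * (- 2 * (N + j)) * (2 * T))
    - 2 * ((- n * z - \<nu> * u * (2 * T)) * P + z * (P * ((N + 2 * j) - 2 * (N + j) * t)))"
    using assms(3) by (simp add: field_simps)
  also have "\<dots> = u * P * (((N + 2 * j) - 2 * (N + j) * t)\<^sup>2 - n\<^sup>2 - 4 * (N + j) * T + 4 * \<nu> * T)"
    by algebra
  also have "\<dots> = 4 * (1 - t) * u * P * (t * (\<nu> - (N + j) * (N + j + 1)) + j * (N + j))"
    unfolding assms(1,2) by algebra
  also have "\<dots> = 2 * T * (2 * u * ((\<nu> - (N + j) * (N + j + 1)) * P + j * (N + j) * (P / t)))"
    unfolding assms(2) using t by (simp add: field_simps)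
  finally show ?thesis
    by (rule mult_left_cancel[THEN iffD1, rotated]) (use assms(3) in simp)
qed

text \<open>\<open>W\<close> is 2t(1 - t) times the Wronskian of U and the test function
  \<open>?P\<close>, with U' eliminated in favour of Z so that it is continuous up to the ends. Its
  derivative contains U only against the weight times t^j and t^(j - 1), and integrating it gives
  the recurrence.\<close>

lemma moment_recurrence:
  assumes S: "sys n \<nu> U Z"
  defines "N \<equiv> of_nat (nat \<bar>n\<bar>) :: complex"
  shows "(\<nu> - (N + of_nat j) * (N + of_nat j + 1)) * moment n U j + of_nat j * (N + of_nat j) * moment n U (j - 1) = 0"
proof -
  let ?k = "nat \<bar>n\<bar>"
  let ?q = "\<lambda>t. of_real (sqrt (t * (1 - t)) ^ ?k) :: complex"
  let ?L = "\<lambda>t. (N + 2 * of_nat j) - 2 * (N + of_nat j) * of_real t"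
  let ?P = "\<lambda>t. ?q t * of_real t ^ j"
  define W where "W t = U t * (?P t * (?L t - of_int n)) - 2 * (Z t * ?P t)" for t
  define W' where "W' t = 2 * U t * ((\<nu> - (N + of_nat j) * (N + of_nat j + 1)) * ?P t + of_nat j * (N + of_nat j) * (?q t * of_real t ^ (j - 1)))" for t
  have cU: "continuous_on {0..1} U" "continuous_on {0..1} Z" and Z: "Z 0 = 0" "Z 1 = 0"
    using S by (auto simp: sys_def)
  have N2: "(of_int n)\<^sup>2 = N\<^sup>2"
  proof -
    have "(of_int n :: complex)\<^sup>2 = (of_int \<bar>n\<bar>)\<^sup>2" by (simp flip: of_int_power)
    then show ?thesis by (simp add: N_def)
  qed
  have "(W' has_integral W 1 - W 0) {0..1}"
  proof (rule fundamental_theorem_of_calculus_interior)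
    show "continuous_on {0..1} W"
      unfolding W_def by (intro continuous_intros cU)
    fix t :: real assume t: "t \<in> {0<..<1}"
    let ?T = "of_real (t * (1 - t)) :: complex"
    have T: "?T \<noteq> 0" "t * (1 - t) > 0" using t by auto
    have dU: "(U has_vector_derivative (of_int n * U t + 2 * Z t) / (2 * ?T)) (at t)"
      and dZ: "(Z has_vector_derivative (- of_int n * Z t / (2 * ?T) - \<nu> * U t)) (at t)"
      using S t by (auto simp: sys_def mult.assoc)
    have dP: "(?P has_vector_derivative ?P t * ?L t / (2 * ?T)) (at t)"
    proof -
      have d1: "((\<lambda>t. sqrt (t * (1 - t))) has_real_derivative sqrt (t * (1 - t)) * ((1 - 2 * t) / (2 * (t * (1 - t))))) (at t)"
      proof -
        have "((\<lambda>t. sqrt (t * (1 - t))) has_real_derivative (inverse (sqrt (t * (1 - t))) / 2) * (1 - 2 * t)) (at t)"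
          by (rule DERIV_chain2[where g = "\<lambda>t. t * (1 - t)" and x = t, OF DERIV_real_sqrt[OF T(2)]]) (auto intro!: derivative_eq_intros)
        moreover have "inverse (sqrt (t * (1 - t))) = sqrt (t * (1 - t)) / (t * (1 - t))"
          using T(2) by (metis inverse_eq_divide less_le real_div_sqrt real_sqrt_gt_0_iff divide_divide_eq_right divide_self_if mult_1 times_divide_eq_left abs_of_pos real_sqrt_abs2 real_sqrt_mult_self mult.commute nonzero_divide_eq_eq)
        ultimately show ?thesis by (simp add: mult.commute)
      qed
      have "((\<lambda>t. sqrt (t * (1 - t)) ^ ?k * t ^ j) has_real_derivative
         (sqrt (t * (1 - t)) ^ ?k * t ^ j) * ((real ?k + 2 * real j) - 2 * (real ?k + real j) * t) / (2 * (t * (1 - t)))) (at t)"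
      proof -
        define r where "r = sqrt (t * (1 - t))"
        define S where "S = r ^ ?k"
        define J where "J = t ^ j"
        have 1: "real ?k * (r * c * r ^ (?k - Suc 0)) = real ?k * S * c" for c
          by (cases ?k) (auto simp: S_def)
        have 2: "real j * t ^ (j - Suc 0) = real j * J / t"
          using t by (cases j) (auto simp: J_def)
        show ?thesis
        proof (rule DERIV_cong[OF DERIV_mult[OF DERIV_power[OF d1, of ?k] DERIV_pow[of j]]])
          show "real ?k * (sqrt (t * (1 - t)) * ((1 - 2 * t) / (2 * (t * (1 - t)))) * sqrt (t * (1 - t)) ^ (?k - Suc 0)) * t ^ j +
             real j * t ^ (j - Suc 0) * sqrt (t * (1 - t)) ^ ?k =
            sqrt (t * (1 - t)) ^ ?k * t ^ j * (real ?k + 2 * real j - 2 * (real ?k + real j) * t) / (2 * (t * (1 - t)))"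
            unfolding r_def[symmetric] 1 2 S_def[symmetric] J_def[symmetric]
            using t by (simp add: field_simps)
        qed
      qed
      from has_vector_derivative_of_real[OF this]
      have "((\<lambda>t. complex_of_real (sqrt (t * (1 - t)) ^ ?k * t ^ j)) has_vector_derivative
        complex_of_real ((sqrt (t * (1 - t)) ^ ?k * t ^ j) * ((real ?k + 2 * real j) - 2 * (real ?k + real j) * t) / (2 * (t * (1 - t))))) (at t)" .
      then show ?thesis by (simp add: N_def del: of_nat_nat)
    qed
    have dL: "((\<lambda>t. ?L t - of_int n) has_vector_derivative - 2 * (N + of_nat j)) (at t)"
      unfolding has_vector_derivative_def
      by (auto intro!: derivative_eq_intros simp: scaleR_conv_of_real fun_eq_iff algebra_simps)
    have "(W has_vector_derivative
      (of_int n * U t + 2 * Z t) / (2 * ?T) * (?P t * (?L t - of_int n)) +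
      U t * (?P t * ?L t / (2 * ?T) * (?L t - of_int n) + ?P t * (- 2 * (N + of_nat j)))
      - 2 * ((- of_int n * Z t / (2 * ?T) - \<nu> * U t) * ?P t + Z t * (?P t * ?L t / (2 * ?T)))) (at t)"
      unfolding W_def
      using has_vector_derivative_diff[OF has_vector_derivative_mult[OF dU has_vector_derivative_mult[OF dP dL]]
         has_vector_derivative_mult_right[OF has_vector_derivative_mult[OF dZ dP], of 2]]
      by (simp only: add.commute)
    also have "(of_int n * U t + 2 * Z t) / (2 * ?T) * (?P t * (?L t - of_int n)) +
      U t * (?P t * ?L t / (2 * ?T) * (?L t - of_int n) + ?P t * (- 2 * (N + of_nat j)))
      - 2 * ((- of_int n * Z t / (2 * ?T) - \<nu> * U t) * ?P t + Z t * (?P t * ?L t / (2 * ?T))) = 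
      2 * U t * ((\<nu> - (N + of_nat j) * (N + of_nat j + 1)) * ?P t + of_nat j * (N + of_nat j) * (?P t / of_real t))"
      by (rule moment_algebra[OF N2 _ T(1)]) simp
    also have "\<dots> = W' t"
      using t by (cases j) (auto simp: W'_def)
    finally show "(W has_vector_derivative W' t) (at t)" .
  qed auto
  \<comment> \<open>Z vanishes at both ends, and \<open>?P\<close> does so unless n = 0. For n = 0
    the linear factor \<open>?L\<close> is 0 at t = 1, and at t = 0 either \<open>?L\<close> or t^j
    is 0.\<close>
  moreover have "W 1 = 0" "W 0 = 0"
    using Z by (auto simp: W_def N_def power_0_left)
  ultimately have 0: "integral {0..1} W' = 0" by (simp add: integral_unique)
  have int: "(\<lambda>t. of_real t ^ i * (?q t * U t)) integrable_on {0..1}" for i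
    by (intro integrable_continuous_real continuous_intros cU)
  have "W' = (\<lambda>t. 2 * (\<nu> - (N + of_nat j) * (N + of_nat j + 1)) * (of_real t ^ j * (?q t * U t)) +
      2 * (of_nat j * (N + of_nat j)) * (of_real t ^ (j - 1) * (?q t * U t)))"
    by (auto simp: W'_def algebra_simps)
  then have "integral {0..1} W' = 2 * (\<nu> - (N + of_nat j) * (N + of_nat j + 1)) * moment n U j +
      2 * (of_nat j * (N + of_nat j)) * moment n U (j - 1)"
    unfolding moment_def using int
    by (simp only: integral_add integrable_on_mult_right integral_mult_right)
  moreover have d: "2 * (a * x + b * y) = 2 * a * x + 2 * b * y" for a b x y :: complex
    by (simp add: distrib_left)
  ultimately have "2 * ((\<nu> - (N + of_nat j) * (N + of_nat j + 1)) * moment n U j + of_nat j * (N + of_nat j) * moment n U (j - 1)) = 0"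
    unfolding d using 0 by (simp only:)
  then show ?thesis by (metis mult_eq_0_iff zero_neq_numeral)
qed

text \<open>Off resonance the recurrence determines moment j from moment j - 1. For j = 0 the
  truncated index is harmless, since that term carries the factor j.\<close>

lemma moment_step:
  assumes S: "sys n \<nu> U Z" and \<nu>: "\<nu> \<noteq> of_nat (nat \<bar>n\<bar> + j) * (of_nat (nat \<bar>n\<bar> + j) + 1)"
    and j: "j = 0 \<or> moment n U (j - 1) = 0"
  shows "moment n U j = 0"
proof -
  have "of_nat j * (of_nat (nat \<bar>n\<bar>) + of_nat j) * moment n U (j - 1) = 0"
    using j by auto
  then have "(\<nu> - of_nat (nat \<bar>n\<bar> + j) * (of_nat (nat \<bar>n\<bar> + j) + 1)) * moment n U j = 0"
    using moment_recurrence[OF S, of j] by (simp only: of_nat_add add_0_right)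
  with \<nu> show ?thesis by (simp only: mult_eq_0_iff right_minus_eq simp_thms)
qed

text \<open>The weight has no zero inside the interval, so U vanishes there once the product of both
  has no moments.\<close>

lemma sys_zero:
  assumes S: "sys n \<nu> U Z" and m: "\<And>j. moment n U j = 0" and t: "t \<in> {0<..<1}"
  shows "U t = 0"
proof -
  have "of_real (sqrt (t * (1 - t)) ^ nat \<bar>n\<bar>) * U t = 0"
    by (rule moments_zero[of "\<lambda>t. of_real (sqrt (t * (1 - t)) ^ nat \<bar>n\<bar>) * U t"])
       (use S m t in \<open>auto simp: sys_def moment_def intro!: continuous_intros\<close>)
  then show ?thesis using t by auto
qed

lemma sys_nonresonant:
  assumes S: "sys n \<nu> U Z" and \<nu>: "\<And>k. k \<ge> nat \<bar>n\<bar> \<Longrightarrow> \<nu> \<noteq> of_nat k * (of_nat k + 1)" and t: "t \<in> {0<..<1}"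
  shows "U t = 0"
proof (rule sys_zero[OF S _ t])
  show "moment n U j = 0" for j
    by (induction j) (rule moment_step[OF S \<nu>]; simp)+
qed

lemma eig_inj:
  assumes "(of_nat k * (of_nat k + 1) :: complex) = of_nat m * (of_nat m + 1)"
  shows "k = m"
proof -
  have "(of_nat (k * (k + 1)) :: complex) = of_nat (m * (m + 1))" using assms by (simp only: of_nat_mult of_nat_add of_nat_1)
  then have eq: "k * (k + 1) = m * (m + 1)" by (simp only: of_nat_eq_iff)
  show ?thesis
  proof (rule linorder_cases[of k m])
    assume "k < m" then have "k * (k + 1) < m * (m + 1)" by (intro mult_strict_mono) auto
    then show ?thesis using eq by simp
  next
    assume "m < k" then have "m * (m + 1) < k * (k + 1)" by (intro mult_strict_mono) auto
    then show ?thesis using eq by simp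
  qed
qed

text \<open>As k(k + 1) is strictly increasing, there is a single resonant index j = m - |n|. A
  solution is determined by that one moment, and subtracting a multiple of U' makes it 0.\<close>

lemma sys_unique:
  assumes S: "sys n (of_nat m * (of_nat m + 1)) U Z" "sys n (of_nat m * (of_nat m + 1)) U' Z'"
    and nm: "nat \<bar>n\<bar> \<le> m" and t0: "t0 \<in> {0<..<1}" "U' t0 \<noteq> 0"
  obtains c where "\<And>t. t \<in> {0<..<1} \<Longrightarrow> U t = c * U' t"
proof -
  have zero: "U t = 0" if S: "sys n (of_nat m * (of_nat m + 1)) U Z" and 0: "moment n U (m - nat \<bar>n\<bar>) = 0" and t: "t \<in> {0<..<1}" for U Z t
  proof (rule sys_zero[OF S _ t])
    show "moment n U j = 0" for j
    proof (cases "nat \<bar>n\<bar> + j = m")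
      case True
      then have "j = m - nat \<bar>n\<bar>" by linarith
      then show ?thesis using 0 by simp
    next
      case False
      have gen: "moment n U j = 0" if "nat \<bar>n\<bar> + j \<noteq> m" "j = 0 \<or> moment n U (j - 1) = 0" for j
        by (rule moment_step[OF S _ that(2)]) (use eig_inj[of m "nat \<bar>n\<bar> + j"] that(1) in blast)
      show ?thesis
      proof (induction j)
        case 0
        then show ?case using gen[of 0] \<open>moment n U (m - nat \<bar>n\<bar>) = 0\<close> by (cases "nat \<bar>n\<bar> = m") auto
      next
        case (Suc j)
        show ?case
        proof (cases "nat \<bar>n\<bar> + Suc j = m")
          case True
          then have "Suc j = m - nat \<bar>n\<bar>" by linarith
          then show ?thesis using 0 by simp
        qed (use Suc gen[of "Suc j"] in auto)
      qed
    qed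
  qed
  define a where "a = moment n U (m - nat \<bar>n\<bar>)"
  define b where "b = moment n U' (m - nat \<bar>n\<bar>)"
  \<comment> \<open>Otherwise U' itself would have no moments and would vanish at t0.\<close>
  have b: "b \<noteq> 0" using zero[OF S(2) _ t0(1)] t0(2) by (auto simp: b_def)
  have int: "(\<lambda>t. of_real t ^ i * (of_real (sqrt (t * (1 - t)) ^ nat \<bar>n\<bar>) * V t)) integrable_on {0..1}"
    if "continuous_on {0..1} V" for V :: "real \<Rightarrow> complex" and i
    by (intro integrable_continuous_real continuous_intros that)
  define c where "c = a / b"
  have "moment n (\<lambda>t. U t - c * U' t) (m - nat \<bar>n\<bar>) = a - c * b"
  proof -
    have "(\<lambda>t. of_real t ^ i * (of_real (sqrt (t * (1 - t)) ^ nat \<bar>n\<bar>) * (U t - c * U' t)))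
      = (\<lambda>t. of_real t ^ i * (of_real (sqrt (t * (1 - t)) ^ nat \<bar>n\<bar>) * U t) -
          c * (of_real t ^ i * (of_real (sqrt (t * (1 - t)) ^ nat \<bar>n\<bar>) * U' t)))" for i
      by (auto simp: algebra_simps)
    then show ?thesis unfolding moment_def a_def b_def
      using int[of U] int[of U'] S by (simp add: sys_def integral_diff integrable_on_mult_right)
  qed
  also have "\<dots> = 0" using b by (simp add: c_def)
  finally have "U t - c * U' t = 0" if "t \<in> {0<..<1}" for t
    using zero[OF sys_diff[OF S] _ that] by simp
  then show ?thesis using that[of c] by simp
qed

section \<open>From a spherical eigenfunction to the radial system\<close>

text \<open>The derivative along a ray is cis t times \<open>d_z\<close> plus cis (-t) times
  \<open>d_zbar\<close>; the two factors move the index of the coefficient to n - 1 and to n +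
  1.\<close>

lemma M_has_vector_derivative:
  assumes k: "C1_on k UNIV"
  shows "((\<lambda>r. M n k (of_real r)) has_vector_derivative
     M (n - 1) (d_z k) (of_real r) + M (n + 1) (d_zbar k) (of_real r)) (at r)"
proof -
  have cz: "continuous_on UNIV (d_z k)" "continuous_on UNIV (d_zbar k)" using k by (auto simp: C1_on_iff)
  have ck: "continuous_on UNIV k" using C1_continuous[OF k] .
  have D: "((\<lambda>r. k (cis t * of_real r)) has_vector_derivative
     d_z k (cis t * of_real r) * cis t + d_zbar k (cis t * of_real r) * cnj (cis t)) (at r within A)" for t r A
  proof -
    have "((\<lambda>r. cis t * of_real r) has_derivative (\<lambda>h. cis t * of_real h)) (at r within A)"
      by (intro has_derivative_mult_right bounded_linear.has_derivative[OF bounded_linear_of_real] has_derivative_ident)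
    from has_derivative_compose[OF this C1_wirt[OF k, of "cis t * of_real r", unfolded wirt_def]]
    show ?thesis by (simp add: has_vector_derivative_def scaleR_conv_of_real algebra_simps)
  qed
  have "((\<lambda>r. integral (cbox 0 (2*pi)) (\<lambda>t. cis (- (of_int n * t)) * k (cis t * of_real r))) has_vector_derivative
    integral (cbox 0 (2*pi)) (\<lambda>t. cis (- (of_int n * t)) * (d_z k (cis t * of_real r) * cis t + d_zbar k (cis t * of_real r) * cnj (cis t)))) (at r within UNIV)"
  proof (rule leibniz_rule_vector_derivative)
    show "((\<lambda>r. cis (- (of_int n * t)) * k (cis t * of_real r)) has_vector_derivative
      cis (- (of_int n * t)) * (d_z k (cis t * of_real r) * cis t + d_zbar k (cis t * of_real r) * cnj (cis t))) (at r within UNIV)" for r t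
      by (rule has_vector_derivative_mult_right[OF D])
    show "(\<lambda>t. cis (- (of_int n * t)) * k (cis t * of_real r)) integrable_on cbox 0 (2*pi)" for r
      by (intro integrable_continuous continuous_intros continuous_on_compose2[OF ck]) auto
    show "continuous_on (UNIV \<times> cbox 0 (2*pi)) (\<lambda>(r, t). cis (- (of_int n * t)) * (d_z k (cis t * of_real r) * cis t + d_zbar k (cis t * of_real r) * cnj (cis t)))"
      unfolding split_beta
      by (intro continuous_intros continuous_on_compose2[OF cz(1)] continuous_on_compose2[OF cz(2)]) auto
  qed auto
  then have 1: "((\<lambda>r. M n k (of_real r)) has_vector_derivative complex_of_real (1 / (2*pi)) *
    integral {0..2*pi} (\<lambda>t. cis (- (of_int n * t)) * (d_z k (cis t * of_real r) * cis t + d_zbar k (cis t * of_real r) * cnj (cis t)))) (at r)"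
    unfolding M_def by (intro has_vector_derivative_mult_right) simp
  have e: "cis (- (of_int n * t)) * (d_z k (cis t * of_real r) * cis t + d_zbar k (cis t * of_real r) * cnj (cis t))
     = cis (- (of_int (n - 1) * t)) * d_z k (cis t * of_real r) + cis (- (of_int (n + 1) * t)) * d_zbar k (cis t * of_real r)" for t
  proof -
    have c: "cis (- (of_int n * t)) * cis t = cis (- (of_int (n - 1) * t))" "cis (- (of_int n * t)) * cnj (cis t) = cis (- (of_int (n + 1) * t))"
      unfolding cis_cnj[symmetric] cis_mult by (auto simp: algebra_simps cis_cnj cis_mult)
    show ?thesis unfolding c[symmetric] by (simp only: distrib_left mult_ac)
  qed
  have "integral {0..2*pi} (\<lambda>t. cis (- (of_int n * t)) * (d_z k (cis t * of_real r) * cis t + d_zbar k (cis t * of_real r) * cnj (cis t)))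
    = integral {0..2*pi} (\<lambda>t. cis (- (of_int (n - 1) * t)) * d_z k (cis t * of_real r)) +
      integral {0..2*pi} (\<lambda>t. cis (- (of_int (n + 1) * t)) * d_zbar k (cis t * of_real r))"
    unfolding e
    by (rule integral_add) (rule M_integrable, rule continuous_on_subset[OF cz(1)] continuous_on_subset[OF cz(2)], simp)+
  note I = this
  show ?thesis using 1 unfolding I by (simp add: M_def add_divide_distrib)
qed

text \<open>The angular derivative of the integrand has integral 0 over a period. In the radial
  derivative this trades the coefficient of \<open>d_z\<close> for that of
  \<open>d_zbar\<close>.\<close>

lemma M_weight_relation:
  assumes k: "C1_on k UNIV"
  shows "of_real r * (M (n - 1) (d_z k) (of_real r) - M (n + 1) (d_zbar k) (of_real r)) = of_int n * M n k (of_real r)"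
proof -
  have cz: "continuous_on UNIV (d_z k)" "continuous_on UNIV (d_zbar k)" using k by (auto simp: C1_on_iff)
  have ck: "continuous_on UNIV k" using C1_continuous[OF k] .
  let ?z = "\<lambda>t. cis t * of_real r"
  let ?I1 = "\<lambda>t. cis (- (of_int (n - 1) * t)) * d_z k (?z t)"
  let ?I2 = "\<lambda>t. cis (- (of_int (n + 1) * t)) * d_zbar k (?z t)"
  let ?I0 = "\<lambda>t. cis (- (of_int n * t)) * k (?z t)"
  have D: "((\<lambda>t. k (?z t)) has_vector_derivative d_z k (?z t) * (\<i> * cis t * of_real r) + d_zbar k (?z t) * (- \<i> * cis (- t) * of_real r)) (at t within A)" for t A
  proof -
    have "((\<lambda>t. cis (1 * t) * of_real r) has_vector_derivative \<i> * of_real 1 * cis (1 * t) * of_real r) (at t within A)"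
      by (rule has_vector_derivative_mult_left[OF has_vector_derivative_cis])
    then have "((\<lambda>t. ?z t) has_derivative (\<lambda>h. h *\<^sub>R (\<i> * cis t * of_real r))) (at t within A)"
      by (simp add: has_vector_derivative_def)
    from has_derivative_compose[OF this C1_wirt[OF k, of "?z t", unfolded wirt_def, simplified]]
    show ?thesis by (simp add: has_vector_derivative_def scaleR_conv_of_real algebra_simps cis_cnj)
  qed
  have "((\<lambda>t. \<i> * of_real r * (?I1 t - ?I2 t) - \<i> * of_int n * ?I0 t) has_integral ?I0 (2*pi) - ?I0 0) {0..2*pi}"
  proof (rule fundamental_theorem_of_calculus)
    fix t :: real
    have c: "((\<lambda>t. cis (- (of_int n * t))) has_vector_derivative \<i> * of_real (- of_int n) * cis (- of_int n * t)) (at t within {0..2*pi})"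
      using has_vector_derivative_cis[of "- of_int n" t "{0..2*pi}"] by simp
    have "cis (- (of_int (n - 1) * t)) = cis (- (of_int n * t)) * cis t" "cis (- (of_int (n + 1) * t)) = cis (- (of_int n * t)) * cis (- t)"
      by (auto simp: cis_mult algebra_simps)
    then show "(?I0 has_vector_derivative \<i> * of_real r * (?I1 t - ?I2 t) - \<i> * of_int n * ?I0 t) (at t within {0..2*pi})"
      using has_vector_derivative_mult[OF c D[of t "{0..2*pi}"]] by (simp add: algebra_simps)
  qed auto
  moreover have "?I0 (2*pi) - ?I0 0 = 0"
  proof -
    have "cis (- (of_int n * (2*pi))) = 1"
      using cis_multiple_2pi[of "- of_int n"] by (simp add: mult_ac)
    then show ?thesis by simp
  qed
  ultimately have 1: "integral {0..2*pi} (\<lambda>t. \<i> * of_real r * (?I1 t - ?I2 t) - \<i> * of_int n * ?I0 t) = 0"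
    by (simp add: integral_unique)
  have i1: "?I1 integrable_on {0..2*pi}" by (rule M_integrable[OF continuous_on_subset[OF cz(1)]]) simp
  have i2: "?I2 integrable_on {0..2*pi}" by (rule M_integrable[OF continuous_on_subset[OF cz(2)]]) simp
  have i0: "?I0 integrable_on {0..2*pi}" by (rule M_integrable[OF continuous_on_subset[OF ck]]) simp
  have "\<i> * of_real r * (integral {0..2*pi} ?I1 - integral {0..2*pi} ?I2) - \<i> * of_int n * integral {0..2*pi} ?I0 = 0"
    unfolding 1[symmetric]
    by (rule integral_unique[symmetric] has_integral_diff has_integral_mult_right integrable_integral i1 i2 i0)+
  then have "\<i> * (of_real r * (integral {0..2*pi} ?I1 - integral {0..2*pi} ?I2)) = \<i> * (of_int n * integral {0..2*pi} ?I0)"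
    by (simp add: algebra_simps)
  then have 2: "of_real r * (integral {0..2*pi} ?I1 - integral {0..2*pi} ?I2) = of_int n * integral {0..2*pi} ?I0"
    by simp
  have "of_real r * (M (n - 1) (d_z k) (of_real r) - M (n + 1) (d_zbar k) (of_real r)) =
    1 / (2*pi) * (of_real r * (integral {0..2*pi} ?I1 - integral {0..2*pi} ?I2))"
    by (simp add: M_def algebra_simps)
  also have "\<dots> = of_int n * M n k (of_real r)"
    unfolding 2 by (simp add: M_def)
  finally show ?thesis .
qed

lemma M_continuous:
  assumes "continuous_on UNIV f"
  shows "continuous_on A (\<lambda>r. M n f (of_real r))"
proof -
  have "continuous_on A (\<lambda>r. integral (cbox 0 (2*pi)) (\<lambda>t. cis (- (of_int n * t)) * f (cis t * of_real r)))"
    by (rule integral_continuous_on_param)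
       (auto simp: split_beta intro!: continuous_intros continuous_on_compose2[OF assms])
  then show ?thesis unfolding M_def by (intro continuous_intros) simp
qed

lemma sqrt_ratio_deriv:
  assumes t: "0 < t" "t < 1"
  defines "\<rho> \<equiv> sqrt (t / (1 - t))"
  shows "\<rho> > 0" "1 + \<rho>\<^sup>2 = 1 / (1 - t)"
    "((\<lambda>t. sqrt (t / (1 - t))) has_real_derivative 1 / (2 * \<rho> * (1 - t)\<^sup>2)) (at t)"
    "\<rho>\<^sup>2 = t / (1 - t)"
proof -
  have p: "t / (1 - t) > 0" using t by simp
  then show "\<rho> > 0" by (simp add: \<rho>_def)
  show 2: "\<rho>\<^sup>2 = t / (1 - t)" using p by (simp add: \<rho>_def)
  show "1 + \<rho>\<^sup>2 = 1 / (1 - t)" unfolding 2 using t by (simp add: field_simps)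
  have d: "((\<lambda>t. t / (1 - t)) has_real_derivative 1 / (1 - t)\<^sup>2) (at t)"
    using t by (auto intro!: derivative_eq_intros simp: power2_eq_square)
  show "((\<lambda>t. sqrt (t / (1 - t))) has_real_derivative 1 / (2 * \<rho> * (1 - t)\<^sup>2)) (at t)"
  proof (rule DERIV_cong)
    show "((\<lambda>t. sqrt (t / (1 - t))) has_real_derivative inverse (sqrt (t / (1 - t))) / 2 * (1 / (1 - t)\<^sup>2)) (at t)"
      by (rule DERIV_chain2[where f = sqrt and g = "\<lambda>t. t / (1 - t)" and x = t, OF DERIV_real_sqrt[OF p] d])
    have "inverse s / 2 * (1 / q) = 1 / (2 * s * q)" for s q :: real
      by (simp add: field_simps)
    then show "inverse (sqrt (t / (1 - t))) / 2 * (1 / (1 - t)\<^sup>2) = 1 / (2 * \<rho> * (1 - t)\<^sup>2)"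
      unfolding \<rho>_def .
  qed
qed

lemma eig_solve:
  fixes Q X L f :: complex
  assumes "Q \<noteq> 0" "- 4 * Q\<^sup>2 * X = L * f"
  shows "X = - (L / 4) / Q\<^sup>2 * f"
proof -
  have "- (L / 4) / Q\<^sup>2 * f = - (L * f) / (4 * Q\<^sup>2)" by simp
  also have "\<dots> = X" unfolding assms(2)[symmetric] using assms(1) by simp
  finally show ?thesis ..
qed

text \<open>The Fourier coefficients u of g and y of its conjugate derivative satisfy first-order
  equations in r. The difficulty is the end t = 1, the point at infinity, where u and r y are
  rewritten in the coordinate 1/cnj s, in which g is again differentiable.\<close>

lemma radial_sys:
  assumes g: "g \<in> S_eig lam"
  shows "\<exists>U Z. sys n (lam / 4) U Z \<and> (\<forall>r>0. M n (\<lambda>s. g (Some s)) (of_real r) = U (r\<^sup>2 / (1 + r\<^sup>2)))"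
proof -
  define f where "f s = g (Some s)" for s
  \<comment> \<open>The conjugate makes the change of coordinate preserve angles, so that the same
    index n serves near infinity.\<close>
  define h where "h s = g (inv_chart (cnj s))" for s
  have C: "C2_on f UNIV" "C2_on (\<lambda>s. g (inv_chart s)) UNIV"
    using g unfolding S_eig_def C2_sphere_def f_def by auto
  have f1: "C1_on f UNIV" "C1_on (d_zbar f) UNIV" using C(1) by (auto simp: C2_iff)
  have h1: "C1_on h UNIV" unfolding h_def
    by (rule C1_comp_cnj[where f = "\<lambda>s. g (inv_chart s)"]) (use C(2) in \<open>auto simp: C2_iff\<close>)
  have lap: "- 4 * (1 + (of_real (cmod z))\<^sup>2)\<^sup>2 * d_z (d_zbar f) z = lam * f z" for z
  proof -
    have "laplace_sphere g (Some z) = lam * g (Some z)" using g unfolding S_eig_def by blast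
    then show ?thesis unfolding laplace_sphere.simps laplace_sphere_formula_def f_def .
  qed
  define u where "u r = M n f (of_real r)" for r :: real
  define y where "y r = M (n + 1) (d_zbar f) (of_real r)" for r :: real
  define v where "v r = M n h (of_real r)" for r :: real
  define v' where "v' r = M (n - 1) (d_z h) (of_real r) + M (n + 1) (d_zbar h) (of_real r)" for r :: real
  have du: "(u has_vector_derivative 2 * y r + of_int n * u r / of_real r) (at r)" if "r > 0" for r
  proof -
    have "of_real r * (M (n - 1) (d_z f) (of_real r) - y r) = of_int n * u r"
      unfolding u_def y_def by (rule M_weight_relation[OF f1(1)])
    then have "M (n - 1) (d_z f) (of_real r) = y r + of_int n * u r / of_real r"
      using that by (simp add: field_simps)
    then show ?thesis
      using M_has_vector_derivative[OF f1(1), of n r] unfolding u_def[abs_def] y_def by (simp add: algebra_simps)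
  qed
  have dy: "(y has_vector_derivative 2 * (- (lam / 4) / (of_real (1 + r\<^sup>2))\<^sup>2 * u r) - of_int (n + 1) * y r / of_real r) (at r)" if "r > 0" for r
  proof -
    have "M n (d_z (d_zbar f)) (of_real r) = M n (\<lambda>z. - (lam / 4) / (of_real (1 + r\<^sup>2))\<^sup>2 * f z) (of_real r)"
    proof (rule M_cong)
      fix t
      have "1 + (complex_of_real (cmod (cis t * of_real r)))\<^sup>2 = of_real (1 + r\<^sup>2)"
        using that by (simp add: norm_mult)
      moreover have "complex_of_real (1 + r\<^sup>2) \<noteq> 0" by (metis of_real_eq_0_iff add_pos_nonneg less_numeral_extra(1) less_irrefl zero_le_power2)
      ultimately show "d_z (d_zbar f) (cis t * of_real r) = - (lam / 4) / (of_real (1 + r\<^sup>2))\<^sup>2 * f (cis t * of_real r)"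
        using lap[of "cis t * of_real r"] by (intro eig_solve) simp_all
    qed
    then have 1: "M n (d_z (d_zbar f)) (of_real r) = - (lam / 4) / (of_real (1 + r\<^sup>2))\<^sup>2 * u r"
      by (simp only: M_cmult u_def)
    have "of_real r * (M n (d_z (d_zbar f)) (of_real r) - M (n + 1 + 1) (d_zbar (d_zbar f)) (of_real r)) = of_int (n + 1) * y r"
      using M_weight_relation[OF f1(2), of r "n + 1"] by (simp add: y_def)
    then have E: "M (n + 1 + 1) (d_zbar (d_zbar f)) (of_real r) = M n (d_z (d_zbar f)) (of_real r) - of_int (n + 1) * y r / of_real r"
      using that by (simp add: field_simps)
    have "(y has_vector_derivative M (n + 1 - 1) (d_z (d_zbar f)) (of_real r) + M (n + 1 + 1) (d_zbar (d_zbar f)) (of_real r)) (at r)"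
      using M_has_vector_derivative[OF f1(2), of "n + 1" r] by (simp only: y_def[abs_def])
    moreover have "a + (a - b) = 2 * a - b" for a b :: complex by simp
    ultimately show ?thesis unfolding E add_diff_cancel_right' 1 by (simp only:)
  qed
  have dv: "(v has_vector_derivative v' r) (at r)" for r
    unfolding v_def v'_def by (rule M_has_vector_derivative[OF h1])
  have base: "continuous_on UNIV f" "continuous_on UNIV (d_zbar f)" "continuous_on UNIV h"
    "continuous_on UNIV (d_z h)" "continuous_on UNIV (d_zbar h)"
    using C1_continuous[OF f1(1)] C1_continuous[OF f1(2)] C1_continuous[OF h1] h1[unfolded C1_on_iff] by blast+
  have cont: "continuous_on A u" "continuous_on A y" "continuous_on A v" "continuous_on A v'" for A
    unfolding u_def[abs_def] y_def[abs_def] v_def[abs_def] v'_def[abs_def]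
    by (intro continuous_on_add M_continuous base)+
  \<comment> \<open>A coefficient of nonzero weight vanishes at the centre; this makes the limit of
    Z at t = 1 equal to 0.\<close>
  have v0: "of_int n * v 0 = 0"
    using M_weight_relation[OF h1, of 0 n] by (simp add: v_def)
  have uv: "u r = v (1 / r)" if "r > 0" for r
    unfolding u_def v_def
  proof (rule M_cong)
    fix t show "f (cis t * of_real r) = h (cis t * of_real (1 / r))"
    proof -
      have "cis t * of_real r \<noteq> 0" using that by simp
      moreover have "1 / (cnj (cis t * of_real (1 / r))) = cis t * of_real r"
        by (simp add: cis_cnj field_simps flip: cis_inverse)
      ultimately show ?thesis using that by (auto simp: f_def h_def)
    qed
  qed
  \<comment> \<open>The derivative of u(r) = v(1/r) is compared with \<open>du\<close>. The
    right-hand side has a limit as r tends to infinity.\<close>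
  have ry: "of_real r * y r = - (of_real (1 / r) * v' (1 / r) + of_int n * v (1 / r)) / 2" if r: "r > 0" for r
  proof -
    have d1: "((\<lambda>r. 1 / r) has_real_derivative - (1 / r\<^sup>2)) (at r)"
      using r by (auto intro!: derivative_eq_intros simp: power2_eq_square)
    have "((\<lambda>r. v (1 / r)) has_vector_derivative - (1 / r\<^sup>2) *\<^sub>R v' (1 / r)) (at r)"
      using vector_diff_chain_at[OF d1[unfolded has_real_derivative_iff_has_vector_derivative] dv[of "1 / r"]] by (simp add: o_def)
    then have "(u has_vector_derivative - (1 / r\<^sup>2) *\<^sub>R v' (1 / r)) (at r)"
      by (rule has_vector_derivative_transform_within_open[of _ _ _ "{0<..}"]) (use r uv in auto)
    then have "- (1 / r\<^sup>2) *\<^sub>R v' (1 / r) = 2 * y r + of_int n * u r / of_real r"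
      using du[OF r] vector_derivative_unique_at by blast
    then have "of_real r * (- (1 / r\<^sup>2) *\<^sub>R v' (1 / r)) = of_real r * (2 * y r + of_int n * u r / of_real r)" by simp
    then show ?thesis using r uv[OF r] by (simp add: scaleR_conv_of_real field_simps power2_eq_square)
  qed
  define \<rho> where "\<rho> t = sqrt (t / (1 - t))" for t
  define \<sigma> where "\<sigma> t = sqrt ((1 - t) / t)" for t
  \<comment> \<open>Division by zero gives \<open>\<rho> 1\<close> = 0, which is the wrong end; so
    the values at infinity are prescribed separately.\<close>
  define U where "U t = (if t = 1 then v 0 else u (\<rho> t))" for t
  define Z where "Z t = (if t = 1 then 0 else of_real (\<rho> t) * y (\<rho> t))" for t
  have \<rho>pos: "\<rho> t > 0" if "0 < t" "t < 1" for t using that by (simp add: \<rho>_def)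
  have \<sigma>\<rho>: "1 / \<rho> t = \<sigma> t" if "0 < t" "t < 1" for t
    by (simp add: \<rho>_def \<sigma>_def real_sqrt_divide)
  have c\<rho>: "continuous_on {0..1/2} \<rho>" unfolding \<rho>_def by (intro continuous_intros) auto
  have c\<sigma>: "continuous_on {1/2..1} \<sigma>" unfolding \<sigma>_def by (intro continuous_intros) auto
  have split: "{0..1::real} = {0..1/2} \<union> {1/2..1}" by auto
  have cU: "continuous_on {0..1} U"
    unfolding split
  proof (rule continuous_on_closed_Un)
    show "continuous_on {0..1/2} U"
      by (rule continuous_on_eq[OF continuous_on_compose2[OF cont(1)[of UNIV] c\<rho>]]) (auto simp: U_def)
    show "continuous_on {1/2..1} U"
    proof (rule continuous_on_eq[OF continuous_on_compose2[OF cont(3)[of UNIV] c\<sigma>]])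
      fix t :: real assume t: "t \<in> {1/2..1}"
      show "v (\<sigma> t) = U t"
      proof (cases "t = 1")
        case False
        then show ?thesis using t uv[OF \<rho>pos[of t]] \<sigma>\<rho>[of t] by (auto simp: U_def)
      qed (simp add: U_def \<sigma>_def)
    qed auto
  qed auto
  have cZ: "continuous_on {0..1} Z"
    unfolding split
  proof (rule continuous_on_closed_Un)
    have "continuous_on {0..1/2} (\<lambda>t. of_real (\<rho> t) * y (\<rho> t))"
      by (intro continuous_intros c\<rho> continuous_on_compose2[OF cont(2)[of UNIV] c\<rho>]) auto
    then show "continuous_on {0..1/2} Z"
      by (rule continuous_on_eq) (auto simp: Z_def)
    have "continuous_on {1/2..1} (\<lambda>t. - (of_real (\<sigma> t) * v' (\<sigma> t) + of_int n * v (\<sigma> t)) / 2)"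
      by (intro continuous_intros c\<sigma> continuous_on_compose2[OF cont(3)[of UNIV] c\<sigma>] continuous_on_compose2[OF cont(4)[of UNIV] c\<sigma>]) auto
    then show "continuous_on {1/2..1} Z"
    proof (rule continuous_on_eq)
      fix t :: real assume t: "t \<in> {1/2..1}"
      show "- (of_real (\<sigma> t) * v' (\<sigma> t) + of_int n * v (\<sigma> t)) / 2 = Z t"
      proof (cases "t = 1")
        case False
        then show ?thesis using t ry[OF \<rho>pos[of t]] \<sigma>\<rho>[of t] by (auto simp: Z_def)
      qed (use v0 in \<open>simp add: Z_def \<sigma>_def\<close>)
    qed
  qed auto
  have "sys n (lam / 4) U Z"
    unfolding sys_def
  proof (intro conjI ballI cU cZ)
    show "Z 0 = 0" "Z 1 = 0" by (auto simp: Z_def \<rho>_def)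
    fix t :: real assume t: "t \<in> {0<..<1}"
    then have t': "0 < t" "t < 1" by auto
    define r where "r = \<rho> t"
    have r: "r > 0" "1 + r\<^sup>2 = 1 / (1 - t)" "r\<^sup>2 = t / (1 - t)"
      and d: "(\<rho> has_vector_derivative 1 / (2 * r * (1 - t)\<^sup>2)) (at t)"
      using sqrt_ratio_deriv[OF t'] by (auto simp: r_def \<rho>_def[abs_def] has_real_derivative_iff_has_vector_derivative)
    have rr: "1 / (2 * r * (1 - t)\<^sup>2) = r / (2 * t * (1 - t))"
    proof -
      have "r / (2 * t * (1 - t)) = r\<^sup>2 / (2 * t * (1 - t) * r)" using r(1) by (simp add: power2_eq_square)
      also have "\<dots> = (t / (1 - t)) / (2 * t * (1 - t) * r)" by (simp only: r(3))
      also have "\<dots> = 1 / (2 * r * (1 - t)\<^sup>2)" using t' r(1) by (simp add: power2_eq_square)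
      finally show ?thesis ..
    qed
    let ?R = "complex_of_real r" and ?T = "complex_of_real (2 * t * (1 - t))"
    have T: "?T \<noteq> 0" "?R \<noteq> 0" using t' r by auto
    have dU: "((\<lambda>t. u (\<rho> t)) has_vector_derivative (of_int n * u r + 2 * (?R * y r)) / ?T) (at t)"
    proof -
      have "((u \<circ> \<rho>) has_vector_derivative (1 / (2 * r * (1 - t)\<^sup>2)) *\<^sub>R (2 * y r + of_int n * u r / ?R)) (at t)"
        by (rule vector_diff_chain_at[OF d]) (use du[OF r(1)] r_def in simp)
      moreover have "(1 / (2 * r * (1 - t)\<^sup>2)) *\<^sub>R (2 * y r + of_int n * u r / ?R) = (of_int n * u r + 2 * (?R * y r)) / ?T"
        unfolding rr scaleR_conv_of_real of_real_divide using T by (simp add: field_simps)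
      ultimately show ?thesis by (simp add: o_def)
    qed
    have "((y \<circ> \<rho>) has_vector_derivative (1 / (2 * r * (1 - t)\<^sup>2)) *\<^sub>R
      (2 * (- (lam / 4) / (of_real (1 + r\<^sup>2))\<^sup>2 * u r) - of_int (n + 1) * y r / ?R)) (at t)"
      by (rule vector_diff_chain_at[OF d]) (use dy[OF r(1)] r_def in simp)
    from has_vector_derivative_mult[OF has_vector_derivative_of_real[OF d[folded has_real_derivative_iff_has_vector_derivative]] this]
    have dZ: "((\<lambda>t. of_real (\<rho> t) * y (\<rho> t)) has_vector_derivative
      ?R * ((1 / (2 * r * (1 - t)\<^sup>2)) *\<^sub>R (2 * (- (lam / 4) / (of_real (1 + r\<^sup>2))\<^sup>2 * u r) - of_int (n + 1) * y r / ?R)) +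
      of_real (1 / (2 * r * (1 - t)\<^sup>2)) * y r) (at t)"
      by (simp add: o_def r_def)
    have eq: "?R * ((1 / (2 * r * (1 - t)\<^sup>2)) *\<^sub>R (2 * (- (lam / 4) / (of_real (1 + r\<^sup>2))\<^sup>2 * u r) - of_int (n + 1) * y r / ?R)) +
      of_real (1 / (2 * r * (1 - t)\<^sup>2)) * y r = - of_int n * (?R * y r) / ?T - lam / 4 * u r"
    proof -
      have a: "?R * of_real (1 / (2 * r * (1 - t)\<^sup>2)) * (2 / (of_real (1 + r\<^sup>2))\<^sup>2) = 1"
      proof -
        have "r * (1 / (2 * r * (1 - t)\<^sup>2)) * (2 / (1 + r\<^sup>2)\<^sup>2) = 1"
          unfolding r(2) using r(1) t' by (simp add: power2_eq_square)
        from arg_cong[OF this, of complex_of_real] show ?thesis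
          by (simp only: of_real_mult of_real_divide of_real_power of_real_1 of_real_numeral)
      qed
      have gen: "R * (c * (2 * (L / Q * u) - k * y / R)) + c * y = (R * c * (2 / Q)) * (L * u) - c * (k * y) + c * y"
        if "R \<noteq> 0" for R c L Q u k y :: complex
        using that by (simp add: algebra_simps)
      have b: "of_real (1 / (2 * r * (1 - t)\<^sup>2)) = ?R / ?T" unfolding rr by simp
      have "?R * ((1 / (2 * r * (1 - t)\<^sup>2)) *\<^sub>R (2 * (- (lam / 4) / (of_real (1 + r\<^sup>2))\<^sup>2 * u r) - of_int (n + 1) * y r / ?R)) +
        of_real (1 / (2 * r * (1 - t)\<^sup>2)) * y r = (?R * of_real (1 / (2 * r * (1 - t)\<^sup>2)) * (2 / (of_real (1 + r\<^sup>2))\<^sup>2)) * (- (lam / 4) * u r)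
         - of_real (1 / (2 * r * (1 - t)\<^sup>2)) * (of_int (n + 1) * y r) + of_real (1 / (2 * r * (1 - t)\<^sup>2)) * y r"
        unfolding scaleR_conv_of_real by (rule gen[OF T(2)])
      also have "\<dots> = - of_int n * (?R * y r) / ?T - lam / 4 * u r"
        unfolding a unfolding b by (simp add: algebra_simps add_divide_distrib diff_divide_distrib)
      finally show ?thesis .
    qed
    have ev: "U s = u (\<rho> s)" "Z s = of_real (\<rho> s) * y (\<rho> s)" if "s \<in> {0<..<1}" for s
      using that by (auto simp: U_def Z_def)
    show "(U has_vector_derivative (of_int n * U t + 2 * Z t) / complex_of_real (2 * t * (1 - t))) (at t)"
      unfolding ev[OF t] r_def[symmetric]
      by (rule has_vector_derivative_transform_within_open[OF dU, of "{0<..<1}"]) (use t ev in auto)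
    show "(Z has_vector_derivative - of_int n * Z t / complex_of_real (2 * t * (1 - t)) - lam / 4 * U t) (at t)"
      unfolding ev[OF t] r_def[symmetric]
      by (rule has_vector_derivative_transform_within_open[OF dZ[unfolded eq], of "{0<..<1}"]) (use t ev in auto)
  qed
  moreover have "M n (\<lambda>s. g (Some s)) (of_real r) = U (r\<^sup>2 / (1 + r\<^sup>2))" if r: "r > 0" for r
  proof -
    have p: "1 + r\<^sup>2 > 0" by (simp add: add_pos_nonneg)
    have "\<rho> (r\<^sup>2 / (1 + r\<^sup>2)) = sqrt (r\<^sup>2)"
      unfolding \<rho>_def by (rule arg_cong[of _ _ sqrt]) (use p in \<open>simp add: field_simps\<close>)
    moreover have "r\<^sup>2 / (1 + r\<^sup>2) \<noteq> 1" using p by (simp add: field_simps)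
    ultimately show ?thesis using r by (simp add: U_def u_def f_def[abs_def])
  qed
  ultimately show ?thesis by blast
qed


section \<open>Eigenvalues and eigenspaces on the sphere\<close>

lemma C2_sphere_continuous:
  assumes "C2_sphere g"
  shows "continuous_on UNIV (\<lambda>s. g (Some s))" "isCont (\<lambda>s. g (Some s)) 0" "isCont (\<lambda>s. g (inv_chart s)) 0"
proof -
  have "C1_on (\<lambda>s. g (Some s)) UNIV" "C1_on (\<lambda>s. g (inv_chart s)) UNIV"
    using assms by (simp_all add: C2_sphere_def C2_iff del: sphere_inverse.simps)
  from this[THEN C1_continuous]
  show "continuous_on UNIV (\<lambda>s. g (Some s))" "isCont (\<lambda>s. g (Some s)) 0" "isCont (\<lambda>s. g (inv_chart s)) 0"
    by (auto simp: continuous_on_eq_continuous_at simp del: sphere_inverse.simps)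
qed

lemma C2_sphere_zero: "C2_sphere (\<lambda>_. 0)"
proof -
  have "d_z (\<lambda>s. 0) = (\<lambda>z. 0)" "d_zbar (\<lambda>s. 0) = (\<lambda>z. 0)"
    using wirtD(4,5)[OF wirt_const] by auto
  then show ?thesis by (auto simp: C2_sphere_def C2_iff C1_const)
qed

text \<open>The radial system is solved for 0 < t < 1 only, that is, away from 0 and infinity;
  continuity in the two coordinates supplies these points.\<close>

lemma C2_sphere_eqI:
  assumes "C2_sphere g" "C2_sphere h" and eq: "\<And>z. z \<noteq> 0 \<Longrightarrow> g (Some z) = h (Some z)"
  shows "g = h"
proof -
  have "(\<lambda>s. g (Some s) - h (Some s)) 0 = 0"
    by (rule isCont_punctured_zero[where g = "\<lambda>s. g (Some s) - h (Some s)"])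
       (use assms C2_sphere_continuous(2) in \<open>auto intro!: continuous_intros simp: eventually_at_filter\<close>)
  moreover have "(\<lambda>s. g (inv_chart s) - h (inv_chart s)) 0 = 0"
  proof (rule isCont_punctured_zero[where g = "\<lambda>s. g (inv_chart s) - h (inv_chart s)"])
    show "isCont (\<lambda>s. g (inv_chart s) - h (inv_chart s)) 0"
      by (intro continuous_intros C2_sphere_continuous(3) assms)
    show "\<forall>\<^sub>F s in at 0. g (inv_chart s) - h (inv_chart s) = 0"
      using eq by (auto simp: eventually_at_filter)
  qed
  ultimately have "g p = h p" for p
    using eq by (cases p) (metis diff_eq_diff_eq eq_iff_diff_eq_0 sphere_inverse.simps(2), metis eq_iff_diff_eq_0)
  then show ?thesis by blast
qed

lemma M_sphere_rotate:
  assumes "C2_sphere g"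
  shows "M n (\<lambda>s. g (Some s)) z = cis (of_int n * Arg2pi z) * M n (\<lambda>s. g (Some s)) (of_real (cmod z))"
proof -
  have "M n (\<lambda>s. g (Some s)) (cis (Arg2pi z) * of_real (cmod z)) = cis (of_int n * Arg2pi z) * M n (\<lambda>s. g (Some s)) (of_real (cmod z))"
    by (rule M_rotate[OF continuous_on_subset[OF C2_sphere_continuous(1)[OF assms]]]) simp
  moreover have "cis (Arg2pi z) * of_real (cmod z) = z"
    using Arg2pi_eq[of z] by (simp add: cis_conv_exp mult.commute)
  ultimately show ?thesis by simp
qed

lemma ratio_unit: "r > 0 \<Longrightarrow> r\<^sup>2 / (1 + r\<^sup>2) \<in> {0<..<1::real}"
  by (auto simp: add_pos_pos divide_less_eq)

text \<open>Without resonance every Fourier coefficient vanishes on every circle about 0, and g with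
  them.\<close>

lemma S_eig_eigenvalue:
  assumes g: "g \<in> S_eig lam" and ne: "g \<noteq> (\<lambda>_. 0)"
  shows "\<exists>m. lam = eigval m"
proof (rule ccontr)
  assume no: "\<nexists>m. lam = eigval m"
  have C: "C2_sphere g" using g unfolding S_eig_def by blast
  have nr: "lam / 4 \<noteq> of_nat k * (of_nat k + 1)" for k
  proof
    assume "lam / 4 = of_nat k * (of_nat k + 1)"
    then have "lam = eigval k" by (simp add: field_simps)
    then show False using no by blast
  qed
  have 0: "M n (\<lambda>s. g (Some s)) (of_real r) = 0" if r: "r > 0" for n r
  proof -
    obtain U Z where U: "sys n (lam / 4) U Z" "\<forall>r>0. M n (\<lambda>s. g (Some s)) (of_real r) = U (r\<^sup>2 / (1 + r\<^sup>2))"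
      using radial_sys[OF g] by blast
    have "U (r\<^sup>2 / (1 + r\<^sup>2)) = 0"
      by (rule sys_nonresonant[OF U(1) nr ratio_unit[OF r]])
    then show ?thesis using U(2) r by simp
  qed
  have "g (Some z) = 0" if "z \<noteq> 0" for z
  proof (rule fourier_zero_at[where f = "\<lambda>s. g (Some s)"])
    show "M n (\<lambda>s. g (Some s)) z = 0" for n
      using M_sphere_rotate[OF C, of n z] 0[of "cmod z" n] that by simp
  qed (rule continuous_on_subset[OF C2_sphere_continuous(1)[OF C]], simp)
  then have "g = (\<lambda>_. 0)"
    by (intro C2_sphere_eqI[OF C]) (auto simp: C2_sphere_zero)
  then show False using ne by simp
qed

text \<open>A rotation of the sphere acts on the antidiagonal as (z, w) -> (cis t z, cis (-t) w),
  which is the scaling of \<open>e0_rotate\<close> with \<zeta> = cis (-t).\<close>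

lemma e_Omega_anti_rotate:
  assumes j: "j \<le> 2 * m"
  shows "anti (e_Omega m j) (Some (cis t * z)) = cis (of_int (int m - int j) * t) * anti (e_Omega m j) (Some z)"
proof -
  have UO: "(z, (- 1) * cnj z) \<in> UO" for z using antidiag_UO by blast
  have ev: "anti (e_Omega m j) (Some z) = e0 m j (z, (- 1) * cnj z)" for z
    unfolding anti_charts e_Omega_def o_def by (rule lift_std[OF UO])
  have "cis (- t) ^ m * e0 m j (z / cis (- t), (- cnj z) * cis (- t)) = cis (- t) ^ j * e0 m j (z, - cnj z)"
    by (rule e0_rotate[OF j]) simp
  moreover have "cis (- t) ^ k = cis (- (real k * t))" for k using Complex.DeMoivre[of "- t" k] by simp
  moreover have "z / cis (- t) = cis t * z" by (simp add: divide_inverse cis_inverse mult.commute)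
  ultimately have "cis (real m * t) * (cis (- (real m * t)) * e0 m j (cis t * z, - (cis (- t) * cnj z))) = cis (real m * t) * (cis (- (real j * t)) * e0 m j (z, - cnj z))"
    by (simp add: mult.commute)
  then have "e0 m j (cis t * z, - (cis (- t) * cnj z)) = cis (of_int (int m - int j) * t) * e0 m j (z, - cnj z)"
    unfolding mult.assoc[symmetric] cis_mult by (simp add: algebra_simps)
  then show ?thesis by (simp add: ev cis_cnj)
qed

lemma e_Omega_nonzero:
  assumes j: "j \<le> 2 * m"
  shows "e_Omega m j \<noteq> (\<lambda>_. 0)"
proof
  assume 0: "e_Omega m j = (\<lambda>_. 0)"
  have "(\<Sum>i\<le>2 * m. fscale (if i = j then 1 else 0) (e_Omega m i)) = (\<Sum>i\<le>2 * m. if i = j then e_Omega m i else 0)"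
    by (intro sum.cong) (auto simp: fscale_def fun_eq_iff)
  also have "\<dots> = 0" using j 0 by (simp add: zero_fun_def)
  finally have "(if j = j then 1 else 0 :: complex) = 0"
    using j by (intro e_Omega_independent_aux[where c = "\<lambda>i. if i = j then 1 else 0" and m = m])
  then show False by simp
qed

text \<open>Each weight n with |n| \<le> m admits one radial profile up to a factor, and
  \<open>e_Omega m j\<close> with j = m - n realises it. The other coefficients vanish, so a finite
  Fourier expansion reassembles g.\<close>

lemma S_eig_subset:
  assumes g: "g \<in> S_eig (eigval m)"
  shows "\<exists>F\<in>cfun.span (e_Omega m ` {..2 * m}). g = anti F"
proof -
  have C: "C2_sphere g" using g unfolding S_eig_def by blast
  have ev4: "eigval m / 4 = of_nat m * (of_nat m + 1)" by simp
  have cg: "continuous_on A (\<lambda>s. g (Some s))" for A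
    using C2_sphere_continuous(1)[OF C] continuous_on_subset by blast
  define e where "e j = anti (e_Omega m j)" for j
  have eS: "e j \<in> S_eig (eigval m)" if "j \<le> 2 * m" for j
    unfolding e_def by (rule anti_S_eig[OF e_Omega_X_eig[OF that]])
  have eC: "C2_sphere (e j)" if "j \<le> 2 * m" for j using eS[OF that] unfolding S_eig_def by blast
  have Me: "M n (\<lambda>s. e j (Some s)) z = (if n = int m - int j then e j (Some z) else 0)" if "j \<le> 2 * m" for j n z
    by (rule M_weight) (simp only: e_def e_Omega_anti_rotate[OF that])
  have "\<exists>c. \<forall>z. z \<noteq> 0 \<longrightarrow> M (int m - int j) (\<lambda>s. g (Some s)) z = c * e j (Some z)" if j: "j \<le> 2 * m" for j
  proof -
    define n where "n = int m - int j"
    have n: "nat \<bar>n\<bar> \<le> m" using j by (auto simp: n_def)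
    obtain U Z where U: "sys n (of_nat m * (of_nat m + 1)) U Z" "\<forall>r>0. M n (\<lambda>s. g (Some s)) (of_real r) = U (r\<^sup>2 / (1 + r\<^sup>2))"
      using radial_sys[OF g, of n] unfolding ev4 by blast
    obtain U' Z' where U': "sys n (of_nat m * (of_nat m + 1)) U' Z'" "\<forall>r>0. M n (\<lambda>s. e j (Some s)) (of_real r) = U' (r\<^sup>2 / (1 + r\<^sup>2))"
      using radial_sys[OF eS[OF j], of n] unfolding ev4 by blast
    \<comment> \<open>\<open>sys_unique\<close> needs a comparison solution that is nonzero
      somewhere. If e j vanished on the positive axis, it would vanish everywhere by rotation, and
      then so would \<open>e_Omega m j\<close>.\<close>
    have "\<exists>r>0. e j (Some (of_real r)) \<noteq> 0"
    proof (rule ccontr)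
      assume "\<not> ?thesis"
      then have 0: "e j (Some (of_real r)) = 0" if "r > 0" for r using that by blast
      have "e j (Some z) = 0" if "z \<noteq> 0" for z
        using M_sphere_rotate[OF eC[OF j], of n z] 0[of "cmod z"] that by (simp add: Me[OF j] n_def)
      then have "e j = (\<lambda>_. 0)"
        by (intro C2_sphere_eqI[OF eC[OF j]]) (auto simp: C2_sphere_zero)
      then have "e_Omega m j = (\<lambda>_. 0)"
        using anti_zero[OF X_eig_OmegaD(1)[OF e_Omega_X_eig[OF j]]] by (simp add: e_def)
      then show False using e_Omega_nonzero[OF j] by simp
    qed
    then obtain r0 where r0: "r0 > 0" "e j (Some (of_real r0)) \<noteq> 0" by blast
    then have "U' (r0\<^sup>2 / (1 + r0\<^sup>2)) \<noteq> 0"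
      using U'(2) Me[OF j] by (simp add: n_def[symmetric])
    then obtain c where c: "\<And>t. t \<in> {0<..<1} \<Longrightarrow> U t = c * U' t"
      using sys_unique[OF U(1) U'(1) n ratio_unit[OF r0(1)]] by blast
    have "M n (\<lambda>s. g (Some s)) z = c * e j (Some z)" if "z \<noteq> 0" for z
    proof -
      have r: "cmod z > 0" using that by simp
      have "M n (\<lambda>s. g (Some s)) (of_real (cmod z)) = c * M n (\<lambda>s. e j (Some s)) (of_real (cmod z))"
        using U(2) U'(2) c[OF ratio_unit[OF r]] r by simp
      then have "M n (\<lambda>s. g (Some s)) z = c * M n (\<lambda>s. e j (Some s)) z"
        by (simp add: M_sphere_rotate[OF C, of n z] M_sphere_rotate[OF eC[OF j], of n z])
      then show ?thesis using Me[OF j] by (simp add: n_def)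
    qed
    then show ?thesis unfolding n_def by blast
  qed
  then obtain c where c: "\<And>j z. j \<le> 2 * m \<Longrightarrow> z \<noteq> 0 \<Longrightarrow> M (int m - int j) (\<lambda>s. g (Some s)) z = c j * e j (Some z)"
    by metis
  have out: "M n (\<lambda>s. g (Some s)) z = 0" if n: "nat \<bar>n\<bar> > m" and z: "z \<noteq> 0" for n z
  proof -
    obtain U Z where U: "sys n (of_nat m * (of_nat m + 1)) U Z" "\<forall>r>0. M n (\<lambda>s. g (Some s)) (of_real r) = U (r\<^sup>2 / (1 + r\<^sup>2))"
      using radial_sys[OF g, of n] unfolding ev4 by blast
    have r: "cmod z > 0" using z by simp
    have "U ((cmod z)\<^sup>2 / (1 + (cmod z)\<^sup>2)) = 0"
      by (rule sys_nonresonant[OF U(1) _ ratio_unit[OF r]]) (use eig_inj[of m] n in fastforce)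
    then show ?thesis using U(2) r by (simp add: M_sphere_rotate[OF C, of n z])
  qed
  define F where "F = (\<Sum>j\<le>2 * m. fscale (c j) (e_Omega m j))"
  have Fspan: "F \<in> cfun.span (e_Omega m ` {..2 * m})"
    unfolding F_def by (intro cfun.span_sum cfun.span_scale cfun.span_base) auto
  have FX: "F \<in> X_eig (eigval m) Omega"
    unfolding F_def by (intro cfun.subspace_sum[OF subspace_X_eig_Omega] cfun.subspace_scale[OF subspace_X_eig_Omega] e_Omega_X_eig) auto
  have "g = anti F"
  proof (rule C2_sphere_eqI[OF C])
    show "C2_sphere (anti F)" using anti_S_eig[OF FX] unfolding S_eig_def by blast
    fix z :: complex assume z: "z \<noteq> 0"
    have "g (Some z) = (\<Sum>n\<in>(\<lambda>j. int m - int j) ` {..2 * m}. M n (\<lambda>s. g (Some s)) z)"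
    proof (rule fourier_finite[OF cg])
      fix n assume "n \<notin> (\<lambda>j. int m - int j) ` {..2 * m}"
      then have "nat \<bar>n\<bar> > m"
      proof (rule contrapos_np)
        assume "\<not> nat \<bar>n\<bar> > m"
        then have "n = int m - int (nat (int m - n))" "nat (int m - n) \<le> 2 * m" by auto
        then show "n \<in> (\<lambda>j. int m - int j) ` {..2 * m}" by blast
      qed
      then show "M n (\<lambda>s. g (Some s)) z = 0" by (rule out[OF _ z])
    qed auto
    also have "\<dots> = (\<Sum>j\<le>2 * m. c j * e j (Some z))"
      by (subst sum.reindex) (auto simp: inj_on_def c z)
    also have "\<dots> = anti F (Some z)"
    proof -
      have "(\<Sum>j\<in>A. fscale (c j) (e_Omega m j)) p = (\<Sum>j\<in>A. c j * e_Omega m j p)" for A p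
        by (induction A rule: infinite_finite_induct) (auto simp: fscale_def)
      then show ?thesis by (simp add: F_def anti_def e_def)
    qed
    finally show "g (Some z) = anti F (Some z)" .
  qed
  with Fspan show ?thesis by blast
qed

text \<open>F agrees on the antidiagonal with some G in the span, and \<open>anti_zero\<close>
  applied to F - G makes them equal.\<close>

lemma X_eig_Omega_eq_span: "X_eig (eigval m) Omega = cfun.span (e_Omega m ` {..2 * m})"
proof
  show sub: "cfun.span (e_Omega m ` {..2 * m}) \<subseteq> X_eig (eigval m) Omega"
    by (rule cfun.span_minimal[OF _ subspace_X_eig_Omega]) (auto intro: e_Omega_X_eig)
  show "X_eig (eigval m) Omega \<subseteq> cfun.span (e_Omega m ` {..2 * m})"
  proof
    fix F assume F: "F \<in> X_eig (eigval m) Omega"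
    obtain G where G: "G \<in> cfun.span (e_Omega m ` {..2 * m})" "anti F = anti G"
      using S_eig_subset[OF anti_S_eig[OF F]] by blast
    have "F - G \<in> X_eig (eigval m) Omega"
      using F G(1) sub by (intro cfun.subspace_diff[OF subspace_X_eig_Omega]) auto
    moreover have "anti (F - G) = (\<lambda>_. 0)"
      using G(2) by (auto simp: anti_def fun_eq_iff)
    ultimately have "F - G = (\<lambda>_. 0)" using anti_zero X_eig_OmegaD(1) by blast
    then have "F = G" by (auto simp: fun_eq_iff)
    then show "F \<in> cfun.span (e_Omega m ` {..2 * m})" using G(1) by simp
  qed
qed

lemma S_eig_eq: "S_eig (eigval m) = anti ` X_eig (eigval m) Omega"
  using S_eig_subset anti_S_eig unfolding X_eig_Omega_eq_span[symmetric] by blast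

lemma dim_X_eig_Omega: "cfun.dim (X_eig (eigval m) Omega) = 2 * m + 1"
  by (simp only: X_eig_Omega_eq_span dim_span_e_Omega)

section \<open>Uniqueness of the finite-dimensional invariant subspace\<close>

lemma difference_quotient_tendsto:
  fixes \<phi> :: "real \<Rightarrow> complex"
  assumes "(\<phi> has_vector_derivative v) (at 0)"
  shows "((\<lambda>h. (1 / of_real h) * (\<phi> h - \<phi> 0)) \<longlongrightarrow> v) (at 0)"
proof -
  have "((\<lambda>h. norm (\<phi> (0 + h) - \<phi> 0 - h *\<^sub>R v) / norm h) \<longlongrightarrow> 0) (at 0)"
    using assms unfolding has_vector_derivative_def has_derivative_at by blast
  then have "((\<lambda>h. norm ((1 / of_real h) * (\<phi> h - \<phi> 0) - v)) \<longlongrightarrow> 0) (at 0)"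
  proof (rule Lim_transform_eventually)
    show "\<forall>\<^sub>F h in at 0. norm (\<phi> (0 + h) - \<phi> 0 - h *\<^sub>R v) / norm h = norm ((1 / of_real h) * (\<phi> h - \<phi> 0) - v)"
    proof (rule eventually_at_filter[THEN iffD2], intro always_eventually allI impI)
      fix h :: real assume h: "h \<noteq> 0"
      have "(1 / of_real h) * (\<phi> h - \<phi> 0) - v = (\<phi> (0 + h) - \<phi> 0 - h *\<^sub>R v) / of_real h"
        using h by (simp add: scaleR_conv_of_real field_simps)
      then show "norm (\<phi> (0 + h) - \<phi> 0 - h *\<^sub>R v) / norm h = norm ((1 / of_real h) * (\<phi> h - \<phi> 0) - v)"
        by (simp add: norm_divide)
    qed
  qed
  from tendsto_norm_zero_cancel[OF this] show ?thesis by (rule LIM_zero_cancel)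
qed

lemma wirt_chain_curve:
  assumes f: "wirt f a b (\<gamma> 0)" and \<gamma>: "(\<gamma> has_vector_derivative v) (at 0)"
  shows "((\<lambda>t. f (\<gamma> t)) has_vector_derivative a * v + b * cnj v) (at 0)"
proof -
  have "((\<lambda>t. f (\<gamma> t)) has_derivative (\<lambda>h. a * (h *\<^sub>R v) + b * cnj (h *\<^sub>R v))) (at 0)"
    using has_derivative_compose[OF \<gamma>[unfolded has_vector_derivative_def] f[unfolded wirt_def]] .
  then show ?thesis by (simp add: has_vector_derivative_def scaleR_conv_of_real algebra_simps)
qed

lemma Moebius_automorphism:
  assumes "cmod w < 1"
  shows "disk_automorphism (Moebius_function 0 w)"
  unfolding disk_automorphism_def
proof
  show "Moebius_function 0 w holomorphic_on ball 0 1" by (rule Moebius_function_holomorphic[OF assms])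
  show "bij_betw (Moebius_function 0 w) (ball 0 1) (ball 0 1)"
    by (rule bij_betw_byWitness[where f' = "Moebius_function 0 (- w)"])
       (use assms Moebius_function_compose Moebius_function_norm_lt_1 in \<open>auto simp: dist_norm\<close>)
qed

lemma rotation_automorphism: "disk_automorphism (\<lambda>z. cis a * z)"
  unfolding disk_automorphism_def
proof
  show "bij_betw (\<lambda>z. cis a * z) (ball 0 1) (ball 0 1)"
    by (rule bij_betw_byWitness[where f' = "\<lambda>z. cis (- a) * z"])
       (auto simp: norm_mult mult.assoc[symmetric] cis_mult)
qed (intro holomorphic_intros)

section \<open>Infinitesimal Moebius transformations and rotation weights\<close>

text \<open>Let D_c f be the derivative at s = 0 of f ((z + s c) / (1 + s cnj c z)). Then
  \<open>lie_A\<close> is (D_1 - i D_i) / 2 and \<open>lie_B\<close> is (D_1 + i D_i) / 2 on the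
  disk.\<close>

definition lie_A :: "(complex \<Rightarrow> complex) \<Rightarrow> complex \<Rightarrow> complex" where
  "lie_A f = restrict0 (ball 0 1) (\<lambda>z. d_z f z - (cnj z)\<^sup>2 * d_zbar f z)"

definition lie_B :: "(complex \<Rightarrow> complex) \<Rightarrow> complex \<Rightarrow> complex" where
  "lie_B f = restrict0 (ball 0 1) (\<lambda>z. d_zbar f z - z\<^sup>2 * d_z f z)"

definition top_vector :: "nat \<Rightarrow> complex \<Rightarrow> complex" where
  "top_vector m = restrict0 (ball 0 1) (\<lambda>z. (z / (1 - z * cnj z)) ^ m)"

lemma cnj_ball_nz: "cmod z < 1 \<Longrightarrow> 1 - z * cnj z \<noteq> 0"
  using bidisk_zw[of z "cnj z"] by simp

lemma rot_wirt:
  assumes "wirt f a b (c * z)"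
  shows "wirt (\<lambda>z. f (c * z)) (a * c) (b * cnj c) z"
proof -
  have "((\<lambda>z. c * z) has_derivative (\<lambda>h. c * h)) (at z)"
    by (rule has_derivative_mult_right[OF has_derivative_ident])
  from has_derivative_compose[OF this assms[unfolded wirt_def]]
  show ?thesis by (simp add: wirt_def algebra_simps)
qed

definition rot_weight :: "int \<Rightarrow> (complex \<Rightarrow> complex) \<Rightarrow> bool" where
  "rot_weight n f \<longleftrightarrow> (\<forall>a z. cmod z < 1 \<longrightarrow> f (cis a * z) = cis (of_int n * a) * f z)"

text \<open>The rotation condition differentiated at angle 0. It allows one of z
  \<open>d_z f\<close> and cnj z \<open>d_zbar f\<close> to be exchanged for the other.\<close>

lemma rot_weight_euler:
  assumes w: "rot_weight n f" and f: "C1_on f (ball 0 1)" and z: "cmod z < 1"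
  shows "z * d_z f z - cnj z * d_zbar f z = of_int n * f z"
proof -
  have "((\<lambda>t. cis (1 * t) * z) has_vector_derivative \<i> * of_real 1 * cis (1 * 0) * z) (at 0)"
    by (rule has_vector_derivative_mult_left[OF has_vector_derivative_cis])
  then have \<gamma>: "((\<lambda>t. cis t * z) has_vector_derivative \<i> * z) (at 0)" by simp
  have D1: "((\<lambda>t. f (cis t * z)) has_vector_derivative d_z f z * (\<i> * z) + d_zbar f z * cnj (\<i> * z)) (at 0)"
    by (rule wirt_chain_curve[OF _ \<gamma>]) (use C1_wirt[OF f, of z] z in simp)
  have "((\<lambda>t. cis (of_int n * t) * f z) has_vector_derivative \<i> * of_real (of_int n) * cis (of_int n * 0) * f z) (at 0)"
    by (rule has_vector_derivative_mult_left[OF has_vector_derivative_cis])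
  moreover have "(\<lambda>t. f (cis t * z)) = (\<lambda>t. cis (of_int n * t) * f z)"
    using w z by (auto simp: rot_weight_def)
  ultimately have D2: "((\<lambda>t. f (cis t * z)) has_vector_derivative \<i> * of_int n * f z) (at 0)" by simp
  have "d_z f z * (\<i> * z) + d_zbar f z * cnj (\<i> * z) = \<i> * of_int n * f z"
    by (rule vector_derivative_unique_at[OF D1 D2])
  then have "\<i> * (z * d_z f z - cnj z * d_zbar f z) = \<i> * (of_int n * f z)"
    by (simp add: algebra_simps)
  then show ?thesis by simp
qed

text \<open>The Wirtinger derivatives of z -> f (cis a z) are computed twice, by the chain rule and
  from the weight of f.\<close>

lemma rot_weight_deriv:
  assumes w: "rot_weight n f" and f: "C1_on f (ball 0 1)"
  shows "rot_weight (n - 1) (d_z f)" "rot_weight (n + 1) (d_zbar f)"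
proof -
  have *: "d_z f (cis a * z) = cis (of_int (n - 1) * a) * d_z f z \<and> d_zbar f (cis a * z) = cis (of_int (n + 1) * a) * d_zbar f z"
    if z: "cmod z < 1" for a z
  proof -
    have "wirt (\<lambda>z. f (cis a * z)) (d_z f (cis a * z) * cis a) (d_zbar f (cis a * z) * cnj (cis a)) z"
      by (rule rot_wirt, rule C1_wirt[OF f]) (use z in \<open>simp add: norm_mult\<close>)
    moreover have "wirt (\<lambda>z. f (cis a * z)) (cis (of_int n * a) * d_z f z) (cis (of_int n * a) * d_zbar f z) z"
      by (rule wirt_cong[OF wirt_cmult[OF C1_wirt[OF f, of z], of "cis (of_int n * a)"], of "ball 0 1"])
         (use z w in \<open>auto simp: rot_weight_def\<close>)
    ultimately have e: "d_z f (cis a * z) * cis a = cis (of_int n * a) * d_z f z"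
      "d_zbar f (cis a * z) * cis (- a) = cis (of_int n * a) * d_zbar f z"
      using wirtD(4,5) by (metis, metis cis_cnj)
    have "d_z f (cis a * z) = d_z f (cis a * z) * cis a * cis (- a)" by (simp add: mult.assoc cis_mult)
    also have "\<dots> = cis (of_int (n - 1) * a) * d_z f z"
      unfolding e by (simp add: mult_ac) (simp add: mult.assoc[symmetric] cis_mult algebra_simps)
    finally have 1: "d_z f (cis a * z) = cis (of_int (n - 1) * a) * d_z f z" .
    have "d_zbar f (cis a * z) = d_zbar f (cis a * z) * cis (- a) * cis a" by (simp add: mult.assoc cis_mult)
    also have "\<dots> = cis (of_int (n + 1) * a) * d_zbar f z"
      unfolding e by (simp add: mult_ac) (simp add: mult.assoc[symmetric] cis_mult algebra_simps)
    finally show ?thesis using 1 by blast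
  qed
  then show "rot_weight (n - 1) (d_z f)" "rot_weight (n + 1) (d_zbar f)"
    by (auto simp: rot_weight_def)
qed

text \<open>Euler's relation leaves one derivative in each operator: B f = (1 - |z|^2)
  \<open>d_zbar f\<close> - n z f, and A is reduced in the same way on this result, which has weight
  n + 1.\<close>

lemma lie_AB:
  assumes f: "C2_on f (ball 0 1)" and w: "rot_weight n f" and z: "cmod z < 1"
  shows "lie_A (lie_B f) z = (1 - z * cnj z)\<^sup>2 * d_z (d_zbar f) z - of_int (n * (n + 1)) * f z"
proof -
  have f1: "C1_on f (ball 0 1)" "C1_on (d_zbar f) (ball 0 1)" using f by (auto simp: C2_iff)
  have w1: "rot_weight (n + 1) (d_zbar f)" by (rule rot_weight_deriv(2)[OF w f1(1)])
  define b where "b z = (1 - z * cnj z) * d_zbar f z - of_int n * (z * f z)" for z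
  have Bb: "lie_B f z = b z" if "cmod z < 1" for z
    using rot_weight_euler[OF w f1(1) that] that
    by (simp add: lie_B_def restrict0_def b_def power2_eq_square algebra_simps)
  have b1: "C1_on b (ball 0 1)"
    unfolding b_def[abs_def]
    by (intro C1_diff C1_mult C1_const C1_ident f1 C1_comp_cnj)
  have wb: "rot_weight (n + 1) b"
    unfolding rot_weight_def
  proof (intro allI impI)
    fix a z assume z: "cmod z < 1"
    have "cis a * z * cnj (cis a * z) = z * cnj z"
      by (simp add: cis_cnj mult_ac) (simp add: mult.assoc[symmetric] cis_mult)
    moreover have "cis a * z * f (cis a * z) = cis (of_int (n + 1) * a) * (z * f z)"
      using w z by (simp add: rot_weight_def algebra_simps flip: cis_mult)
    moreover have "d_zbar f (cis a * z) = cis (of_int (n + 1) * a) * d_zbar f z"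
      using w1 z unfolding rot_weight_def by blast
    ultimately show "b (cis a * z) = cis (of_int (n + 1) * a) * b z"
      unfolding b_def by (simp only: algebra_simps)
  qed
  have "wirt b ((1 - z * cnj z) * d_z (d_zbar f) z + (0 - (z * 0 + 1 * cnj z)) * d_zbar f z - of_int n * (z * d_z f z + 1 * f z))
     ((1 - z * cnj z) * d_zbar (d_zbar f) z + (0 - (z * 1 + 0 * cnj z)) * d_zbar f z - of_int n * (z * d_zbar f z + 0 * f z)) z"
    unfolding b_def[abs_def]
    by (intro wirt_diff wirt_mult wirt_cmult wirt_const wirt_ident wirt_cnj C1_wirt[OF f1(1)] C1_wirt[OF f1(2)]) (use z in auto)
  from wirtD(4)[OF this]
  have bz: "d_z b z = (1 - z * cnj z) * d_z (d_zbar f) z - cnj z * d_zbar f z - of_int n * (z * d_z f z + f z)" by simp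
  have "lie_A (lie_B f) z = d_z b z - (cnj z)\<^sup>2 * d_zbar b z"
    using d_z_cong[OF b1 open_ball, of "lie_B f" z] Bb z by (simp add: lie_A_def restrict0_def)
  also have "\<dots> = d_z b z - cnj z * (z * d_z b z - of_int (n + 1) * b z)"
    using rot_weight_euler[OF wb b1 z] by (simp add: power2_eq_square algebra_simps)
  also have "\<dots> = (1 - z * cnj z) * d_z b z + of_int (n + 1) * cnj z * b z" by (simp add: algebra_simps)
  also have "\<dots> = (1 - z * cnj z)\<^sup>2 * d_z (d_zbar f) z - of_int (n * (n + 1)) * f z"
  proof -
    have e: "z * d_z f z = of_int n * f z + cnj z * d_zbar f z"
      using rot_weight_euler[OF w f1(1) z] by (simp add: algebra_simps)
    show ?thesis unfolding bz e b_def by (simp add: power2_eq_square algebra_simps)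
  qed
  finally show ?thesis .
qed

text \<open>Mirror image of \<open>lie_AB\<close>. The mixed derivative arises in the other order,
  whence \<open>d_z_d_zbar_commute\<close>.\<close>

lemma lie_BA:
  assumes f: "C2_on f (ball 0 1)" and w: "rot_weight n f" and z: "cmod z < 1"
  shows "lie_B (lie_A f) z = (1 - z * cnj z)\<^sup>2 * d_z (d_zbar f) z - of_int (n * (n - 1)) * f z"
proof -
  have f1: "C1_on f (ball 0 1)" "C1_on (d_z f) (ball 0 1)" using f by (auto simp: C2_iff)
  have w1: "rot_weight (n - 1) (d_z f)" by (rule rot_weight_deriv(1)[OF w f1(1)])
  define b where "b z = (1 - z * cnj z) * d_z f z + of_int n * (cnj z * f z)" for z
  have Ab: "lie_A f z = b z" if "cmod z < 1" for z
  proof -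
    have "cnj z * d_zbar f z = z * d_z f z - of_int n * f z"
      using rot_weight_euler[OF w f1(1) that] by (simp add: algebra_simps)
    then have "(cnj z)\<^sup>2 * d_zbar f z = cnj z * (z * d_z f z - of_int n * f z)"
      by (simp add: power2_eq_square mult.assoc)
    then show ?thesis using that by (simp add: lie_A_def restrict0_def b_def algebra_simps)
  qed
  have b1: "C1_on b (ball 0 1)"
    unfolding b_def[abs_def]
    by (intro C1_diff C1_add C1_mult C1_const C1_ident f1 C1_comp_cnj)
  have wb: "rot_weight (n - 1) b"
    unfolding rot_weight_def
  proof (intro allI impI)
    fix a z assume z: "cmod z < 1"
    have "cis a * z * cnj (cis a * z) = z * cnj z"
      by (simp add: cis_cnj mult_ac) (simp add: mult.assoc[symmetric] cis_mult)
    moreover have "cnj (cis a * z) * f (cis a * z) = cis (of_int (n - 1) * a) * (cnj z * f z)"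
    proof -
      have "cis (- a) * cis (of_int n * a) = cis (of_int (n - 1) * a)" by (simp add: cis_mult algebra_simps)
      moreover have "f (cis a * z) = cis (of_int n * a) * f z" using w z unfolding rot_weight_def by blast
      ultimately show ?thesis by (simp add: cis_cnj mult_ac)
    qed
    moreover have "d_z f (cis a * z) = cis (of_int (n - 1) * a) * d_z f z"
      using w1 z unfolding rot_weight_def by blast
    ultimately show "b (cis a * z) = cis (of_int (n - 1) * a) * b z"
      unfolding b_def by (simp only: algebra_simps)
  qed
  have "wirt b ((1 - z * cnj z) * d_z (d_z f) z + (0 - (z * 0 + 1 * cnj z)) * d_z f z + of_int n * (cnj z * d_z f z + 0 * f z))
     ((1 - z * cnj z) * d_zbar (d_z f) z + (0 - (z * 1 + 0 * cnj z)) * d_z f z + of_int n * (cnj z * d_zbar f z + 1 * f z)) z"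
    unfolding b_def[abs_def]
    by (intro wirt_add wirt_diff wirt_mult wirt_cmult wirt_const wirt_ident wirt_cnj C1_wirt[OF f1(1)] C1_wirt[OF f1(2)]) (use z in auto)
  from wirtD(5)[OF this]
  have bz: "d_zbar b z = (1 - z * cnj z) * d_z (d_zbar f) z - z * d_z f z + of_int n * (cnj z * d_zbar f z + f z)"
    using d_z_d_zbar_commute[OF f open_ball, of z] z by simp
  have "lie_B (lie_A f) z = d_zbar b z - z\<^sup>2 * d_z b z"
    using d_z_cong[OF b1 open_ball, of "lie_A f" z] Ab z by (simp add: lie_B_def restrict0_def)
  also have "\<dots> = d_zbar b z - z * (cnj z * d_zbar b z + of_int (n - 1) * b z)"
  proof -
    have "z * d_z b z = cnj z * d_zbar b z + of_int (n - 1) * b z"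
      using rot_weight_euler[OF wb b1 z] by (simp add: algebra_simps)
    then show ?thesis by (simp add: power2_eq_square mult.assoc)
  qed
  also have "\<dots> = (1 - z * cnj z) * d_zbar b z - of_int (n - 1) * z * b z" by (simp add: algebra_simps)
  also have "\<dots> = (1 - z * cnj z)\<^sup>2 * d_z (d_zbar f) z - of_int (n * (n - 1)) * f z"
  proof -
    have e: "cnj z * d_zbar f z = z * d_z f z - of_int n * f z"
      using rot_weight_euler[OF w f1(1) z] by (simp add: algebra_simps)
    show ?thesis unfolding bz e b_def by (simp add: power2_eq_square algebra_simps)
  qed
  finally show ?thesis .
qed

text \<open>The kernel equation says that \<phi> = f (1 - |z|^2)^m is holomorphic, and Euler's
  relation that z \<phi>' = m \<phi>. So \<phi> / z^m is constant on the punctured disk, and the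
  centre follows by continuity.\<close>

lemma top_weight_kernel:
  assumes f: "C1_on f (ball 0 1)" and w: "rot_weight (int m) f" and B: "\<And>z. cmod z < 1 \<Longrightarrow> lie_B f z = 0"
  obtains c where "\<And>z. cmod z < 1 \<Longrightarrow> f z = c * top_vector m z"
proof -
  define \<phi> where "\<phi> z = f z * (1 - z * cnj z) ^ m" for z
  have k: "(1 - z * cnj z) * d_zbar f z = of_nat m * z * f z" if "cmod z < 1" for z
    using rot_weight_euler[OF w f that] B[OF that] that
    by (simp add: lie_B_def restrict0_def power2_eq_square algebra_simps)
  have "wirt (\<lambda>z. (1 - z * cnj z) ^ j) (- of_nat j * cnj z * (1 - z * cnj z) ^ (j - 1)) (- of_nat j * z * (1 - z * cnj z) ^ (j - 1)) z" for j z
  proof (induction j)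
    case (Suc j)
    have "wirt (\<lambda>z. 1 - z * cnj z) (0 - (z * 0 + 1 * cnj z)) (0 - (z * 1 + 0 * cnj z)) z"
      by (intro wirt_diff wirt_mult wirt_const wirt_ident wirt_cnj)
    from wirt_mult[OF this Suc]
    show ?case by (cases j) (simp_all add: algebra_simps)
  qed (use wirt_const in auto)
  note pw = this
  have hol: "\<exists>D. (\<phi> has_field_derivative D) (at z) \<and> z * D = of_nat m * \<phi> z" if z: "cmod z < 1" for z
  proof -
    let ?a = "f z * (- of_nat m * cnj z * (1 - z * cnj z) ^ (m - 1)) + d_z f z * (1 - z * cnj z) ^ m"
    have w\<phi>: "wirt \<phi> ?a (f z * (- of_nat m * z * (1 - z * cnj z) ^ (m - 1)) + d_zbar f z * (1 - z * cnj z) ^ m) z"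
      unfolding \<phi>_def[abs_def] by (rule wirt_mult[OF C1_wirt[OF f] pw]) (use z in auto)
    have 0: "f z * (- of_nat m * z * (1 - z * cnj z) ^ (m - 1)) + d_zbar f z * (1 - z * cnj z) ^ m = 0"
    proof (cases m)
      case 0
      then show ?thesis using k[OF z] cnj_ball_nz[OF z] by simp
    next
      case (Suc j)
      have "d_zbar f z * (1 - z * cnj z) ^ m = ((1 - z * cnj z) * d_zbar f z) * (1 - z * cnj z) ^ j"
        using Suc by (simp add: algebra_simps)
      then show ?thesis unfolding k[OF z] using Suc by (simp add: algebra_simps)
    qed
    have D: "(\<phi> has_field_derivative ?a) (at z)"
      using w\<phi> unfolding 0 wirt_def has_field_derivative_def by simp
    have e: "z * d_z f z = of_nat m * f z + cnj z * d_zbar f z"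
      using rot_weight_euler[OF w f z] by (simp add: algebra_simps)
    have "z * ?a = cnj z * (f z * (- of_nat m * z * (1 - z * cnj z) ^ (m - 1)) + d_zbar f z * (1 - z * cnj z) ^ m) + of_nat m * \<phi> z"
      using e by (simp add: \<phi>_def ring_distribs mult.assoc[symmetric])
    then show ?thesis using D 0 by auto
  qed
  define S where "S = ball (0::complex) 1 - {0}"
  have S: "open S" "connected S" unfolding S_def by (auto intro: connected_punctured_ball simp: open_delete)
  have "\<exists>c. \<forall>z\<in>S. \<phi> z / z ^ m = c"
  proof (rule DERIV_zero_connected_constant_on[OF S(2,1) finite.emptyI, unfolded constant_on_def])
    have D0: "((\<lambda>z. \<phi> z / z ^ m) has_field_derivative 0) (at z)" if "z \<in> S" for z
    proof -
      have z: "z \<noteq> 0" "cmod z < 1" using that by (auto simp: S_def)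
      obtain D where D: "(\<phi> has_field_derivative D) (at z)" "z * D = of_nat m * \<phi> z" using hol[OF z(2)] by blast
      have dp: "((\<lambda>z. z ^ m) has_field_derivative of_nat m * z ^ (m - Suc 0)) (at z)"
        by (auto intro!: derivative_eq_intros)
      have "D * z ^ m - \<phi> z * (of_nat m * z ^ (m - Suc 0)) = 0"
      proof (cases m)
        case 0
        then show ?thesis using D(2) z by simp
      next
        case (Suc j)
        have "D * z ^ m = (z * D) * z ^ j" using Suc by simp
        then show ?thesis unfolding D(2) using Suc by (simp add: algebra_simps)
      qed
      then show ?thesis
        using DERIV_divide[OF D(1) dp] z by simp
    qed
    show "continuous_on S (\<lambda>z. \<phi> z / z ^ m)"
      using D0 by (intro continuous_at_imp_continuous_on ballI DERIV_isCont) blast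
    show "\<forall>z\<in>S - {}. ((\<lambda>z. \<phi> z / z ^ m) has_field_derivative 0) (at z)"
      using D0 by simp
  qed
  then obtain c where c: "\<And>z. z \<in> S \<Longrightarrow> \<phi> z = c * z ^ m"
    by (auto simp: S_def field_simps)
  have c0: "\<phi> z = c * z ^ m" if z: "cmod z < 1" for z
  proof (cases "z = 0")
    case True
    have "(\<lambda>z. \<phi> z - c * z ^ m) 0 = 0"
    proof (rule isCont_punctured_zero[where g = "\<lambda>z. \<phi> z - c * z ^ m"])
      show "isCont (\<lambda>z. \<phi> z - c * z ^ m) 0"
      proof -
        have "isCont \<phi> 0" using hol[of 0] DERIV_isCont by auto
        then show ?thesis by (intro continuous_intros)
      qed
      have "\<forall>\<^sub>F z in at 0. z \<in> ball (0::complex) 1"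
        by (rule eventually_at_in_open') auto
      then have "\<forall>\<^sub>F z in at 0. z \<in> S"
        unfolding S_def eventually_at_filter by eventually_elim auto
      then show "\<forall>\<^sub>F z in at 0. \<phi> z - c * z ^ m = 0"
        by eventually_elim (simp add: c)
    qed
    then show ?thesis using True by simp
  qed (use c z in \<open>auto simp: S_def\<close>)
  show ?thesis
  proof (rule that)
    fix z :: complex assume z: "cmod z < 1"
    show "f z = c * top_vector m z"
      using c0[OF z] cnj_ball_nz[OF z] z by (simp add: \<phi>_def top_vector_def restrict0_def power_divide field_simps)
  qed
qed


section \<open>Structure of a finite-dimensional invariant space\<close>

locale finite_dim_invariant =
  fixes lam :: complex and Y :: "(complex \<Rightarrow> complex) set" and B :: "(complex \<Rightarrow> complex) set" and m :: nat
  assumes inv: "moebius_invariant_subspace lam Y" and fin: "finite B" and Y: "Y = cfun.span B"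
    and lam: "lam = eigval m"
begin

lemma subspace: "cfun.subspace Y"
  using inv by (simp add: moebius_invariant_subspace_def)

text \<open>The inclusion is hidden in \<open>closedin\<close>, which places Y inside the underlying
  set of the topology.\<close>

lemma Y_X_disk: "Y \<subseteq> X_disk lam"
proof -
  have "closedin (loc_unif_topology (ball 0 1) (X_disk lam)) Y"
    using inv by (simp add: moebius_invariant_subspace_def)
  then have "Y \<subseteq> topspace (loc_unif_topology (ball 0 1) (X_disk lam))" by (rule closedin_subset)
  also have "\<dots> \<subseteq> X_disk lam"
    unfolding topspace_def openin_loc_unif_topology by blast
  finally show ?thesis .
qed

lemma YD:
  assumes "f \<in> Y"
  shows "\<not> cmod z < 1 \<Longrightarrow> f z = 0" "C2_on f (ball 0 1)"
    "cmod z < 1 \<Longrightarrow> (1 - z * cnj z)\<^sup>2 * d_z (d_zbar f) z = of_nat (m * (m + 1)) * f z"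
proof -
  have X: "f \<in> X_disk lam" using assms Y_X_disk by blast
  then show "\<not> cmod z < 1 \<Longrightarrow> f z = 0" "C2_on f (ball 0 1)" by (auto simp: X_disk_def)
  have "laplace_disk f z = lam * f z" if "cmod z < 1" using X that by (simp add: X_disk_def)
  then show "(1 - z * cnj z)\<^sup>2 * d_z (d_zbar f) z = of_nat (m * (m + 1)) * f z" if "cmod z < 1"
    using that unfolding lam by (simp add: laplace_disk_def complex_norm_square[symmetric] del: of_real_power) (simp add: algebra_simps)
qed

lemma Y_C1: "f \<in> Y \<Longrightarrow> C1_on f (ball 0 1)"
  using YD(2) by (simp add: C2_iff)

lemma Y_limit:
  assumes "\<And>n. f n \<in> Y" "\<And>x. (\<lambda>n. f n x) \<longlonglongrightarrow> g x"
  shows "g \<in> Y"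
  using span_pointwise_closed[OF fin] assms unfolding Y by blast

lemma Y_compose: "f \<in> Y \<Longrightarrow> disk_automorphism \<psi> \<Longrightarrow> restrict0 (ball 0 1) (f \<circ> \<psi>) \<in> Y"
  using inv by (simp add: moebius_invariant_subspace_def)

lemma Y_rotate:
  assumes "f \<in> Y"
  shows "(\<lambda>z. f (cis a * z)) \<in> Y"
proof -
  have "restrict0 (ball 0 1) (f \<circ> (\<lambda>z. cis a * z)) = (\<lambda>z. f (cis a * z))"
    using YD(1)[OF assms] by (auto simp: restrict0_def fun_eq_iff norm_mult)
  then show ?thesis using Y_compose[OF assms rotation_automorphism[of a]] by simp
qed

lemma Y_continuous_circle:
  assumes "f \<in> Y"
  shows "continuous_on {\<zeta>. cmod \<zeta> = cmod z} f"
proof (cases "cmod z < 1")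
  case True
  then show ?thesis
    by (intro continuous_on_subset[OF C1_continuous[OF Y_C1[OF assms]]]) auto
next
  case False
  have "continuous_on {\<zeta>. cmod \<zeta> = cmod z} (\<lambda>_. 0 :: complex)" by simp
  then show ?thesis by (rule continuous_on_eq) (use YD(1)[OF assms] False in auto)
qed

lemma sum_fun_apply: "(\<Sum>k\<in>A. fscale (c k) (g k)) x = (\<Sum>k\<in>A. c k * g k x)"
  by (induction A rule: infinite_finite_induct) (auto simp: fscale_def)

lemma Y_M:
  assumes f: "f \<in> Y"
  shows "M n f \<in> Y"
proof (rule Y_limit)
  fix N :: nat
  show "(\<Sum>k<N. fscale (cis (- (of_int n * (2 * pi * real k / real N))) / of_nat N) (\<lambda>z. f (cis (2 * pi * real k / real N) * z))) \<in> Y"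
    by (intro cfun.subspace_sum[OF subspace] cfun.subspace_scale[OF subspace] Y_rotate f)
  fix z
  show "(\<lambda>N. (\<Sum>k<N. fscale (cis (- (of_int n * (2 * pi * real k / real N))) / of_nat N) (\<lambda>z. f (cis (2 * pi * real k / real N) * z))) z) \<longlonglongrightarrow> M n f z"
    unfolding sum_fun_apply by (rule M_riemann[OF Y_continuous_circle[OF f]])
qed

text \<open>The difference quotients along a curve of automorphisms through the identity belong to
  Y, and so does their pointwise limit, because Y has a finite spanning set.\<close>

lemma Y_derivative:
  assumes f: "f \<in> Y" and c: "cmod c = 1"
  shows "restrict0 (ball 0 1) (\<lambda>z. d_z f z * (c - cnj c * z\<^sup>2) + d_zbar f z * cnj (c - cnj c * z\<^sup>2)) \<in> Y"
proof (rule Y_limit)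
  \<comment> \<open>The sequence starts at 1/2, which keeps the Moebius parameter inside the
    disk.\<close>
  define t where "t k = inverse (real (Suc (Suc k)))" for k
  have t: "t k > 0" "t k < 1" for k by (auto simp: t_def inverse_eq_divide)
  have t0: "filterlim t (at 0) sequentially"
  proof -
    have "(\<lambda>k. inverse (real (Suc k))) \<longlonglongrightarrow> 0" by (rule LIMSEQ_inverse_real_of_nat)
    from LIMSEQ_Suc[OF this] have "t \<longlonglongrightarrow> 0" by (simp add: t_def[abs_def])
    then show ?thesis by (auto simp: filterlim_at eventually_sequentially t(1) less_imp_neq[OF t(1), symmetric])
  qed
  let ?\<psi> = "\<lambda>s. Moebius_function 0 (- of_real s * c)"
  fix k
  have "cmod (- of_real (t k) * c) < 1" using t[of k] c by (simp add: norm_mult)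
  then show "fscale (1 / of_real (t k)) (restrict0 (ball 0 1) (f \<circ> ?\<psi> (t k)) - f) \<in> Y"
    by (intro cfun.subspace_scale[OF subspace] cfun.subspace_diff[OF subspace] Y_compose f Moebius_automorphism)
  fix z
  show "(\<lambda>k. fscale (1 / of_real (t k)) (restrict0 (ball 0 1) (f \<circ> ?\<psi> (t k)) - f) z)
    \<longlonglongrightarrow> restrict0 (ball 0 1) (\<lambda>z. d_z f z * (c - cnj c * z\<^sup>2) + d_zbar f z * cnj (c - cnj c * z\<^sup>2)) z"
  proof (cases "cmod z < 1")
    case True
    have \<psi>0: "?\<psi> 0 z = z" by (simp add: Moebius_function_simple)
    have "((\<lambda>s. ?\<psi> s z) has_vector_derivative c - cnj c * z\<^sup>2) (at 0)"
    proof -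
      have "((\<lambda>s. (z + s * c) / (1 + s * cnj c * z)) has_field_derivative c - cnj c * z\<^sup>2) (at (of_real 0))"
        by (auto intro!: derivative_eq_intros simp: power2_eq_square algebra_simps)
      from has_vector_derivative_real_field[OF this]
      show ?thesis by (simp add: Moebius_function_simple)
    qed
    then have "((\<lambda>s. f (?\<psi> s z)) has_vector_derivative d_z f z * (c - cnj c * z\<^sup>2) + d_zbar f z * cnj (c - cnj c * z\<^sup>2)) (at 0)"
      by (intro wirt_chain_curve) (use C1_wirt[OF Y_C1[OF f], of z] True \<psi>0 in auto)
    from filterlim_compose[OF difference_quotient_tendsto[OF this] t0]
    show ?thesis using True \<psi>0 by (simp add: fscale_def restrict0_def)
  next
    case False
    then show ?thesis using YD(1)[OF f] by (simp add: fscale_def restrict0_def)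
  qed
qed

lemma Y_lie:
  assumes f: "f \<in> Y"
  shows "lie_A f \<in> Y" "lie_B f \<in> Y"
proof -
  define D where "D c = restrict0 (ball 0 1) (\<lambda>z. d_z f z * (c - cnj c * z\<^sup>2) + d_zbar f z * cnj (c - cnj c * z\<^sup>2))" for c
  have D: "D 1 \<in> Y" "D \<i> \<in> Y" unfolding D_def by (rule Y_derivative[OF f]; simp)+
  have "lie_A f = fscale (1/2) (D 1 + fscale (- \<i>) (D \<i>))" "lie_B f = fscale (1/2) (D 1 + fscale \<i> (D \<i>))"
    by (auto simp: fun_eq_iff lie_A_def lie_B_def D_def fscale_def restrict0_def algebra_simps add_divide_distrib diff_divide_distrib)
  then show "lie_A f \<in> Y" "lie_B f \<in> Y"
    using cfun.subspace_scale[OF subspace] cfun.subspace_add[OF subspace] D by metis+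
qed

definition W :: "int \<Rightarrow> (complex \<Rightarrow> complex) set" where
  "W n = {f \<in> Y. rot_weight n f}"

lemma M_W: "f \<in> Y \<Longrightarrow> M n f \<in> W n"
  by (auto simp: W_def Y_M rot_weight_def intro: M_rotate Y_continuous_circle)

lemma W_rot:
  assumes "f \<in> W n"
  shows "f (cis a * z) = cis (of_int n * a) * f z"
proof (cases "cmod z < 1")
  case False
  then show ?thesis using YD(1)[of f] assms by (auto simp: W_def norm_mult)
qed (use assms in \<open>auto simp: W_def rot_weight_def\<close>)

lemma W_lie:
  assumes f: "f \<in> W n"
  shows "lie_A f \<in> W (n - 1)" "lie_B f \<in> W (n + 1)"
proof -
  have fY: "f \<in> Y" and w: "rot_weight n f" using f by (auto simp: W_def)
  have wd: "rot_weight (n - 1) (d_z f)" "rot_weight (n + 1) (d_zbar f)"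
    using rot_weight_deriv[OF w Y_C1[OF fY]] by auto
  have c: "cis (- a) ^ 2 * cis (of_int (n + 1) * a) = cis (of_int (n - 1) * a)" "cis a ^ 2 * cis (of_int (n - 1) * a) = cis (of_int (n + 1) * a)" for a
    by (auto simp: Complex.DeMoivre cis_mult algebra_simps)
  have "rot_weight (n - 1) (lie_A f)"
    unfolding rot_weight_def
  proof (intro allI impI)
    fix a z assume z: "cmod z < 1"
    have 1: "(cnj (cis a * z))\<^sup>2 * d_zbar f (cis a * z) = cis (of_int (n - 1) * a) * ((cnj z)\<^sup>2 * d_zbar f z)"
    proof -
      have "d_zbar f (cis a * z) = cis (of_int (n + 1) * a) * d_zbar f z"
        using wd(2) z unfolding rot_weight_def by blast
      then show ?thesis unfolding c(1)[symmetric] by (simp only: power_mult_distrib cis_cnj complex_cnj_mult mult_ac)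
    qed
    have 2: "d_z f (cis a * z) = cis (of_int (n - 1) * a) * d_z f z"
      using wd(1) z unfolding rot_weight_def by blast
    have "lie_A f (cis a * z) = d_z f (cis a * z) - (cnj (cis a * z))\<^sup>2 * d_zbar f (cis a * z)"
      using z by (simp add: lie_A_def restrict0_def norm_mult)
    also have "\<dots> = cis (of_int (n - 1) * a) * lie_A f z"
      unfolding 1 2 using z by (simp add: lie_A_def restrict0_def right_diff_distrib)
    finally show "lie_A f (cis a * z) = cis (of_int (n - 1) * a) * lie_A f z" .
  qed
  moreover have "rot_weight (n + 1) (lie_B f)"
    unfolding rot_weight_def
  proof (intro allI impI)
    fix a z assume z: "cmod z < 1"
    have 1: "(cis a * z)\<^sup>2 * d_z f (cis a * z) = cis (of_int (n + 1) * a) * (z\<^sup>2 * d_z f z)"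
    proof -
      have "d_z f (cis a * z) = cis (of_int (n - 1) * a) * d_z f z"
        using wd(1) z unfolding rot_weight_def by blast
      then show ?thesis unfolding c(2)[symmetric] by (simp only: power_mult_distrib mult_ac)
    qed
    have 2: "d_zbar f (cis a * z) = cis (of_int (n + 1) * a) * d_zbar f z"
      using wd(2) z unfolding rot_weight_def by blast
    have "lie_B f (cis a * z) = d_zbar f (cis a * z) - (cis a * z)\<^sup>2 * d_z f (cis a * z)"
      using z by (simp add: lie_B_def restrict0_def norm_mult)
    also have "\<dots> = cis (of_int (n + 1) * a) * lie_B f z"
      unfolding 1 2 using z by (simp add: lie_B_def restrict0_def right_diff_distrib)
    finally show "lie_B f (cis a * z) = cis (of_int (n + 1) * a) * lie_B f z" .
  qed
  ultimately show "lie_A f \<in> W (n - 1)" "lie_B f \<in> W (n + 1)"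
    using Y_lie[OF fY] by (auto simp: W_def)
qed

lemma W_AB:
  assumes f: "f \<in> W n"
  shows "lie_A (lie_B f) = fscale (of_int (int m * (int m + 1) - n * (n + 1))) f"
    "lie_B (lie_A f) = fscale (of_int (int m * (int m + 1) - n * (n - 1))) f"
proof -
  have fY: "f \<in> Y" and w: "rot_weight n f" using f by (auto simp: W_def)
  have z0: "lie_A (lie_B f) z = 0" "lie_B (lie_A f) z = 0" "f z = 0" if "\<not> cmod z < 1" for z
    using that YD(1)[OF fY] by (auto simp: lie_A_def lie_B_def restrict0_def)
  have "lie_A (lie_B f) z = of_int (int m * (int m + 1) - n * (n + 1)) * f z \<and>
     lie_B (lie_A f) z = of_int (int m * (int m + 1) - n * (n - 1)) * f z" for z
  proof (cases "cmod z < 1")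
    case True
    show ?thesis
      unfolding lie_AB[OF YD(2)[OF fY] w True] lie_BA[OF YD(2)[OF fY] w True] YD(3)[OF fY True]
      by (simp add: algebra_simps)
  qed (use z0 in simp)
  then show "lie_A (lie_B f) = fscale (of_int (int m * (int m + 1) - n * (n + 1))) f"
    "lie_B (lie_A f) = fscale (of_int (int m * (int m + 1) - n * (n - 1))) f"
    by (auto simp: fscale_def)
qed

lemma lie_zero: "lie_A (\<lambda>_. 0) = (\<lambda>_. 0)" "lie_B (\<lambda>_. 0) = (\<lambda>_. 0)"
  using wirtD(4,5)[OF wirt_const[of 0]] by (auto simp: lie_A_def lie_B_def restrict0_def)

text \<open>Nonzero functions of different weights are linearly independent, so there are at most as
  many as elements of the spanning set B.\<close>

lemma finitely_many_weights:
  assumes f: "\<And>n. n \<in> S \<Longrightarrow> f n \<in> W n" "\<And>n. n \<in> S \<Longrightarrow> f n \<noteq> (\<lambda>_. 0)"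
  shows "finite S"
proof (rule ccontr)
  assume "infinite S"
  then obtain T where T: "T \<subseteq> S" "finite T" "card T = Suc (card B)"
    using infinite_arbitrarily_large by blast
  have coeff: "c k = 0" if "(\<Sum>n\<in>T. fscale (c n) (f n)) = 0" "k \<in> T" for c k
  proof -
    have kS: "k \<in> S" using that T by auto
    obtain z where z: "f k z \<noteq> 0" using f(2)[OF kS] by auto
    have cont: "continuous_on {\<zeta>. cmod \<zeta> = cmod z} (f n)" if "n \<in> T" for n
      using f(1)[of n] that T by (auto simp: W_def intro: Y_continuous_circle)
    have M_sum: "M k (\<lambda>z. \<Sum>n\<in>T'. c n * f n z) z = (\<Sum>n\<in>T'. c n * M k (f n) z)" if "T' \<subseteq> T" for T'
      using finite_subset[OF that T(2)] that
    proof (induction T' rule: finite_induct)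
      case (insert n T')
      then show ?case
        using cont by (simp add: M_cmult M_add[where f = "\<lambda>z. c n * f n z"] continuous_on_sum continuous_on_mult_left subset_iff)
    qed (simp add: M_def)
    \<comment> \<open>\<open>M k\<close> retains only the term of weight k in the relation.\<close>
    have "(\<Sum>n\<in>T. c n * M k (f n) z) = M k (\<lambda>z. \<Sum>n\<in>T. c n * f n z) z"
      by (simp add: M_sum)
    also have "(\<lambda>z. \<Sum>n\<in>T. c n * f n z) = (\<lambda>_. 0)"
      using fun_cong[OF that(1)] by (simp add: sum_fun_apply)
    finally have "(\<Sum>n\<in>T. c n * M k (f n) z) = 0" by (simp add: M_def)
    also have "(\<Sum>n\<in>T. c n * M k (f n) z) = (\<Sum>n\<in>T. if k = n then c n * f n z else 0)"
    proof (intro sum.cong refl)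
      fix n assume "n \<in> T"
      then have "f n \<in> W n" using f T by auto
      from M_weight[of "f n" z n k, OF W_rot[OF this]]
      show "c n * M k (f n) z = (if k = n then c n * f n z else 0)" by simp
    qed
    also have "\<dots> = c k * f k z" using that(2) T(2) by simp
    finally show ?thesis using z by simp
  qed
  have inj: "inj_on f T"
  proof (rule inj_onI, rule ccontr)
    fix j k assume jk: "j \<in> T" "k \<in> T" "f j = f k" "j \<noteq> k"
    let ?c = "\<lambda>i. (if i = j then 1 else 0) + (if i = k then -1 else 0) :: complex"
    have "(\<Sum>i\<in>T. fscale (?c i) (f i)) = (\<Sum>i\<in>T. (if i = j then f i else 0) + (if i = k then - f i else 0))"
      by (intro sum.cong) (auto simp: fscale_def fun_eq_iff)
    also have "\<dots> = 0" using jk T by (simp add: sum.distrib)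
    finally have "?c j = 0" by (rule coeff) (use jk in auto)
    then show False using jk(4) by simp
  qed
  have "cfun.independent (f ` T)"
  proof -
    have "u v = 0" if "(\<Sum>v\<in>f ` T. fscale (u v) v) = 0" "v \<in> f ` T" for u v
    proof -
      have "(\<Sum>n\<in>T. fscale (u (f n)) (f n)) = 0" using that(1) by (simp add: sum.reindex[OF inj])
      from coeff[OF this] show ?thesis using that(2) by auto
    qed
    then show ?thesis using T(2) by (subst cfun.dependent_finite) auto
  qed
  moreover have "f ` T \<subseteq> cfun.span B" using f(1) T(1) unfolding Y[symmetric] by (auto simp: W_def)
  ultimately have "card (f ` T) \<le> card B" using cfun.independent_span_bound[OF fin] by blast
  then show False using card_image[OF inj] T(3) by simp
qed

text \<open>From n > m on, the scalar of A B is nonzero at n and at every higher weight. Repeated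
  raising would never give 0 and would produce infinitely many weights.\<close>

lemma W_high:
  assumes f: "f \<in> W n" and n: "n > int m"
  shows "f = (\<lambda>_. 0)"
proof (rule ccontr)
  assume ne: "f \<noteq> (\<lambda>_. 0)"
  have it: "(lie_B ^^ k) f \<in> W (n + int k) \<and> (lie_B ^^ k) f \<noteq> (\<lambda>_. 0)" for k
  proof (induction k)
    case (Suc k)
    let ?g = "(lie_B ^^ k) f" and ?n = "n + int k"
    have "int m * (int m + 1) < ?n * (?n + 1)" using n by (intro mult_strict_mono) auto
    then have "lie_A (lie_B ?g) \<noteq> (\<lambda>_. 0)"
      using W_AB(1)[of ?g ?n] Suc by (auto simp: fscale_def fun_eq_iff simp del: of_int_diff of_int_mult of_int_add)
    then have "lie_B ?g \<noteq> (\<lambda>_. 0)" using lie_zero by auto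
    then show ?case using W_lie(2)[of ?g ?n] Suc by (simp add: add_ac)
  qed (use f ne in simp)
  have "finite (range (\<lambda>k. n + int k))"
  proof (rule finitely_many_weights)
    show "(lie_B ^^ (nat (j - n))) f \<in> W j" "(lie_B ^^ (nat (j - n))) f \<noteq> (\<lambda>_. 0)" if "j \<in> range (\<lambda>k. n + int k)" for j
      using that it[of "nat (j - n)"] by auto
  qed
  moreover have "inj (\<lambda>k. n + int k)" by (auto simp: inj_def)
  ultimately show False using finite_imageD by blast
qed

text \<open>The same with repeated lowering and B A, as n(n - 1) > m(m + 1) for n < -m.\<close>

lemma W_low:
  assumes f: "f \<in> W n" and n: "n < - int m"
  shows "f = (\<lambda>_. 0)"
proof (rule ccontr)
  assume ne: "f \<noteq> (\<lambda>_. 0)"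
  have it: "(lie_A ^^ k) f \<in> W (n - int k) \<and> (lie_A ^^ k) f \<noteq> (\<lambda>_. 0)" for k
  proof (induction k)
    case (Suc k)
    let ?g = "(lie_A ^^ k) f" and ?n = "n - int k"
    have "int m * (int m + 1) < (- ?n) * (- ?n + 1)" using n by (intro mult_strict_mono) auto
    then have "int m * (int m + 1) < ?n * (?n - 1)" by (simp add: algebra_simps)
    then have "lie_B (lie_A ?g) \<noteq> (\<lambda>_. 0)"
      using W_AB(2)[of ?g ?n] Suc by (auto simp: fscale_def fun_eq_iff simp del: of_int_diff of_int_mult of_int_add)
    then have "lie_A ?g \<noteq> (\<lambda>_. 0)" using lie_zero by auto
    then show ?case using W_lie(1)[of ?g ?n] Suc by (simp add: algebra_simps)
  qed (use f ne in simp)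
  have "finite (range (\<lambda>k. n - int k))"
  proof (rule finitely_many_weights)
    show "(lie_A ^^ (nat (n - j))) f \<in> W j" "(lie_A ^^ (nat (n - j))) f \<noteq> (\<lambda>_. 0)" if "j \<in> range (\<lambda>k. n - int k)" for j
      using that it[of "nat (n - j)"] by auto
  qed
  moreover have "inj (\<lambda>k. n - int k)" by (auto simp: inj_def)
  ultimately show False using finite_imageD by blast
qed

lemma Y_decompose:
  assumes f: "f \<in> Y"
  shows "f = (\<Sum>j\<le>2 * m. M (int m - int j) f)"
proof
  fix z
  have "f z = (\<Sum>n\<in>(\<lambda>j. int m - int j) ` {..2 * m}. M n f z)"
  proof (rule fourier_finite[OF Y_continuous_circle[OF f]])
    fix n assume n: "n \<notin> (\<lambda>j. int m - int j) ` {..2 * m}"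
    have "n > int m \<or> n < - int m"
    proof (rule ccontr)
      assume "\<not> ?thesis"
      then have "n = int m - int (nat (int m - n))" "nat (int m - n) \<le> 2 * m" by auto
      then show False using n by blast
    qed
    then have "M n f = (\<lambda>_. 0)" using W_high[OF M_W[OF f]] W_low[OF M_W[OF f]] by blast
    then show "M n f z = 0" by simp
  qed auto
  also have "\<dots> = (\<Sum>j\<le>2 * m. M (int m - int j) f z)"
    by (subst sum.reindex) (auto simp: inj_on_def)
  also have "\<dots> = (\<Sum>j\<le>2 * m. M (int m - int j) f) z"
  proof -
    have "(\<Sum>j\<in>A. g j) z = (\<Sum>j\<in>A. g j z)" for A :: "nat set" and g :: "nat \<Rightarrow> complex \<Rightarrow> complex"
      by (induction A rule: infinite_finite_induct) auto
    then show ?thesis by simp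
  qed
  finally show "f z = (\<Sum>j\<le>2 * m. M (int m - int j) f) z" .
qed

text \<open>Raising leads to weight m + 1, where only 0 is left, so f is in the kernel of B.\<close>

lemma W_top:
  assumes f: "f \<in> W (int m)"
  shows "\<exists>c. f = fscale c (top_vector m)"
proof -
  have fY: "f \<in> Y" and w: "rot_weight (int m) f" using f by (auto simp: W_def)
  have "lie_B f = (\<lambda>_. 0)" by (rule W_high[OF W_lie(2)[OF f]]) simp
  then obtain c where c: "\<And>z. cmod z < 1 \<Longrightarrow> f z = c * top_vector m z"
    using top_weight_kernel[OF Y_C1[OF fY] w] by (metis (no_types))
  have "f z = c * top_vector m z" for z
    using c YD(1)[OF fY] by (cases "cmod z < 1") (auto simp: top_vector_def restrict0_def)
  then show ?thesis by (auto simp: fscale_def fun_eq_iff)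
qed

text \<open>On weight m - j - 1 the product A B is (j + 1)(2m - j), which is nonzero above weight -m
  - 1, so f is recovered as a multiple of A (B f). The second conjunct is carried along because the
  generated functions are in Y only once \<open>top_vector m\<close> is.\<close>

lemma W_down:
  assumes "j \<le> 2 * m" "f \<in> W (int m - int j)"
  shows "\<exists>c. f = fscale c ((lie_A ^^ j) (top_vector m)) \<and> (f \<noteq> (\<lambda>_. 0) \<longrightarrow> top_vector m \<in> Y)"
  using assms
proof (induction j arbitrary: f)
  case 0
  then obtain c where c: "f = fscale c (top_vector m)" using W_top by auto
  have "top_vector m \<in> Y" if "f \<noteq> (\<lambda>_. 0)"
  proof -
    have "c \<noteq> 0" using that c by (auto simp: fscale_def)
    then have "top_vector m = fscale (1 / c) f" unfolding c by (simp add: fscale_def)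
    then show ?thesis using 0 cfun.subspace_scale[OF subspace, of f "1 / c"] by (auto simp: W_def)
  qed
  then show ?case using c by auto
next
  case (Suc j)
  let ?n = "int m - int (Suc j)"
  define d :: complex where "d = of_int (int m * (int m + 1) - ?n * (?n + 1))"
  have d: "d \<noteq> 0"
  proof -
    have "int m * (int m + 1) - ?n * (?n + 1) = (int j + 1) * (2 * int m - int j)" by (simp add: algebra_simps)
    also have "\<dots> > 0" using Suc.prems(1) by (intro mult_pos_pos) auto
    finally show ?thesis by (simp only: d_def of_int_eq_0_iff)
  qed
  have AB: "lie_A (lie_B f) = fscale d f" unfolding d_def by (rule W_AB(1)[OF Suc.prems(2)])
  have "lie_B f \<in> W (int m - int j)" using W_lie(2)[OF Suc.prems(2)] by simp
  then obtain c where c: "lie_B f = fscale c ((lie_A ^^ j) (top_vector m))" and t: "lie_B f \<noteq> (\<lambda>_. 0) \<longrightarrow> top_vector m \<in> Y"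
    using Suc by (metis Suc_leD)
  show ?case
  proof (cases "lie_B f = (\<lambda>_. 0)")
    case True
    then have "fscale d f = (\<lambda>_. 0)" using AB lie_zero(1) by simp
    then have "f = (\<lambda>_. 0)" using d by (auto simp: fscale_def fun_eq_iff)
    then show ?thesis by (intro exI[of _ 0]) (auto simp: fscale_def)
  next
    case False
    then have tY: "top_vector m \<in> Y" using t by blast
    have gY: "(lie_A ^^ j) (top_vector m) \<in> Y" by (induction j) (auto intro: tY Y_lie(1))
    define g where "g = (lie_A ^^ j) (top_vector m)"
    have "lie_A (fscale c g) = fscale c (lie_A g)"
      using wirtD(4,5)[OF wirt_cmult[OF C1_wirt[OF Y_C1[OF gY]]], of _ c]
      by (auto simp: lie_A_def restrict0_def fscale_def fun_eq_iff algebra_simps g_def)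
    then have "fscale d f = fscale c (lie_A g)" using AB c by (simp add: g_def)
    then have "f = fscale (c / d) (lie_A g)"
      using d by (auto simp: fscale_def fun_eq_iff field_simps)
    then show ?thesis using tY by (auto simp: g_def)
  qed
qed

text \<open>The right-hand side does not mention Y, so any two nonzero spaces of this kind
  coincide.\<close>

theorem Y_eq:
  assumes ne: "Y \<noteq> {\<lambda>_. 0}"
  shows "Y = cfun.span ((\<lambda>j. (lie_A ^^ j) (top_vector m)) ` {..2 * m})"
proof -
  have "0 \<in> Y" by (rule cfun.subspace_0[OF subspace])
  then obtain f where f: "f \<in> Y" "f \<noteq> (\<lambda>_. 0)" using ne by (auto simp: zero_fun_def)
  have "\<exists>j\<le>2 * m. M (int m - int j) f \<noteq> (\<lambda>_. 0)"
  proof (rule ccontr)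
    assume "\<not> ?thesis"
    then have "(\<Sum>j\<le>2 * m. M (int m - int j) f) = (\<Sum>j\<le>2 * m. 0)"
      by (intro sum.cong) (auto simp: zero_fun_def)
    from trans[OF Y_decompose[OF f(1)] this] have "f = 0" by simp
    then show False using f(2) by (simp add: zero_fun_def)
  qed
  then obtain j where j: "j \<le> 2 * m" "M (int m - int j) f \<noteq> (\<lambda>_. 0)" by blast
  then have tY: "top_vector m \<in> Y" using W_down[OF j(1) M_W[OF f(1)]] by blast
  have AY: "(lie_A ^^ j) (top_vector m) \<in> Y" for j by (induction j) (auto intro: tY Y_lie(1))
  show ?thesis
  proof
    show "cfun.span ((\<lambda>j. (lie_A ^^ j) (top_vector m)) ` {..2 * m}) \<subseteq> Y"
      by (rule cfun.span_minimal[OF _ subspace]) (use AY in auto)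
    show "Y \<subseteq> cfun.span ((\<lambda>j. (lie_A ^^ j) (top_vector m)) ` {..2 * m})"
    proof
      fix f assume f: "f \<in> Y"
      have "M (int m - int j) f \<in> cfun.span ((\<lambda>j. (lie_A ^^ j) (top_vector m)) ` {..2 * m})" if j: "j \<in> {..2 * m}" for j
      proof -
        obtain c where "M (int m - int j) f = fscale c ((lie_A ^^ j) (top_vector m))"
          using W_down[of j] M_W[OF f] j by blast
        then show ?thesis using cfun.span_scale[OF cfun.span_base[OF imageI[OF j]]] by metis
      qed
      then have "(\<Sum>j\<le>2 * m. M (int m - int j) f) \<in> cfun.span ((\<lambda>j. (lie_A ^^ j) (top_vector m)) ` {..2 * m})"
        by (rule cfun.span_sum)
      then show "f \<in> cfun.span ((\<lambda>j. (lie_A ^^ j) (top_vector m)) ` {..2 * m})"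
        by (simp only: Y_decompose[OF f, symmetric])
    qed
  qed
qed

end

lemma invariant_unique:
  assumes "moebius_invariant_subspace (eigval m) Y" "Y \<noteq> {\<lambda>_. 0}" "finite_dimensional Y"
  shows "Y = cfun.span ((\<lambda>j. (lie_A ^^ j) (top_vector m)) ` {..2 * m})"
proof -
  obtain B where B: "finite B" "Y = cfun.span B" using assms(3) by (auto simp: finite_dimensional_def)
  interpret finite_dim_invariant "eigval m" Y B m by unfold_locales (use assms B in auto)
  show ?thesis by (rule Y_eq[OF assms(2)])
qed

section \<open>Restriction to the disk and the main theorem\<close>

text \<open>Restricting to the bidisk inside the definition makes this a linear map on all total
  functions, which therefore commutes with spans.\<close>

definition rho :: "(sphere \<times> sphere \<Rightarrow> complex) \<Rightarrow> complex \<Rightarrow> complex" where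
  "rho F = R_h (restrict0 bidisk F)"

lemma rho_eq: "rho F = restrict0 (ball 0 1) (\<lambda>z. F (std_chart (z, cnj z)))"
  by (auto simp: rho_def R_h_def restrict0_def std_chart.simps)

lemma linear_rho: "Vector_Spaces.linear fscale fscale rho"
  by unfold_locales (auto simp: rho_eq restrict0_def fscale_def algebra_simps)

lemma rho_span: "rho ` cfun.span S = cfun.span (rho ` S)"
proof -
  interpret h: Vector_Spaces.linear fscale fscale rho by (rule linear_rho)
  show ?thesis by (rule h.span_image[symmetric])
qed

lemma diagonal_X_disk:
  assumes f: "sep_holomorphic f (ball 0 1 \<times> ball 0 1)"
    and L: "\<And>p. p \<in> ball 0 1 \<times> ball 0 1 \<Longrightarrow> LF f p = lam * f p"
  shows "restrict0 (ball 0 1) (\<lambda>z. f (z, cnj z)) \<in> X_disk lam"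
proof -
  let ?U = "ball 0 1 \<times> ball 0 1 :: (complex \<times> complex) set"
  have U: "open ?U" by (intro open_Times open_ball)
  have S: "{z. (z, 1 * cnj z) \<in> ?U} = ball 0 1" by auto
  note C = sep_C2[OF f U, where s = 1, unfolded S]
  have D: "C2_on (restrict0 (ball 0 1) (\<lambda>z. f (z, cnj z))) (ball 0 1)"
    "z \<in> ball 0 1 \<Longrightarrow> d_z (d_zbar (restrict0 (ball 0 1) (\<lambda>z. f (z, cnj z)))) z = d_z (d_zbar (\<lambda>z. f (z, 1 * cnj z))) z" for z
    using C2_cong[OF C(1) open_ball, of "restrict0 (ball 0 1) (\<lambda>z. f (z, cnj z))"] by (auto simp: restrict0_def)
  have "laplace_disk (restrict0 (ball 0 1) (\<lambda>z. f (z, cnj z))) z = lam * restrict0 (ball 0 1) (\<lambda>z. f (z, cnj z)) z"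
    if z: "z \<in> ball 0 1" for z
  proof -
    have "(of_real (cmod z))\<^sup>2 = z * cnj z" by (metis complex_norm_square of_real_power)
    moreover have "d_z (d_zbar (\<lambda>z. f (z, 1 * cnj z))) z = 1 * pz (pw f) (z, 1 * cnj z)"
      by (rule C(2)) (use z in auto)
    ultimately have "laplace_disk (restrict0 (ball 0 1) (\<lambda>z. f (z, cnj z))) z = LF f (z, cnj z)"
      unfolding laplace_disk_def D(2)[OF z] LF_eq by simp
    also have "\<dots> = lam * f (z, cnj z)" by (rule L) (use z in auto)
    finally show ?thesis using z by (simp add: restrict0_def)
  qed
  then show ?thesis using D(1) by (simp add: X_disk_def restrict0_def)
qed

lemma ball_UO: "ball 0 1 \<times> ball 0 1 \<subseteq> UO"
  using bidisk_zw by auto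

lemma rho_X_disk:
  assumes F: "F \<in> X_eig lam Omega"
  shows "rho F \<in> X_disk lam"
proof -
  have "restrict0 (ball 0 1) (\<lambda>z. (F \<circ> std_chart) (z, cnj z)) \<in> X_disk lam"
  proof (rule diagonal_X_disk)
    show "sep_holomorphic (F \<circ> std_chart) (ball 0 1 \<times> ball 0 1)"
      using X_eig_OmegaD(1)[OF F] sep_holomorphic_subset[OF _ ball_UO] by (auto simp: Hol_Omega_iff)
    show "LF (F \<circ> std_chart) p = lam * (F \<circ> std_chart) p" if "p \<in> ball 0 1 \<times> ball 0 1" for p
      using X_eig_OmegaD(2)[OF F subsetD[OF ball_UO that]] by simp
  qed
  then show ?thesis by (simp add: rho_eq)
qed

text \<open>If f outside the span had no neighbourhood avoiding it, there would be approximants from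
  the span on a sequence of disks filling the unit disk. They converge to f pointwise, and
  \<open>span_pointwise_closed\<close> puts f into the span.\<close>

lemma closed_span_X_disk:
  assumes "finite B" "cfun.span B \<subseteq> X_disk lam"
  shows "closedin (loc_unif_topology (ball 0 1) (X_disk lam)) (cfun.span B)"
proof -
  let ?T = "loc_unif_topology (ball 0 1) (X_disk lam)"
  have top: "topspace ?T = X_disk lam"
  proof -
    have "openin ?T (X_disk lam)"
      unfolding openin_loc_unif_topology by (intro conjI order_refl ballI exI[of _ "{}"] exI[of _ "1::real"]) auto
    moreover have "topspace ?T \<subseteq> X_disk lam"
      unfolding topspace_def openin_loc_unif_topology by blast
    ultimately show ?thesis using openin_subset by blast
  qed
  have "openin ?T (X_disk lam - cfun.span B)"
    unfolding openin_loc_unif_topology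
  proof (intro conjI ballI)
    fix f assume f: "f \<in> X_disk lam - cfun.span B"
    show "\<exists>K e. compact K \<and> K \<subseteq> ball 0 1 \<and> e > 0 \<and> {h \<in> X_disk lam. \<forall>z\<in>K. dist (h z) (f z) < e} \<subseteq> X_disk lam - cfun.span B"
    proof (rule ccontr)
      assume no: "\<not> ?thesis"
      \<comment> \<open>One null sequence serves both as the tolerance and as the distance of the
        compact disks from the boundary.\<close>
      define \<epsilon> where "\<epsilon> n = inverse (real (Suc n))" for n
      have \<epsilon>: "\<epsilon> n > 0" "\<epsilon> \<longlonglongrightarrow> 0" for n
        using LIMSEQ_inverse_real_of_nat by (auto simp: \<epsilon>_def[abs_def])
      have "\<exists>h. h \<in> cfun.span B \<and> (\<forall>z\<in>cball 0 (1 - \<epsilon> n). dist (h z) (f z) < \<epsilon> n)" for n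
      proof -
        have "compact (cball (0::complex) (1 - \<epsilon> n))" "cball (0::complex) (1 - \<epsilon> n) \<subseteq> ball 0 1"
          using \<epsilon>(1)[of n] by auto
        then have "\<not> {h \<in> X_disk lam. \<forall>z\<in>cball 0 (1 - \<epsilon> n). dist (h z) (f z) < \<epsilon> n} \<subseteq> X_disk lam - cfun.span B"
          using no \<epsilon>(1)[of n] by blast
        then show ?thesis by blast
      qed
      then obtain h where h: "\<And>n. h n \<in> cfun.span B" "\<And>n z. z \<in> cball 0 (1 - \<epsilon> n) \<Longrightarrow> dist (h n z) (f z) < \<epsilon> n"
        by metis
      have "f \<in> cfun.span B"
      proof (rule span_pointwise_closed[OF assms(1) h(1)])
        fix z
        show "(\<lambda>n. h n z) \<longlonglongrightarrow> f z"
        proof (cases "cmod z < 1")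
          case True
          have "\<forall>\<^sub>F n in sequentially. \<epsilon> n < 1 - cmod z"
            using order_tendstoD(2)[OF \<epsilon>(2), of "1 - cmod z"] True by simp
          then have "\<forall>\<^sub>F n in sequentially. norm (h n z - f z) \<le> \<epsilon> n"
            by eventually_elim (use h(2) in \<open>force simp: dist_norm intro: less_imp_le\<close>)
          then have "(\<lambda>n. h n z - f z) \<longlonglongrightarrow> 0" by (rule Lim_null_comparison[OF _ \<epsilon>(2)])
          then show ?thesis by (rule LIM_zero_cancel)
        next
          case False
          then have "h n z = 0" "f z = 0" for n
            using h(1)[of n] assms(2) f by (auto simp: X_disk_def)
          then show ?thesis by simp
        qed
      qed
      then show False using f by blast
    qed
  qed auto
  then show ?thesis using assms(2) by (simp add: closedin_def top)
qed

section \<open>Moebius invariance of the diagonal restrictions\<close>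

text \<open>Composed with the Moebius map that takes \<psi> 0 to 0, the automorphism fixes 0.
  Schwarz' lemma for it and for its inverse gives equality at 1/2, hence a rotation.\<close>

lemma automorphism_form:
  assumes "disk_automorphism \<psi>"
  obtains \<alpha> c where "cmod \<alpha> = 1" "cmod c < 1" "\<And>z. cmod z < 1 \<Longrightarrow> \<psi> z = (\<alpha> * z + c) / (1 + cnj c * (\<alpha> * z))"
proof -
  have hol: "\<psi> holomorphic_on ball 0 1" and bij: "bij_betw \<psi> (ball 0 1) (ball 0 1)"
    using assms by (auto simp: disk_automorphism_def)
  define c where "c = \<psi> 0"
  have \<psi>lt: "cmod (\<psi> z) < 1" if "cmod z < 1" for z
    using bij_betwE[OF bij] that by auto
  have c: "cmod c < 1" unfolding c_def by (rule \<psi>lt) simp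
  let ?\<phi> = "\<lambda>z. Moebius_function 0 c (\<psi> z)"
  have Mb: "bij_betw (Moebius_function 0 c) (ball 0 1) (ball 0 1)" and Mh: "Moebius_function 0 c holomorphic_on ball 0 1"
    using Moebius_automorphism[OF c] by (auto simp: disk_automorphism_def)
  have \<phi>hol: "?\<phi> holomorphic_on ball 0 1"
    using holomorphic_on_compose_gen[OF hol Mh] bij_betw_imp_surj_on[OF bij] by (simp add: o_def)
  have \<phi>bij: "bij_betw ?\<phi> (ball 0 1) (ball 0 1)"
    using bij_betw_trans[OF bij Mb] by (simp add: o_def)
  have \<phi>0: "?\<phi> 0 = 0" by (simp add: c_def Moebius_function_eq_zero)
  have \<phi>lt: "cmod (?\<phi> z) < 1" if "cmod z < 1" for z
    using bij_betwE[OF \<phi>bij] that by auto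
  obtain g where g: "g holomorphic_on (?\<phi> ` ball 0 1)" "\<And>z. z \<in> ball 0 1 \<Longrightarrow> g (?\<phi> z) = z"
    using holomorphic_has_inverse[OF \<phi>hol open_ball bij_betw_imp_inj_on[OF \<phi>bij]] by metis
  have im: "?\<phi> ` ball 0 1 = ball 0 1" using bij_betw_imp_surj_on[OF \<phi>bij] .
  have g0: "g 0 = 0" using g(2)[of 0] \<phi>0 by simp
  have glt: "cmod (g z) < 1" if z: "cmod z < 1" for z
  proof -
    obtain y where "y \<in> ball 0 1" "z = ?\<phi> y" using im z by (metis imageE mem_ball_0)
    then show ?thesis using g(2) by auto
  qed
  have gs: "cmod (g z) \<le> cmod z" if "cmod z < 1" for z
    by (rule Schwarz_Lemma(1)[of g]) (use g(1) im g0 glt that in auto)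
  have half: "cmod (?\<phi> (1/2)) = cmod (1/2)"
  proof (rule antisym)
    show "cmod (?\<phi> (1/2)) \<le> cmod (1/2)"
      by (rule Schwarz_Lemma(1)[of ?\<phi>]) (use \<phi>hol \<phi>0 \<phi>lt in auto)
    have "cmod (g (?\<phi> (1/2))) \<le> cmod (?\<phi> (1/2))" by (rule gs, rule \<phi>lt) simp
    then show "cmod (1/2) \<le> cmod (?\<phi> (1/2))" using g(2)[of "1/2"] by simp
  qed
  have "\<exists>\<alpha>. (\<forall>z. cmod z < 1 \<longrightarrow> ?\<phi> z = \<alpha> * z) \<and> cmod \<alpha> = 1"
    by (rule Schwarz_Lemma(3)[of ?\<phi> 0]) (use \<phi>hol \<phi>0 \<phi>lt half in \<open>auto intro!: disjI1 exI[of _ "1/2"]\<close>)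
  then obtain \<alpha> where \<alpha>: "\<And>z. cmod z < 1 \<Longrightarrow> ?\<phi> z = \<alpha> * z" "cmod \<alpha> = 1" by blast
  show ?thesis
  proof (rule that[OF \<alpha>(2) c])
    fix z :: complex assume z: "cmod z < 1"
    have "\<psi> z = Moebius_function 0 (- c) (Moebius_function 0 c (\<psi> z))"
      by (rule Moebius_function_compose[symmetric]) (use c \<psi>lt[OF z] in auto)
    also have "\<dots> = (\<alpha> * z + c) / (1 + cnj c * (\<alpha> * z))"
      unfolding \<alpha>(1)[OF z] by (simp add: Moebius_function_simple)
    finally show "\<psi> z = (\<alpha> * z + c) / (1 + cnj c * (\<alpha> * z))" .
  qed
qed

text \<open>An automorphism acts on the pair (a, b) linearly, up to a scalar. Homogeneous parameters
  are the right ones here: the new second entry can vanish, and a quotient a/b would then be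
  infinite.\<close>

lemma X_ab_automorphism:
  assumes \<alpha>: "cmod \<alpha> = 1" and c: "cmod c < 1" and z: "cmod z < 1"
  defines "\<psi> \<equiv> (\<alpha> * z + c) / (1 + cnj c * (\<alpha> * z))"
  shows "X_ab a b (\<psi>, cnj \<psi>) = cnj \<alpha> / (1 - c * cnj c) * X_ab (a - b * c) (\<alpha> * (b - a * cnj c)) (z, cnj z)"
proof -
  define y where "y = \<alpha> * z"
  have y: "cmod y < 1" using \<alpha> z by (simp add: y_def norm_mult)
  have \<alpha>1: "\<alpha> * cnj \<alpha> = 1" using \<alpha> by (simp add: complex_norm_square[symmetric])
  have n1: "1 + cnj c * y \<noteq> 0"
    using bidisk_zw[of "- cnj c" y] c y by (simp add: add_eq_0_iff) (metis minus_equation_iff)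
  have n1': "1 + c * cnj y \<noteq> 0"
    using bidisk_zw[of "- c" "cnj y"] c y by (simp add: add_eq_0_iff) (metis minus_equation_iff)
  have n2: "1 - y * cnj y \<noteq> 0" "1 - c * cnj c \<noteq> 0" using cnj_ball_nz y c by auto
  have \<psi>: "\<psi> = (y + c) / (1 + cnj c * y)" "cnj \<psi> = (cnj y + cnj c) / (1 + c * cnj y)"
    by (auto simp: \<psi>_def y_def)
  have e1: "b * \<psi> - a = ((b - a * cnj c) * y - (a - b * c)) / (1 + cnj c * y)"
    unfolding \<psi>(1) using n1 by (simp add: field_simps)
  have e2: "b - a * cnj \<psi> = ((b - a * cnj c) - (a - b * c) * cnj y) / (1 + c * cnj y)"
    unfolding \<psi>(2) using n1' by (simp add: field_simps)
  have e3: "1 - \<psi> * cnj \<psi> = (1 - c * cnj c) * (1 - y * cnj y) / ((1 + cnj c * y) * (1 + c * cnj y))"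
  proof -
    have "1 - \<psi> * cnj \<psi> = ((1 + cnj c * y) * (1 + c * cnj y) - (y + c) * (cnj y + cnj c)) / ((1 + cnj c * y) * (1 + c * cnj y))"
      unfolding \<psi> using n1 n1' by (simp add: diff_divide_distrib)
    also have "(1 + cnj c * y) * (1 + c * cnj y) - (y + c) * (cnj y + cnj c) = (1 - c * cnj c) * (1 - y * cnj y)"
      by (simp add: algebra_simps)
    finally show ?thesis .
  qed
  have "X_ab a b (\<psi>, cnj \<psi>) = ((b - a * cnj c) * y - (a - b * c)) * ((b - a * cnj c) - (a - b * c) * cnj y) / ((1 - c * cnj c) * (1 - y * cnj y))"
    unfolding X_ab_def fst_conv snd_conv e1 e2 e3 using n1 n1' n2 by simp
  also have "(b - a * cnj c) - (a - b * c) * cnj y = cnj \<alpha> * (\<alpha> * (b - a * cnj c) - (a - b * c) * cnj z)"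
  proof -
    have "cnj \<alpha> * (\<alpha> * (b - a * cnj c)) = b - a * cnj c" using \<alpha>1 by (metis mult.assoc mult.commute mult_1)
    then show ?thesis by (simp add: right_diff_distrib y_def mult_ac)
  qed
  also have "y * cnj y = z * cnj z" using \<alpha>1 by (simp add: y_def)
  finally show ?thesis by (simp add: X_ab_def y_def mult_ac)
qed

text \<open>The candidate for the space described by \<open>X0_disk\<close>.\<close>

definition V_disk :: "nat \<Rightarrow> (complex \<Rightarrow> complex) set" where
  "V_disk m = rho ` X_eig (eigval m) Omega"

lemma V_disk_span: "V_disk m = cfun.span (rho ` e_Omega m ` {..2 * m})"
  unfolding V_disk_def X_eig_Omega_eq_span rho_span ..

text \<open>This family is larger than the basis, but an automorphism maps each of its members to a
  multiple of another one.\<close>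

lemma V_disk_span_E: "V_disk m = cfun.span (rho ` (\<lambda>(a, b). E_Omega m a b) ` UNIV)"
proof -
  have "X_eig (eigval m) Omega = cfun.span ((\<lambda>(a, b). E_Omega m a b) ` UNIV)"
  proof
    show "cfun.span ((\<lambda>(a, b). E_Omega m a b) ` UNIV) \<subseteq> X_eig (eigval m) Omega"
      by (rule cfun.span_minimal[OF _ subspace_X_eig_Omega]) (auto intro: E_Omega_X_eig)
    have "E_Omega m a b \<in> cfun.span ((\<lambda>(a, b). E_Omega m a b) ` UNIV)" for a b
      by (rule cfun.span_base) auto
    then show "X_eig (eigval m) Omega \<subseteq> cfun.span ((\<lambda>(a, b). E_Omega m a b) ` UNIV)"
      unfolding X_eig_Omega_eq_span
      by (intro cfun.span_minimal) (auto intro: e_Omega_in_subspace)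
  qed
  then show ?thesis unfolding V_disk_def by (simp only: rho_span)
qed

lemma rho_E: "cmod z < 1 \<Longrightarrow> rho (E_Omega m a b) z = X_ab a b (z, cnj z) ^ m"
  using lift_std[of "(z, cnj z)"] bidisk_zw[of z "cnj z"] by (simp add: rho_eq restrict0_def E_Omega_def E0_def)

lemma V_disk_invariant:
  assumes f: "f \<in> V_disk m" and \<psi>: "disk_automorphism \<psi>"
  shows "restrict0 (ball 0 1) (f \<circ> \<psi>) \<in> V_disk m"
proof -
  have sub: "cfun.subspace (V_disk m)" unfolding V_disk_span by (rule cfun.subspace_span)
  obtain \<alpha> c where \<alpha>: "cmod \<alpha> = 1" and c: "cmod c < 1" and
    form: "\<And>z. cmod z < 1 \<Longrightarrow> \<psi> z = (\<alpha> * z + c) / (1 + cnj c * (\<alpha> * z))"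
    using automorphism_form[OF \<psi>] by blast
  have \<psi>lt: "cmod (\<psi> z) < 1" if "cmod z < 1" for z
    using \<psi> that bij_betwE unfolding disk_automorphism_def by fastforce
  \<comment> \<open>The functions whose composition with \<psi> stays in the space form a subspace,
    so the generators suffice.\<close>
  let ?S = "{f. restrict0 (ball 0 1) (f \<circ> \<psi>) \<in> V_disk m}"
  have S: "cfun.subspace ?S"
  proof (rule cfun.subspaceI)
    have "restrict0 (ball 0 1) ((0 :: complex \<Rightarrow> complex) \<circ> \<psi>) = 0" by (auto simp: restrict0_def)
    then show "0 \<in> ?S" using cfun.subspace_0[OF sub] by simp
    fix f g assume "f \<in> ?S" "g \<in> ?S"
    moreover have "restrict0 (ball 0 1) ((f + g) \<circ> \<psi>) = restrict0 (ball 0 1) (f \<circ> \<psi>) + restrict0 (ball 0 1) (g \<circ> \<psi>)"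
      by (auto simp: restrict0_def)
    ultimately show "f + g \<in> ?S" using cfun.subspace_add[OF sub] by simp
  next
    fix k f assume "f \<in> ?S"
    moreover have "restrict0 (ball 0 1) (fscale k f \<circ> \<psi>) = fscale k (restrict0 (ball 0 1) (f \<circ> \<psi>))"
      by (auto simp: restrict0_def fscale_def)
    ultimately show "fscale k f \<in> ?S" using cfun.subspace_scale[OF sub] by simp
  qed
  have "rho (E_Omega m a b) \<in> ?S" for a b
  proof -
    have "restrict0 (ball 0 1) (rho (E_Omega m a b) \<circ> \<psi>) =
      fscale ((cnj \<alpha> / (1 - c * cnj c)) ^ m) (rho (E_Omega m (a - b * c) (\<alpha> * (b - a * cnj c))))"
    proof
      fix z
      show "restrict0 (ball 0 1) (rho (E_Omega m a b) \<circ> \<psi>) z =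
        fscale ((cnj \<alpha> / (1 - c * cnj c)) ^ m) (rho (E_Omega m (a - b * c) (\<alpha> * (b - a * cnj c)))) z"
      proof (cases "cmod z < 1")
        case True
        have "rho (E_Omega m a b) (\<psi> z) = X_ab a b (\<psi> z, cnj (\<psi> z)) ^ m"
          by (rule rho_E[OF \<psi>lt[OF True]])
        also have "\<dots> = (cnj \<alpha> / (1 - c * cnj c)) ^ m * X_ab (a - b * c) (\<alpha> * (b - a * cnj c)) (z, cnj z) ^ m"
          unfolding form[OF True] X_ab_automorphism[OF \<alpha> c True] by (rule power_mult_distrib)
        finally show ?thesis using True by (simp add: restrict0_def fscale_def rho_E)
      next
        case False
        then show ?thesis by (simp add: restrict0_def fscale_def rho_eq)
      qed
    qed
    moreover have "rho (E_Omega m (a - b * c) (\<alpha> * (b - a * cnj c))) \<in> V_disk m"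
      unfolding V_disk_def by (rule imageI[OF E_Omega_X_eig])
    ultimately show ?thesis using cfun.subspace_scale[OF sub] by simp
  qed
  then have "V_disk m \<subseteq> ?S"
    unfolding V_disk_span_E by (intro cfun.span_minimal[OF _ S[unfolded V_disk_span_E]]) auto
  then show ?thesis using f by blast
qed

lemma V_disk_X_disk: "V_disk m \<subseteq> X_disk (eigval m)"
  unfolding V_disk_def by (auto intro: rho_X_disk)

lemma V_disk_moebius: "moebius_invariant_subspace (eigval m) (V_disk m)"
  unfolding moebius_invariant_subspace_def
proof (intro conjI ballI allI impI)
  show "cfun.subspace (V_disk m)" unfolding V_disk_span by (rule cfun.subspace_span)
  show "closedin (loc_unif_topology (ball 0 1) (X_disk (eigval m))) (V_disk m)"
    using closed_span_X_disk[of "rho ` e_Omega m ` {..2 * m}" "eigval m"] V_disk_X_disk[of m]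
    by (simp add: V_disk_span)
qed (rule V_disk_invariant)

section \<open>The finite-dimensional invariant space is proper and unique\<close>

lemma e_Omega_half: "j \<le> 2 * m \<Longrightarrow> e_Omega m j (Some (1/2), Some (1/2)) \<noteq> 0"
  using lift_std[of "(1/2, 1/2)" "(-1)^m" "e0 m j"] e0_half_nonzero[of j m] by (simp add: e_Omega_def std_chart.simps)

lemma V_disk_nonzero: "V_disk m \<noteq> {\<lambda>_. 0}"
proof
  assume "V_disk m = {\<lambda>_. 0}"
  then have "rho (e_Omega m m) = (\<lambda>_. 0)"
    using e_Omega_X_eig[of m m] by (auto simp: V_disk_def)
  then have "rho (e_Omega m m) (1/2) = 0" by simp
  then show False using e_Omega_half[of m m] by (simp add: rho_eq restrict0_def std_chart.simps)
qed

text \<open>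
  The eigenfunctions in \<open>V_disk m\<close> grow at most like \<open>(1 - r)\<^sup>-\<^sup>m\<close> at the boundary point \<open>1\<close>; the
  eigenfunction below, a power of the Poisson kernel, grows like \<open>(1 - r)\<^sup>-\<^sup>m\<^sup>-\<^sup>1\<close>.
\<close>

lemma V_disk_not_all: "V_disk m \<noteq> X_disk (eigval m)"
proof
  assume eq: "V_disk m = X_disk (eigval m)"
  let ?U = "ball 0 1 \<times> ball 0 1 :: (complex \<times> complex) set"
  \<comment> \<open>On the diagonal 1 / \<open>X_ab 1 1\<close> is minus the Poisson kernel of the
    boundary point 1, and s = -(m + 1) gives the same eigenvalue 4s(s + 1) as s = m.\<close>
  let ?Q = "\<lambda>p. (1 / X_ab 1 1 p) ^ Suc m"
  have U: "open ?U" by (intro open_Times open_ball)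
  have X0: "X_ab 1 1 p \<noteq> 0" if "p \<in> ?U" for p
    using that ball_UO by (auto simp: X_ab_def subset_iff)
  have "restrict0 (ball 0 1) (\<lambda>z. ?Q (z, cnj z)) \<in> X_disk (eigval m)"
  proof (rule diagonal_X_disk)
    show "sep_holomorphic ?Q ?U"
      by (intro sep_power sep_divide sep_const sep_X_ab ball_UO X0)
    fix p assume p: "p \<in> ?U"
    let ?x = "X_ab 1 1 p"
    have "LF (\<lambda>p. (1 / X_ab 1 1 p) ^ Suc m) p = 4 * (?x\<^sup>2 * (of_nat (Suc m) * of_nat (Suc (Suc m)) * (1 / ?x) ^ Suc (Suc (Suc m))) + 2 * ?x * (- of_nat (Suc m) * (1 / ?x) ^ Suc (Suc m)))"
    proof (rule LF_X_ab[OF U ball_UO p, where \<phi> = "\<lambda>x. (1 / x) ^ Suc m" and \<phi>' = "\<lambda>x. - of_nat (Suc m) * (1 / x) ^ Suc (Suc m)"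
          and \<phi>'' = "\<lambda>x. of_nat (Suc m) * of_nat (Suc (Suc m)) * (1 / x) ^ Suc (Suc (Suc m))"])
      have dp: "((\<lambda>x. (1 / x) ^ Suc k) has_field_derivative - of_nat (Suc k) * (1 / x) ^ Suc (Suc k)) (at x)" if "x \<noteq> 0" for x :: complex and k
      proof -
        have "((\<lambda>x. 1 / x) has_field_derivative - (1 / x)\<^sup>2) (at x)"
          using that by (auto intro!: derivative_eq_intros simp: power2_eq_square)
        from DERIV_power[OF this, of "Suc k"] show ?thesis
          by (simp add: power2_eq_square mult_ac del: of_nat_Suc)
      qed
      fix q assume q: "q \<in> ?U"
      show "((\<lambda>x. (1 / x) ^ Suc m) has_field_derivative - of_nat (Suc m) * (1 / X_ab 1 1 q) ^ Suc (Suc m)) (at (X_ab 1 1 q))"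
        by (rule dp[OF X0[OF q]])
      show "((\<lambda>x. - of_nat (Suc m) * (1 / x) ^ Suc (Suc m)) has_field_derivative
         of_nat (Suc m) * of_nat (Suc (Suc m)) * (1 / X_ab 1 1 q) ^ Suc (Suc (Suc m))) (at (X_ab 1 1 q))"
        using DERIV_cmult[OF dp[OF X0[OF q], of "Suc m"], of "- of_nat (Suc m)"] by (simp only: mult_minus_left mult_minus_right minus_minus mult.assoc)
    qed
    also have "\<dots> = eigval m * (1 / ?x) ^ Suc m"
    proof -
      have "?x\<^sup>2 * (1 / ?x) ^ Suc (Suc (Suc m)) = (1 / ?x) ^ Suc m" "?x * (1 / ?x) ^ Suc (Suc m) = (1 / ?x) ^ Suc m"
        using X0[OF p] by (simp_all add: power2_eq_square)
      then have "4 * (?x\<^sup>2 * (of_nat (Suc m) * of_nat (Suc (Suc m)) * (1 / ?x) ^ Suc (Suc (Suc m))) + 2 * ?x * (- of_nat (Suc m) * (1 / ?x) ^ Suc (Suc m)))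
        = 4 * (of_nat (Suc m) * of_nat (Suc (Suc m)) * (1 / ?x) ^ Suc m - 2 * of_nat (Suc m) * (1 / ?x) ^ Suc m)"
        by (metis (no_types, opaque_lifting) mult.assoc mult.left_commute mult_minus_left mult_minus_right diff_conv_add_uminus)
      also have "\<dots> = eigval m * (1 / ?x) ^ Suc m" by (simp add: algebra_simps del: power_Suc)
      finally show ?thesis .
    qed
    finally show "LF ?Q p = eigval m * ?Q p" .
  qed
  then have QV: "restrict0 (ball 0 1) (\<lambda>z. ?Q (z, cnj z)) \<in> V_disk m" using eq by simp
  \<comment> \<open>Growth of order at most (1 - r)^(-m) along the radius to 1, stated with the
    factor (1 - r^2)^m that is the denominator of \<open>e0 m j\<close>.\<close>
  let ?S = "{f :: complex \<Rightarrow> complex. \<exists>C. \<forall>r::real. 0 < r \<and> r < 1 \<longrightarrow> cmod (f (of_real r) * of_real ((1 - r\<^sup>2) ^ m)) \<le> C}"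
  have S: "cfun.subspace ?S"
  proof (rule cfun.subspaceI)
    show "0 \<in> ?S" by (auto intro!: exI[of _ 0])
    fix f g assume "f \<in> ?S" "g \<in> ?S"
    then obtain C D where CD: "\<And>r. 0 < r \<Longrightarrow> r < 1 \<Longrightarrow> cmod (f (of_real r) * of_real ((1 - r\<^sup>2) ^ m)) \<le> C"
      "\<And>r. 0 < r \<Longrightarrow> r < 1 \<Longrightarrow> cmod (g (of_real r) * of_real ((1 - r\<^sup>2) ^ m)) \<le> D" by blast
    have "cmod ((f + g) (of_real r) * of_real ((1 - r\<^sup>2) ^ m)) \<le> C + D" if "0 < r" "r < 1" for r
      using norm_triangle_mono[OF CD(1)[OF that] CD(2)[OF that]] by (simp add: distrib_right)
    then show "f + g \<in> ?S" by blast
  next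
    fix k f assume "f \<in> ?S"
    then obtain C where C: "\<And>r. 0 < r \<Longrightarrow> r < 1 \<Longrightarrow> cmod (f (of_real r) * of_real ((1 - r\<^sup>2) ^ m)) \<le> C" by blast
    have "cmod (fscale k f (of_real r) * of_real ((1 - r\<^sup>2) ^ m)) \<le> cmod k * C" if "0 < r" "r < 1" for r
      using mult_left_mono[OF C[OF that] norm_ge_zero[of k]] by (simp add: fscale_def norm_mult mult.assoc)
    then show "fscale k f \<in> ?S" by blast
  qed
  have "rho (e_Omega m j) \<in> ?S" if "j \<le> 2 * m" for j
  proof -
    let ?N = "\<lambda>z. \<Sum>i\<le>m. \<Sum>k\<le>m. if i + k = j then of_nat (m choose i) * of_nat (m choose k) * z ^ (m - i) * z ^ k else 0 :: complex"
    have "continuous_on (cball 0 1) (\<lambda>z::complex. if i + k = j then of_nat (m choose i) * of_nat (m choose k) * z ^ (m - i) * z ^ k else 0 :: complex)" for i k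
      by (cases "i + k = j") (auto intro!: continuous_intros)
    then have "compact (?N ` cball 0 1)"
      by (intro compact_continuous_image continuous_on_sum compact_cball)
    from compact_imp_bounded[OF this] obtain C where C': "\<forall>x\<in>?N ` cball 0 1. cmod x \<le> C"
      unfolding bounded_iff by (rule exE)
    have C: "cmod (?N z) \<le> C" if "z \<in> cball 0 1" for z
      by (rule bspec[OF C' imageI[OF that]])
    have "cmod (rho (e_Omega m j) (of_real r) * of_real ((1 - r\<^sup>2) ^ m)) \<le> C" if r: "0 < r" "r < 1" for r
    proof -
      have r2: "r\<^sup>2 < 1" using r by (simp add: power_less_one_iff)
      have "(of_real r * of_real r :: complex) \<noteq> 1"
        using r2 by (metis of_real_mult of_real_eq_1_iff power2_eq_square less_irrefl)
      then have "rho (e_Omega m j) (of_real r) = e0 m j (of_real r, of_real r)"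
        using r lift_std[of "(of_real r, of_real r)"] by (simp add: rho_eq restrict0_def e_Omega_def)
      also have "\<dots> = ?N (of_real r) / of_real ((1 - r\<^sup>2) ^ m)"
        unfolding e0_def fst_conv snd_conv by (simp only: of_real_power of_real_diff of_real_1 power2_eq_square of_real_mult)
      finally have q: "rho (e_Omega m j) (of_real r) = ?N (of_real r) / of_real ((1 - r\<^sup>2) ^ m)" .
      have nz: "complex_of_real ((1 - r\<^sup>2) ^ m) \<noteq> 0"
        unfolding of_real_eq_0_iff using r2 by simp
      have "rho (e_Omega m j) (of_real r) * of_real ((1 - r\<^sup>2) ^ m) = ?N (of_real r)"
        by (rule nonzero_eq_divide_eq[OF nz, THEN iffD1, OF q])
      then show ?thesis using C[of "of_real r"] r by simp
    qed
    then show ?thesis by blast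
  qed
  then have "V_disk m \<subseteq> ?S"
    unfolding V_disk_span by (intro cfun.span_minimal[OF _ S]) auto
  then obtain C where C: "\<And>r. 0 < r \<Longrightarrow> r < 1 \<Longrightarrow> cmod (restrict0 (ball 0 1) (\<lambda>z. ?Q (z, cnj z)) (of_real r) * of_real ((1 - r\<^sup>2) ^ m)) \<le> C"
    using QV by blast
  \<comment> \<open>Chosen so that 1 / (1 - r) = |C| + 2, which exceeds the supposed bound
    C.\<close>
  define r where "r = 1 - 1 / (\<bar>C\<bar> + 2)"
  have r: "0 < r" "r < 1" by (auto simp: r_def field_simps)
  have r2: "1 - r\<^sup>2 = (1 - r) * (1 + r)" by (simp add: power2_eq_square algebra_simps)
  have X: "X_ab 1 1 (of_real r, of_real r) = - of_real ((1 - r) / (1 + r))"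
  proof -
    have "X_ab 1 1 (of_real r, of_real r) = complex_of_real (- ((1 - r) * (1 - r)) / ((1 - r) * (1 + r)))"
      unfolding X_ab_def by (simp add: algebra_simps)
    also have "- ((1 - r) * (1 - r)) / ((1 - r) * (1 + r)) = - ((1 - r) / (1 + r))" using r by simp
    finally show ?thesis by simp
  qed
  have "cmod (restrict0 (ball 0 1) (\<lambda>z. ?Q (z, cnj z)) (of_real r) * of_real ((1 - r\<^sup>2) ^ m))
    = ((1 + r) / (1 - r)) ^ Suc m * ((1 - r) * (1 + r)) ^ m"
    unfolding r2 using r by (simp add: restrict0_def X norm_mult norm_power norm_divide del: power_Suc of_real_divide of_real_diff of_real_add of_real_mult of_real_power)
  also have "\<dots> = (1 + r) ^ m * (1 + r) ^ m * (1 + r) / (1 - r)"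
    using r by (simp add: power_divide power_mult_distrib)
  also have "\<dots> \<ge> 1 / (1 - r)"
  proof (rule divide_right_mono)
    have "1 \<le> (1 + r) ^ m" using r by (intro one_le_power) simp
    then have "1 * 1 * 1 \<le> (1 + r) ^ m * (1 + r) ^ m * (1 + r)" using r by (intro mult_mono) auto
    then show "1 \<le> (1 + r) ^ m * (1 + r) ^ m * (1 + r)" by simp
  qed (use r in simp)
  finally have "1 / (1 - r) \<le> C" using C[OF r] by linarith
  then show False by (simp add: r_def)
qed

text \<open>\<open>V_disk m\<close> settles existence. For uniqueness
  \<open>invariant_unique\<close> is applied to an arbitrary candidate and to
  \<open>V_disk m\<close>, with the same span as result.\<close>

lemma X0_disk_eq: "X0_disk (eigval m) = V_disk m"
  unfolding X0_disk_def
proof (rule the_equality)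
  have fd: "finite_dimensional (V_disk m)"
    unfolding finite_dimensional_def by (intro exI[of _ "rho ` e_Omega m ` {..2 * m}"] conjI V_disk_span) simp
  then show V: "moebius_invariant_subspace (eigval m) (V_disk m) \<and> V_disk m \<noteq> {\<lambda>_. 0} \<and> V_disk m \<noteq> X_disk (eigval m) \<and> finite_dimensional (V_disk m)"
    using V_disk_moebius V_disk_nonzero V_disk_not_all by blast
  show "Y = V_disk m" if "moebius_invariant_subspace (eigval m) Y \<and> Y \<noteq> {\<lambda>_. 0} \<and> Y \<noteq> X_disk (eigval m) \<and> finite_dimensional Y" for Y
  proof -
    have u: "Z = cfun.span ((\<lambda>j. (lie_A ^^ j) (top_vector m)) ` {..2 * m})"
      if "moebius_invariant_subspace (eigval m) Z \<and> Z \<noteq> {\<lambda>_. 0} \<and> Z \<noteq> X_disk (eigval m) \<and> finite_dimensional Z" for Z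
      by (rule invariant_unique) (use that in blast)+
    show ?thesis by (rule trans[OF u[OF that] u[OF V, symmetric]])
  qed
qed

section \<open>Maximal domains and the equivalences\<close>

text \<open>Subdomains lie in Omega by definition, so none is strictly larger, and an extension to
  Omega is all that maximality asks for.\<close>

lemma maximal_Omega:
  assumes "G \<in> Hol Omega" "\<And>p. p \<in> bidisk \<Longrightarrow> G p = F p"
  shows "maximal_domain_of_existence Omega F"
  unfolding maximal_domain_of_existence_def
proof (intro conjI allI impI subdomain_Omega bidisk_subset)
  show "\<exists>G\<in>Hol Omega. \<forall>p\<in>bidisk. G p = F p" using assms by blast
  fix D assume "subdomain D \<and> Omega \<subset> D"
  then show "\<not> (\<exists>G\<in>Hol D. \<forall>p\<in>bidisk. G p = F p)" unfolding subdomain_def by blast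
qed

lemma X_eig_restrict_bidisk:
  assumes F: "F \<in> X_eig lam Omega"
  shows "restrict0 bidisk F \<in> X_eig lam bidisk"
proof -
  have "laplace_zw (restrict0 bidisk F) p = lam * restrict0 bidisk F p" if "p \<in> bidisk" for p
  proof -
    obtain z w where p: "p = (Some z, Some w)" "cmod z < 1" "cmod w < 1"
      using \<open>p \<in> bidisk\<close> by (auto simp: bidisk_def std_chart.simps)
    have "laplace_zw (restrict0 bidisk F) p = LF (F \<circ> std_chart) (z, w)"
      using p by (simp, intro LF_cong[of "ball 0 1 \<times> ball 0 1"]) (auto simp: open_Times restrict0_def std_chart.simps)
    also have "\<dots> = lam * F p"
      using X_eig_OmegaD(2)[OF F, of "(z, w)"] bidisk_zw p by (simp add: std_chart.simps)
    finally show ?thesis using that by (simp add: restrict0_def)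
  qed
  then show ?thesis
    using Hol_restrict0[OF X_eig_OmegaD(1)[OF F] bidisk_subset] by (simp add: X_eig_def)
qed

text \<open>Injectivity of the restriction to the diagonal, in the form that recognises G as an
  extension of F from the bidisk.\<close>

lemma R_h_inj:
  assumes F: "F \<in> Hol bidisk" and G: "G \<in> Hol Omega" and eq: "R_h F = rho G" and p: "p \<in> bidisk"
  shows "G p = F p"
proof -
  obtain z w where zw: "p = (Some z, Some w)" "cmod z < 1" "cmod w < 1"
    using p by (auto simp: bidisk_def std_chart.simps)
  have s: "sep_holomorphic (\<lambda>p. (G \<circ> std_chart) p - (F \<circ> std_chart) p) (ball 0 1 \<times> ball 0 1)"
    by (rule sep_diff[OF sep_holomorphic_subset[OF G[unfolded Hol_Omega_iff, THEN conjunct2, THEN conjunct1] ball_UO] Hol_bidiskD(2)[OF F]])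
  have "(\<lambda>p. (G \<circ> std_chart) p - (F \<circ> std_chart) p) (z, w) = 0"
  proof (rule bidisk_identity[OF s _ zw(2,3)])
    fix z :: complex assume "cmod z < 1"
    then show "(G \<circ> std_chart) (z, cnj z) - (F \<circ> std_chart) (z, cnj z) = 0"
      using fun_cong[OF eq, of z] by (simp add: rho_eq R_h_def restrict0_def std_chart.simps)
  qed
  then show ?thesis by (simp add: zw std_chart.simps)
qed

theorem theorem2p5:
  fixes lam :: complex
  shows "((\<exists>F \<in> X_eig lam bidisk. F \<noteq> (\<lambda>_. 0) \<and> maximal_domain_of_existence Omega F) \<longleftrightarrow>
          (\<exists>g. C2_sphere g \<and> g \<noteq> (\<lambda>_. 0) \<and> (\<forall>z. laplace_sphere g z = lam * g z)))
       \<and> ((\<exists>g. C2_sphere g \<and> g \<noteq> (\<lambda>_. 0) \<and> (\<forall>z. laplace_sphere g z = lam * g z)) \<longleftrightarrow>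
          (\<exists>m::nat. lam = 4 * of_nat m * (of_nat m + 1)))
       \<and> (\<forall>m::nat. lam = 4 * of_nat m * (of_nat m + 1) \<longrightarrow>
            cfun.dim (X_eig lam Omega) = 2 * m + 1
          \<and> (\<forall>F \<in> X0_bidisk lam. maximal_domain_of_existence Omega F)
          \<and> X0_disk lam = R_h ` restrict0 bidisk ` X_eig lam Omega
          \<and> {g. C2_sphere g \<and> (\<forall>z. laplace_sphere g z = lam * g z)}
              = {(\<lambda>z. F (z, neg_cnj z)) | F. F \<in> X_eig lam Omega})"
proof -
  let ?i = "\<exists>F \<in> X_eig lam bidisk. F \<noteq> (\<lambda>_. 0) \<and> maximal_domain_of_existence Omega F"
  let ?ii = "\<exists>g. C2_sphere g \<and> g \<noteq> (\<lambda>_. 0) \<and> (\<forall>z. laplace_sphere g z = lam * g z)"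
  let ?iii = "\<exists>m::nat. lam = 4 * of_nat m * (of_nat m + 1)"
  have ii_iii: "?iii" if "?ii"
    using that S_eig_eigenvalue by (auto simp: S_eig_def)
  have i_ii: "?ii" if "?i"
  proof -
    obtain F G where F: "F \<in> X_eig lam bidisk" "F \<noteq> (\<lambda>_. 0)" and G: "G \<in> Hol Omega" "\<And>p. p \<in> bidisk \<Longrightarrow> G p = F p"
      using \<open>?i\<close> unfolding maximal_domain_of_existence_def by blast
    \<comment> \<open>Condition (i) yields only a holomorphic extension G; the eigenvalue equation
      for it comes from \<open>X_eig_Omega_extend\<close>.\<close>
    have "anti G \<in> S_eig lam" by (rule anti_S_eig[OF X_eig_Omega_extend[OF F(1) G]])
    moreover have "anti G \<noteq> (\<lambda>_. 0)"
    proof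
      assume "anti G = (\<lambda>_. 0)"
      then have "G = (\<lambda>_. 0)" by (rule anti_zero[OF G(1)])
      moreover have "F p = 0" if "p \<notin> bidisk" for p
        using F(1) that Hol_bidiskD(1) by (auto simp: X_eig_def)
      ultimately have "F p = 0" for p using G(2)[of p] by (cases "p \<in> bidisk") auto
      then show False using F(2) by auto
    qed
    ultimately show ?thesis unfolding S_eig_def by blast
  qed
  have iii_i: "?i" if "?iii"
  proof -
    obtain m where m: "lam = eigval m" using \<open>?iii\<close> by blast
    \<comment> \<open>Every basis function would do; the index m gives the one of rotation weight
      0.\<close>
    have e: "e_Omega m m \<in> X_eig lam Omega" unfolding m by (rule e_Omega_X_eig) simp
    show ?thesis
    proof (intro bexI conjI)
      show "restrict0 bidisk (e_Omega m m) \<in> X_eig lam bidisk" by (rule X_eig_restrict_bidisk[OF e])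
      show "restrict0 bidisk (e_Omega m m) \<noteq> (\<lambda>_. 0)"
      proof
        assume "restrict0 bidisk (e_Omega m m) = (\<lambda>_. 0)"
        then have "restrict0 bidisk (e_Omega m m) (Some (1/2), Some (1/2)) = 0" by simp
        then show False using e_Omega_half[of m m] by (simp add: restrict0_def)
      qed
      show "maximal_domain_of_existence Omega (restrict0 bidisk (e_Omega m m))"
        by (rule maximal_Omega[OF X_eig_OmegaD(1)[OF e]]) (simp add: restrict0_def)
    qed
  qed
  have main: "cfun.dim (X_eig lam Omega) = 2 * m + 1
          \<and> (\<forall>F \<in> X0_bidisk lam. maximal_domain_of_existence Omega F)
          \<and> X0_disk lam = R_h ` restrict0 bidisk ` X_eig lam Omega
          \<and> {g. C2_sphere g \<and> (\<forall>z. laplace_sphere g z = lam * g z)}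
              = {(\<lambda>z. F (z, neg_cnj z)) | F. F \<in> X_eig lam Omega}" if m: "lam = eigval m" for m
  proof (intro conjI ballI)
    show "cfun.dim (X_eig lam Omega) = 2 * m + 1" unfolding m by (rule dim_X_eig_Omega)
    show "X0_disk lam = R_h ` restrict0 bidisk ` X_eig lam Omega"
      unfolding m X0_disk_eq V_disk_def by (simp add: rho_def[abs_def] image_image)
    show "{g. C2_sphere g \<and> (\<forall>z. laplace_sphere g z = lam * g z)} = {(\<lambda>z. F (z, neg_cnj z)) | F. F \<in> X_eig lam Omega}"
      using S_eig_eq[of m] unfolding m S_eig_def anti_def[abs_def] by blast
    fix F assume "F \<in> X0_bidisk lam"
    then have F: "F \<in> Hol bidisk" "R_h F \<in> V_disk m"
      by (auto simp: X0_bidisk_def X_eig_def m X0_disk_eq)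
    \<comment> \<open>Some eigenfunction on Omega has the same diagonal values as F, and by
      \<open>R_h_inj\<close> it extends F.\<close>
    then obtain G where G: "G \<in> X_eig lam Omega" "R_h F = rho G" by (auto simp: V_disk_def m)
    show "maximal_domain_of_existence Omega F"
      by (rule maximal_Omega[OF X_eig_OmegaD(1)[OF G(1)]]) (rule R_h_inj[OF F(1) X_eig_OmegaD(1)[OF G(1)] G(2)])
  qed
  show ?thesis using ii_iii i_ii iii_i main by blast
qed

end
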